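(* $\mathcal{M}_P(\Delta^3)\simeq\mathcal{M}_P(\partial\Delta^3)\simeq\bigvee^{81}S^3$.
   Context: All simplicial complexes are finite abstract simplicial complexes; simplices are nonempty. $\Delta^3$ is the simplicial complex of all nonempty subsets of a $4$-element vertex set and $\partial\Delta^3$ its subcomplex of proper nonempty subsets. The Hasse diagram $\mathcal{H}(K)$ of $K$ is the directed graph whose vertices are the simplices of $K$, with an edge $\sigma\to\tau$ whenever $\sigma\subsetneq\tau$ and $\dim\tau=\dim\sigma+1$. A matching on $\mathcal{H}(K)$ is a set $W$ of edges of $\mathcal{H}(K)$, no two sharing a vertex. $W$ is acyclic if the directed graph obtained from $\mathcal{H}(K)$ by reversing every edge in $W$ has no directed cycle. The complex of discrete Morse matchings $\mathcal{M}(K)$ is the simplicial complex whose vertices are the edges of $\mathcal{H}(K)$ and whose simplices are the nonempty acyclic matchings on $\mathcal{H}(K)$. The pure complex $\mathcal{M}_P(K)$ is the subcomplex of $\mathcal{M}(K)$ generated by (consisting of all faces of) the simplices of $\mathcal{M}(K)$ of maximum dimension, i.e. the acyclic matchings of maximum cardinality. *)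

theory Defs
  imports "HOL-Analysis.Analysis"
begin

text \<open>Finite abstract simplicial complexes are represented as sets of (finite, nonempty)
  vertex sets.\<close>

definition full_simplex3 :: "nat set set" where
  "full_simplex3 = {\<sigma>. \<sigma> \<noteq> {} \<and> \<sigma> \<subseteq> {0..3}}"

definition boundary_simplex3 :: "nat set set" where
  "boundary_simplex3 = {\<sigma>. \<sigma> \<noteq> {} \<and> \<sigma> \<subseteq> {0..3} \<and> \<sigma> \<noteq> {0..3}}"

definition hasse_edges :: "'a set set \<Rightarrow> ('a set \<times> 'a set) set" where
  "hasse_edges K = {(\<sigma>, \<tau>). \<sigma> \<in> K \<and> \<tau> \<in> K \<and> \<sigma> \<subset> \<tau> \<and> card \<tau> = card \<sigma> + 1}"

definition is_matching :: "'a set set \<Rightarrow> ('a set \<times> 'a set) set \<Rightarrow> bool" where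
  "is_matching K W \<longleftrightarrow> W \<subseteq> hasse_edges K \<and>
     (\<forall>e\<in>W. \<forall>e'\<in>W. e \<noteq> e' \<longrightarrow>
        {fst e, snd e} \<inter> {fst e', snd e'} = {})"

definition modified_hasse :: "'a set set \<Rightarrow> ('a set \<times> 'a set) set \<Rightarrow> ('a set \<times> 'a set) set" where
  "modified_hasse K W = (hasse_edges K - W) \<union> converse W"

definition acyclic_matching :: "'a set set \<Rightarrow> ('a set \<times> 'a set) set \<Rightarrow> bool" where
  "acyclic_matching K W \<longleftrightarrow> is_matching K W \<and> acyclic (modified_hasse K W)"

definition morse_complex :: "'a set set \<Rightarrow> ('a set \<times> 'a set) set set" where
  "morse_complex K = {W. W \<noteq> {} \<and> acyclic_matching K W}"

definition pure_morse_complex :: "'a set set \<Rightarrow> ('a set \<times> 'a set) set set" where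
  "pure_morse_complex K =
     {W. W \<noteq> {} \<and> (\<exists>U\<in>morse_complex K.
          W \<subseteq> U \<and> (\<forall>U'\<in>morse_complex K. card U' \<le> card U))}"

text \<open>Geometric realization of a finite simplicial complex C, as a subspace of
  the product space of real-valued functions on the vertex type (barycentric coordinates).\<close>
definition realization :: "'v set set \<Rightarrow> ('v \<Rightarrow> real) topology" where
  "realization C = subtopology (powertop_real UNIV)
     {f. \<exists>\<sigma>\<in>C. (\<forall>v. v \<notin> \<sigma> \<longrightarrow> f v = 0) \<and> (\<forall>v\<in>\<sigma>. 0 \<le> f v) \<and> sum f \<sigma> = 1}"

text \<open>Wedge of k copies of S^n: the i-th sphere is the unit sphere centred at e_(i,0)
  inside the (n+1)-dimensional coordinate block {i} x {0..n}; all spheres meet only at 0.\<close>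
definition wedge_spheres :: "nat \<Rightarrow> nat \<Rightarrow> (nat \<times> nat \<Rightarrow> real) topology" where
  "wedge_spheres k n = subtopology (powertop_real UNIV)
     {x. \<exists>i<k. (\<forall>p. fst p \<noteq> i \<or> snd p > n \<longrightarrow> x p = 0) \<and>
              (\<Sum>j\<le>n. (x (i, j) - (if j = 0 then 1 else 0))\<^sup>2) = 1}"

end

theory Submission
  imports Defs
begin

text \<open>
  A maximum acyclic matching on the boundary of the tetrahedron is a pair of a rooted spanning
  tree of \<open>K\<^sub>4\<close> (matching vertices with edges) and a rooted spanning tree of the dual \<open>K\<^sub>4\<close>
  (matching edges with triangles) using complementary edges; on the full simplex the dual root is
  moreover matched with the solid tetrahedron. So both pure complexes are generated by the same 256
  pairs. If the link of a simplex is collapsible, deleting the open star of the simplex preserves the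
  homotopy type. Deleting in this way all vertices coming from the solid tetrahedron and all
  pairs of arcs of the primal tree leaves, in both cases, one and the same 3-dimensional complex.
  This complex becomes collapsible after removal of 81 suitable 3-simplices, and a complex
  that arises from a contractible one by attaching maximal simplices is a wedge of spheres.
\<close>

section \<open>Collapses\<close>

text \<open>The number 81 is forced by counting. The labels \<open>Q\<close> alone form the complex
  of rooted forests on four points; it has 12, 48 and 64 faces with 1, 2 and 3 arcs, so its reduced
  Euler characteristic is -1 + 12 - 48 + 64 = 27. Each of the 12 possible primal arcs adds a cone
  over its link in that complex, and a link that collapses after losing nine triangles has reduced
  Euler characteristic 9. The total is 27 - 12 * 9 = -81, as it should be for 81 spheres of odd
  dimension. The three arcs into \<open>P0\<close> are a choice whose cones use up all of the 27:
  the forest complex with these cones is collapsible. The other nine arcs keep nine cells each. No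
  cells can be chosen in the given complexes, whose facets have dimension 5 and 6 while the spheres
  have dimension 3. The drop in dimension is possible because the dual part of the link is
  collapsible for two or more arcs and for every set of primal labels with a label \<open>T\<close>,
  though not for a single arc. Each such dual part is generated by a set of dual trees, so these
  checks run on complexes of dimension at most 2.\<close>

definition geom :: "'v set set \<Rightarrow> ('v \<Rightarrow> real) set" where
  "geom K = {f. \<exists>\<sigma>\<in>K. (\<forall>v. v \<notin> \<sigma> \<longrightarrow> f v = 0) \<and> (\<forall>v\<in>\<sigma>. 0 \<le> f v) \<and> sum f \<sigma> = 1}"

lemma realization_eq_geom: "realization K = top_of_set (geom K)"
  by (simp add: realization_def geom_def euclidean_product_topology)

lemma geomI:
  "\<lbrakk>\<sigma> \<in> K; \<And>v. v \<notin> \<sigma> \<Longrightarrow> f v = 0; \<And>v. 0 \<le> f v; sum f \<sigma> = 1\<rbrakk> \<Longrightarrow> f \<in> geom K"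
  by (auto simp: geom_def)

lemma geomE:
  assumes "f \<in> geom K"
  obtains \<sigma> where "\<sigma> \<in> K" "\<And>v. v \<notin> \<sigma> \<Longrightarrow> f v = 0" "\<And>v. 0 \<le> f v" "sum f \<sigma> = 1" "finite \<sigma>"
proof -
  obtain \<sigma> where \<sigma>: "\<sigma> \<in> K" "\<forall>v. v \<notin> \<sigma> \<longrightarrow> f v = 0" "\<forall>v\<in>\<sigma>. 0 \<le> f v" "sum f \<sigma> = 1"
    using assms by (auto simp: geom_def)
  show thesis
  proof
    show "0 \<le> f v" for v using \<sigma> by (cases "v \<in> \<sigma>") auto
    show "finite \<sigma>" using \<sigma>(4) by (rule_tac ccontr) simp
  qed (use \<sigma> in auto)
qed

lemma geom_mono: "K \<subseteq> L \<Longrightarrow> geom K \<subseteq> geom L"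
  unfolding geom_def by blast

lemma geom_insert_empty: "geom (insert {} K) = geom K"
  by (simp add: geom_def)

lemma homotopic_top_of_setI:
  assumes "continuous_on ({0..1} \<times> S) (\<lambda>z. h (fst z) (snd z))"
    and "\<And>t x. \<lbrakk>0 \<le> t; t \<le> (1::real); x \<in> S\<rbrakk> \<Longrightarrow> h t x \<in> T"
    and "\<And>x. x \<in> S \<Longrightarrow> h 0 x = f x" and "\<And>x. x \<in> S \<Longrightarrow> h 1 x = g x"
  shows "homotopic_with (\<lambda>_. True) (top_of_set S) (top_of_set T) f g"
  using assms by (subst homotopic_with) (auto intro!: exI[of _ "\<lambda>z. h (fst z) (snd z)"])

lemma continuous_on_Min_image:
  fixes f :: "'a \<Rightarrow> 'b::topological_space \<Rightarrow> 'c::linorder_topology"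
  assumes "finite I" "I \<noteq> {}" "\<And>i. i \<in> I \<Longrightarrow> continuous_on S (f i)"
  shows "continuous_on S (\<lambda>x. Min ((\<lambda>i. f i x) ` I))"
  using assms
proof (induction I rule: finite_ne_induct)
  case (insert i I)
  then have "(\<lambda>x. Min ((\<lambda>i. f i x) ` insert i I)) = (\<lambda>x. min (f i x) (Min ((\<lambda>i. f i x) ` I)))"
    by simp
  with insert show ?case by (auto intro!: continuous_intros)
qed auto

lemma continuous_on_coordinate [continuous_intros]:
  "continuous_on S (\<lambda>f. f v)" for S :: "('v \<Rightarrow> 'a::topological_space) set"
  by (rule continuous_on_product_then_coordinatewise) (rule continuous_on_id)

lemma continuous_on_snd_coordinate [continuous_intros]:
  "continuous_on S (\<lambda>z. snd z v)" for S :: "('b::topological_space \<times> ('v \<Rightarrow> 'a::topological_space)) set"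
  by (rule continuous_on_product_then_coordinatewise) (intro continuous_intros)

lemma Min_coordinates_eq_0:
  fixes f :: "'v \<Rightarrow> real"
  assumes "finite \<sigma>" "\<And>v. 0 \<le> f v" "v \<in> \<sigma>" "f v = 0"
  shows "Min (f ` \<sigma>) = 0"
  using assms by (intro Min_eqI) auto

text \<open>The empty face belongs to every nonempty complex here. \<open>geom\<close> does not see
  it, as an empty sum is not 1, and it serves as the face whose open star is the whole
  complex.\<close>

definition is_complex :: "'v set set \<Rightarrow> bool" where
  "is_complex K \<longleftrightarrow> (\<forall>\<rho>\<in>K. finite \<rho> \<and> Pow \<rho> \<subseteq> K)"

lemma is_complexD: "\<lbrakk>is_complex K; \<rho> \<in> K; \<tau> \<subseteq> \<rho>\<rbrakk> \<Longrightarrow> \<tau> \<in> K"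
  by (auto simp: is_complex_def)

definition minus_star :: "'v set set \<Rightarrow> 'v set \<Rightarrow> 'v set set" where
  "minus_star K \<sigma> = {\<rho> \<in> K. \<not> \<sigma> \<subseteq> \<rho>}"

lemma is_complex_minus_star: "is_complex K \<Longrightarrow> is_complex (minus_star K \<sigma>)"
  by (fastforce simp: is_complex_def minus_star_def)

text \<open>On a simplex containing \<open>\<sigma>\<close> the retraction moves the weight \<open>m = min\<^sub>\<sigma> f\<close> from
  each vertex of \<open>\<sigma>\<close> to \<open>w\<close>; as \<open>m = 0\<close> on every simplex not containing \<open>\<sigma>\<close>,
  one formula serves for the whole is_complex.\<close>

lemma geom_minus_star:
  assumes K: "is_complex K" and \<sigma>: "\<sigma> \<noteq> {}" "w \<notin> \<sigma>"
    and apex: "\<And>\<rho>. \<lbrakk>\<rho> \<in> K; \<sigma> \<subseteq> \<rho>\<rbrakk> \<Longrightarrow> insert w \<rho> \<in> K"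
  shows "top_of_set (geom K) homotopy_equivalent_space top_of_set (geom (minus_star K \<sigma>))"
proof (cases "finite \<sigma>")
  case False
  have "minus_star K \<sigma> = K"
    using K False by (auto simp: minus_star_def is_complex_def dest: finite_subset)
  then show ?thesis by (simp add: homotopy_equivalent_space_refl)
next
  case fin: True
  define m where "m f = Min (f ` \<sigma>)" for f :: "'a \<Rightarrow> real"
  define push where "push t f v = f v + t * m f * ((if v = w then real (card \<sigma>) else 0) - (if v \<in> \<sigma> then 1 else 0))"
    for t f v
  have m_le: "m f \<le> f v" if "v \<in> \<sigma>" for f v
    using fin that by (simp add: m_def)
  have m_eq_0: "m f = 0" if "\<not> \<sigma> \<subseteq> \<rho>" "\<And>v. v \<notin> \<rho> \<Longrightarrow> f v = 0" "\<And>v. 0 \<le> f v" for f \<rho>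
    using that Min_coordinates_eq_0[OF fin] by (auto simp: m_def)
  have push_mem: "push t f \<in> geom K \<and> (t = 1 \<longrightarrow> push t f \<in> geom (minus_star K \<sigma>))"
    if f: "f \<in> geom K" and t: "0 \<le> t" "t \<le> 1" for t f
  proof -
    obtain \<rho> where \<rho>: "\<rho> \<in> K" "\<And>v. v \<notin> \<rho> \<Longrightarrow> f v = 0" "\<And>v. 0 \<le> f v" "sum f \<rho> = 1" "finite \<rho>"
      using f by (elim geomE) blast
    show ?thesis
    proof (cases "\<sigma> \<subseteq> \<rho>")
      case False
      then have "push t f = f"
        using m_eq_0[of \<rho> f] \<rho> by (simp add: push_def fun_eq_iff)
      moreover have "f \<in> geom (minus_star K \<sigma>)"
        using \<rho> False by (intro geomI[of \<rho>]) (auto simp: minus_star_def)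
      ultimately show ?thesis using f by auto
    next
      case True
      have m0: "0 \<le> m f" using \<rho>(3) fin \<sigma> by (simp add: m_def)
      have nonneg: "0 \<le> push t f v" for v
      proof (cases "v \<in> \<sigma>")
        case True
        then have "t * m f \<le> f v"
          using m_le[OF True, of f] m0 t by (meson mult_left_le_one_le order_trans)
        then show ?thesis using True \<sigma> \<rho>(3)[of v] by (auto simp: push_def)
      next
        case False
        then show ?thesis using m0 t \<rho>(3)[of v] by (simp add: push_def)
      qed
      have outside: "push t f v = 0" if "v \<notin> insert w \<rho>" for v
        using that True \<rho>(2) by (auto simp: push_def)
      have sum1: "sum (push t f) (insert w \<rho>) = 1"
      proof -
        have "sum f (insert w \<rho>) = 1"
          using \<rho> by (cases "w \<in> \<rho>") (auto simp: insert_absorb)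
        moreover have "(\<Sum>v\<in>insert w \<rho>. (if v = w then real (card \<sigma>) else 0) - (if v \<in> \<sigma> then 1 else 0)) = 0"
        proof -
          have "insert w \<rho> \<inter> \<sigma> = \<sigma>" using True by auto
          then show ?thesis
            using \<rho>(5) by (simp add: sum_subtractf sum.If_cases del: sum.insert)
        qed
        ultimately show ?thesis
          by (simp add: push_def sum.distrib flip: sum_distrib_left del: sum.insert)
      qed
      have wK: "insert w \<rho> \<in> K" using apex \<rho> True by blast
      have "push t f \<in> geom K"
        using wK outside nonneg sum1 by (rule geomI)
      moreover have "push 1 f \<in> geom (minus_star K \<sigma>)" if t1: "t = 1"
      proof -
        \<comment> \<open>At time 1 a vertex \<open>v0\<close> where the minimum is attained has
          lost all its weight, so the support no longer contains \<open>\<sigma>\<close>.\<close>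
        have "m f \<in> f ` \<sigma>" using fin \<sigma> by (simp add: m_def)
        then obtain v0 where v0: "v0 \<in> \<sigma>" "f v0 = m f" by auto
        then have z: "push 1 f v0 = 0" using \<sigma> by (auto simp: push_def)
        show ?thesis
        proof (rule geomI)
          show "insert w \<rho> - {v0} \<in> minus_star K \<sigma>"
            using wK K v0 by (auto simp: minus_star_def is_complex_def)
          show "push 1 f v = 0" if "v \<notin> insert w \<rho> - {v0}" for v
            using outside z that t1 by blast
          show "0 \<le> push 1 f v" for v using nonneg t1 by simp
          show "sum (push 1 f) (insert w \<rho> - {v0}) = 1"
            using sum1 z \<rho>(5) t1 v0 True by (subst sum_diff) auto
        qed
      qed
      ultimately show ?thesis by simp
    qed
  qed
  have fixed: "push t f = f" if "f \<in> geom (minus_star K \<sigma>)" for t f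
    using that m_eq_0[of _ f] by (auto simp: push_def fun_eq_iff minus_star_def elim!: geomE)
  have cont: "continuous_on ({0..1} \<times> geom K) (\<lambda>z. push (fst z) (snd z))"
    unfolding push_def m_def
    by (intro continuous_intros continuous_on_Min_image fin \<sigma>)
  show ?thesis
  proof (rule deformation_retract_imp_homotopy_equivalent_space)
    show "homotopic_with (\<lambda>x. True) (top_of_set (geom K)) (top_of_set (geom K)) (push 1) id"
      using cont push_mem
      by (intro homotopic_with_symD[OF homotopic_top_of_setI[of _ push]]) (auto simp: push_def)
    have "continuous_on (geom K) (\<lambda>f. (1::real, f))"
      by (intro continuous_intros)
    then have "continuous_on (geom K) (\<lambda>f. push (fst (1::real, f)) (snd (1::real, f)))"
      by (rule continuous_on_compose2[OF cont]) auto
    then have "continuous_on (geom K) (push 1)" by simp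
    moreover have "geom (minus_star K \<sigma>) \<subseteq> geom K"
      by (intro geom_mono) (auto simp: minus_star_def)
    ultimately show "retraction_maps (top_of_set (geom K)) (top_of_set (geom (minus_star K \<sigma>))) (push 1) id"
      using push_mem[where t = 1] fixed by (auto simp: retraction_maps_def)
  qed
qed

text \<open>With \<open>\<sigma> = {}\<close> the step removes a whole cone with apex
  \<open>w\<close>, including its empty face. Hence the base case is the void complex and not a
  point; a nonempty complex keeps its empty face until such a cone step occurs. The void complex has
  to count as collapsible because it is the link of a non-face.\<close>

inductive collapsible :: "'v set set \<Rightarrow> bool" where
  empty: "collapsible {}"
| step: "\<lbrakk>w \<notin> \<sigma>; \<And>\<rho>. \<lbrakk>\<rho> \<in> K; \<sigma> \<subseteq> \<rho>\<rbrakk> \<Longrightarrow> insert w \<rho> \<in> K; collapsible (minus_star K \<sigma>)\<rbrakk> \<Longrightarrow> collapsible K"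

lemma contractible_geom_cone:
  assumes K: "is_complex K" and apex: "\<And>\<rho>. \<rho> \<in> K \<Longrightarrow> insert w \<rho> \<in> K"
  shows "contractible (geom K)"
proof -
  define e where "e v = (if v = w then 1 else 0 :: real)" for v
  have "homotopic_with (\<lambda>_. True) (top_of_set (geom K)) (top_of_set (geom K)) id (\<lambda>_. e)"
  proof (rule homotopic_top_of_setI[of _ "\<lambda>t f v. (1 - t) * f v + t * e v"])
    fix t :: real and f assume t: "0 \<le> t" "t \<le> 1" and f: "f \<in> geom K"
    obtain \<rho> where \<rho>: "\<rho> \<in> K" "\<And>v. v \<notin> \<rho> \<Longrightarrow> f v = 0" "\<And>v. 0 \<le> f v" "sum f \<rho> = 1" "finite \<rho>"
      using f by (elim geomE) blast
    have "sum f (insert w \<rho>) = 1"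
      using \<rho> by (cases "w \<in> \<rho>") (auto simp: insert_absorb)
    moreover have "sum e (insert w \<rho>) = 1"
      using \<rho>(5) by (simp add: e_def sum.If_cases del: sum.insert)
    ultimately show "(\<lambda>v. (1 - t) * f v + t * e v) \<in> geom K"
      using apex[OF \<rho>(1)] \<rho>(2,3) t
      by (intro geomI[of "insert w \<rho>"]) (auto simp: e_def sum.distrib simp flip: sum_distrib_left simp del: sum.insert)
  qed (auto intro!: continuous_intros)
  then show ?thesis by (auto simp: contractible_def)
qed

lemma contractible_geom_collapsible:
  assumes "collapsible K" "is_complex K"
  shows "contractible (geom K)"
  using assms
proof (induction rule: collapsible.induct)
  case empty
  then show ?case by (simp add: geom_def)
next
  case (step w \<sigma> K)
  show ?case
  proof (cases "\<sigma> = {}")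
    case True
    with step show ?thesis by (intro contractible_geom_cone[of K w]) auto
  next
    case False
    with step show ?thesis
      using homotopy_equivalent_space_contractibility[OF geom_minus_star[of K \<sigma> w]]
      by (auto simp: is_complex_minus_star)
  qed
qed

section \<open>Deleting open stars with collapsible links\<close>

definition link :: "'v set set \<Rightarrow> 'v set \<Rightarrow> 'v set set" where
  "link K \<sigma> = {\<tau>. \<tau> \<inter> \<sigma> = {} \<and> \<sigma> \<union> \<tau> \<in> K}"

text \<open>A collapse of the link that removes \<open>\<tau>\<close> towards \<open>w\<close> lifts
  to the collapse of \<open>K\<close> that removes \<open>\<sigma> \<union> \<tau>\<close> towards
  \<open>w\<close>, and the link of \<open>\<sigma>\<close> in the new complex is the collapsed
  link. The closing cone step, with \<open>\<tau> = {}\<close>, is the one that removes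
  \<open>\<sigma>\<close> itself.\<close>

lemma geom_minus_star_collapsible_link:
  assumes "collapsible (link K \<sigma>)" "is_complex K" "\<sigma> \<noteq> {}"
  shows "top_of_set (geom K) homotopy_equivalent_space top_of_set (geom (minus_star K \<sigma>))"
  using assms
proof (induction "link K \<sigma>" arbitrary: K rule: collapsible.induct)
  case empty
  then have "\<sigma> \<notin> K" by (auto simp: link_def)
  then have "minus_star K \<sigma> = K"
    using empty by (auto simp: minus_star_def is_complex_def)
  then show ?case by (simp add: homotopy_equivalent_space_refl)
next
  case (step w \<tau> K)
  show ?case
  proof (cases "\<tau> \<in> link K \<sigma>")
    case False
    have "\<tau> \<in> link K \<sigma>" if "\<rho> \<in> link K \<sigma>" "\<tau> \<subseteq> \<rho>" for \<rho>
    proof -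
      have "\<sigma> \<union> \<tau> \<subseteq> \<sigma> \<union> \<rho>" using that by auto
      then show ?thesis using that is_complexD[OF \<open>is_complex K\<close>, of "\<sigma> \<union> \<rho>"] by (auto simp: link_def)
    qed
    then have "minus_star (link K \<sigma>) \<tau> = link K \<sigma>"
      using False by (auto simp: minus_star_def)
    then show ?thesis using step by metis
  next
    case True
    let ?K' = "minus_star K (\<sigma> \<union> \<tau>)"
    have w: "w \<notin> \<sigma>" 
      using step(2)[OF True] by (auto simp: link_def)
    have "insert w \<rho> \<in> K" if "\<rho> \<in> K" "\<sigma> \<union> \<tau> \<subseteq> \<rho>" for \<rho>
    proof -
      have "\<rho> - \<sigma> \<in> link K \<sigma>" "\<tau> \<subseteq> \<rho> - \<sigma>"
        using that True by (auto simp: link_def Un_absorb1)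
      from step(2)[OF this] have "\<sigma> \<union> insert w (\<rho> - \<sigma>) \<in> K" by (simp add: link_def)
      moreover have "\<sigma> \<union> insert w (\<rho> - \<sigma>) = insert w \<rho>" using that by auto
      ultimately show ?thesis by simp
    qed
    then have "top_of_set (geom K) homotopy_equivalent_space top_of_set (geom ?K')"
      using step w by (intro geom_minus_star[of K "\<sigma> \<union> \<tau>" w]) auto
    moreover have link': "minus_star (link K \<sigma>) \<tau> = link ?K' \<sigma>"
      using True by (auto simp: minus_star_def link_def)
    then have "top_of_set (geom ?K') homotopy_equivalent_space top_of_set (geom (minus_star ?K' \<sigma>))"
      using step by (intro step) (auto simp: is_complex_minus_star)
    moreover have "minus_star ?K' \<sigma> = minus_star K \<sigma>"
      by (auto simp: minus_star_def)
    ultimately show ?thesis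
      by (metis homotopy_eqv_trans)
  qed
qed

text \<open>The faces in \<open>\<S>\<close> are removed in order of decreasing size. This makes it
  enough to know the part of each link outside \<open>P\<close>, computed in the original
  \<open>K\<close>: faces that meet \<open>P\<close> in more than \<open>s\<close> are already gone,
  and earlier removals do not touch this part.\<close>

lemma geom_remove_stars:
  assumes "finite \<S>" "is_complex K" "{} \<notin> \<S>" "\<And>s. s \<in> \<S> \<Longrightarrow> s \<subseteq> P"
    and up: "\<And>s s'. \<lbrakk>s \<in> \<S>; s \<subseteq> s'; s' \<subseteq> P; s' \<in> K\<rbrakk> \<Longrightarrow> s' \<in> \<S>"
    and "\<And>s. s \<in> \<S> \<Longrightarrow> collapsible {\<tau>. \<tau> \<inter> P = {} \<and> s \<union> \<tau> \<in> K}"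
  shows "top_of_set (geom K) homotopy_equivalent_space
         top_of_set (geom {\<rho> \<in> K. \<rho> \<inter> P \<notin> \<S>})"
  using assms
proof (induction "card \<S>" arbitrary: \<S> K)
  case 0
  then show ?case by (simp add: homotopy_equivalent_space_refl)
next
  case (Suc n)
  then have "\<S> \<noteq> {}" by auto
  have "Max (card ` \<S>) \<in> card ` \<S>" using Suc.prems(1) \<open>\<S> \<noteq> {}\<close> by simp
  then obtain s where s: "s \<in> \<S>" "card s = Max (card ` \<S>)" by auto
  then have mx: "card s' \<le> card s" if "s' \<in> \<S>" for s'
    using that Suc.prems(1) by simp
  note s = s(1)
  have eq_s: "s' = s" if "s' \<in> \<S>" "s \<subseteq> s'" "s' \<in> K" for s'
    using mx[of s'] that Suc.prems(2) by (metis card_seteq is_complex_def)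
  have ne: "s \<noteq> {}" using s Suc.prems by auto
  let ?K' = "minus_star K s" and ?S' = "\<S> - {s}"
  \<comment> \<open>A vertex of \<open>P\<close> in the link would enlarge \<open>s\<close> to a
    bigger member of \<open>\<S>\<close>, against the choice of \<open>s\<close>.\<close>
  have "link K s = {\<tau>. \<tau> \<inter> P = {} \<and> s \<union> \<tau> \<in> K}"
  proof -
    have "\<tau> \<inter> P = {}" if "\<tau> \<inter> s = {}" "s \<union> \<tau> \<in> K" for \<tau>
    proof -
      have sK: "s \<union> \<tau> \<inter> P \<in> K"
        using that(2) Suc.prems(2) by (auto simp: is_complex_def)
      then have "s \<union> \<tau> \<inter> P \<in> \<S>"
        using Suc.prems(4)[OF s] by (intro Suc.prems(5)[OF s]) auto
      then have "s \<union> \<tau> \<inter> P = s" using sK by (intro eq_s) auto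
      then show ?thesis using that by auto
    qed
    then show ?thesis using Suc.prems(4)[OF s] by (auto simp: link_def)
  qed
  then have "top_of_set (geom K) homotopy_equivalent_space top_of_set (geom ?K')"
    using Suc.prems s ne by (intro geom_minus_star_collapsible_link) auto
  also have "top_of_set (geom ?K') homotopy_equivalent_space
         top_of_set (geom {\<rho> \<in> ?K'. \<rho> \<inter> P \<notin> ?S'})"
  proof (rule Suc.hyps(1))
    show "n = card ?S'" using Suc.hyps(2) s Suc.prems(1) by simp
    show "is_complex ?K'" using Suc.prems by (simp add: is_complex_minus_star)
    show "s' \<in> ?S'" if "s1 \<in> ?S'" "s1 \<subseteq> s'" "s' \<subseteq> P" "s' \<in> ?K'" for s1 s'
      using Suc.prems(5)[of s1 s'] that by (auto simp: minus_star_def)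
    show "collapsible {\<tau>. \<tau> \<inter> P = {} \<and> s1 \<union> \<tau> \<in> ?K'}" if s1: "s1 \<in> ?S'" for s1
    proof -
      have "\<not> s \<subseteq> s1 \<union> \<tau>" if "\<tau> \<inter> P = {}" "s1 \<union> \<tau> \<in> K" for \<tau>
      proof
        assume "s \<subseteq> s1 \<union> \<tau>"
        then have "s \<subseteq> s1" using that Suc.prems(4)[OF s] by auto
        moreover have "s1 \<in> K" using that(2) Suc.prems(2) by (auto simp: is_complex_def)
        ultimately show False using eq_s s1 by blast
      qed
      then have "{\<tau>. \<tau> \<inter> P = {} \<and> s1 \<union> \<tau> \<in> ?K'} = {\<tau>. \<tau> \<inter> P = {} \<and> s1 \<union> \<tau> \<in> K}"
        by (auto simp: minus_star_def)
      then show ?thesis using Suc.prems(6) s1 by auto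
    qed
  qed (use Suc.prems in auto)
  also have "{\<rho> \<in> ?K'. \<rho> \<inter> P \<notin> ?S'} = {\<rho> \<in> K. \<rho> \<inter> P \<notin> \<S>}"
  proof -
    have "\<rho> \<inter> P \<in> \<S>" if "\<rho> \<in> K" "s \<subseteq> \<rho>" for \<rho>
    proof (rule Suc.prems(5)[OF s])
      show "s \<subseteq> \<rho> \<inter> P" using that Suc.prems(4)[OF s] by auto
      show "\<rho> \<inter> P \<in> K" using that Suc.prems(2) by (auto simp: is_complex_def)
    qed auto
    then show ?thesis using s by (auto simp: minus_star_def)
  qed
  finally show ?case .
qed

section \<open>Attaching maximal simplices to a contractible complex\<close>

text \<open>Compactness turns continuous surjections onto Hausdorff spaces into quotient maps,
  through which the maps and homotopies below are factored.\<close>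

lemma compact_geom:
  assumes "finite K"
  shows "compact (geom K)"
proof -
  define A where "A \<sigma> = {f :: 'a \<Rightarrow> real. (\<forall>v. v \<notin> \<sigma> \<longrightarrow> f v = 0) \<and> (\<forall>v\<in>\<sigma>. 0 \<le> f v) \<and> sum f \<sigma> = 1}" for \<sigma>
  have "compact (A \<sigma>)" for \<sigma>
  proof -
    have "compactin (product_topology (\<lambda>_. euclidean) UNIV) (\<Pi>\<^sub>E v\<in>UNIV :: 'a set. {0..1::real})"
      by (simp add: compactin_PiE)
    then have "compact (\<Pi>\<^sub>E v\<in>UNIV :: 'a set. {0..1::real})"
      by (simp add: euclidean_product_topology)
    moreover have "closed (A \<sigma>)"
      unfolding A_def
      by (intro closed_Collect_conj closed_Collect_all closed_Collect_imp closed_Collect_eq closed_Collect_le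
            continuous_intros open_Collect_const) (simp add: Ball_def, intro closed_Collect_all closed_Collect_imp closed_Collect_le continuous_intros open_Collect_const)
    moreover have "A \<sigma> \<subseteq> (\<Pi>\<^sub>E v\<in>UNIV. {0..1})"
    proof
      fix f assume f: "f \<in> A \<sigma>"
      then have "finite \<sigma>" by (auto simp: A_def intro: ccontr)
      have "f v \<in> {0..1}" for v
      proof (cases "v \<in> \<sigma>")
        case True
        then have "f v \<le> sum f \<sigma>"
          using f \<open>finite \<sigma>\<close> by (intro member_le_sum) (auto simp: A_def)
        then show ?thesis using f True by (auto simp: A_def)
      qed (use f in \<open>auto simp: A_def\<close>)
      then show "f \<in> (\<Pi>\<^sub>E v\<in>UNIV. {0..1})" by (simp add: PiE_iff)
    qed
    ultimately show ?thesis
      by (metis compact_Int_closed inf.absorb_iff2)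
  qed
  moreover have "geom K = (\<Union>\<sigma>\<in>K. A \<sigma>)" by (auto simp: geom_def A_def)
  ultimately show ?thesis using assms by auto
qed

lemma Hausdorff_top_of_set_fun: "Hausdorff_space (top_of_set (S :: ('v \<Rightarrow> real) set))"
  by (metis Hausdorff_space_euclidean Hausdorff_space_product_topology Hausdorff_space_subtopology euclidean_product_topology)

text \<open>The right-hand side shows that the sphere passes through the origin, the wedge point,
  and that a point of the sphere with vanishing coordinate 0 is the origin.\<close>

lemma sum_unit_sphere:
  fixes x :: "nat \<Rightarrow> real"
  shows "(\<Sum>j\<le>n. (x j - (if j = 0 then 1 else 0))\<^sup>2) = 1 \<longleftrightarrow> (\<Sum>j\<le>n. (x j)\<^sup>2) = 2 * x 0"
proof -
  have "(\<Sum>j\<le>n. (x j - (if j = 0 then 1 else 0))\<^sup>2)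
      = (\<Sum>j\<le>n. (x j)\<^sup>2 + (if j = 0 then 1 - 2 * x 0 else 0))"
    by (intro sum.cong) (auto simp: power2_eq_square algebra_simps)
  also have "\<dots> = (\<Sum>j\<le>n. (x j)\<^sup>2) + (1 - 2 * x 0)"
    by (simp add: sum.distrib)
  finally show ?thesis by auto
qed

text \<open>Collapsing everything outside the open cells \<open>\<tau> i\<close> to one point yields
  a wedge of \<open>k\<close> spheres of dimension \<open>n\<close>. The enumeration
  \<open>e i\<close> of the vertices of a cell supplies coordinates; vertex 0 will be the reference
  vertex of the chart \<open>y\<close>.\<close>

locale maximal_cells =
  fixes K :: "'v set set" and n k :: nat and \<tau> :: "nat \<Rightarrow> 'v set" and e :: "nat \<Rightarrow> nat \<Rightarrow> 'v"
  assumes K: "is_complex K" "finite K"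
    and inj_\<tau>: "inj_on \<tau> {..<k}"
    and \<tau>_mem: "i < k \<Longrightarrow> \<tau> i \<in> K"
    and \<tau>_max: "\<lbrakk>i < k; \<rho> \<in> K; \<tau> i \<subseteq> \<rho>\<rbrakk> \<Longrightarrow> \<rho> = \<tau> i"
    and e: "i < k \<Longrightarrow> bij_betw (e i) {..n} (\<tau> i)"
begin

definition C where "C = K - \<tau> ` {..<k}"

text \<open>A measure of the distance to the boundary of the cell: on \<open>geom K\<close> it is
  positive exactly in the open simplex \<open>\<tau> i\<close>.\<close>

definition m where "m i f = Min ((\<lambda>j. f (e i j)) ` {..n})" for f :: "'v \<Rightarrow> real"

lemma e_mem: "\<lbrakk>i < k; j \<le> n\<rbrakk> \<Longrightarrow> e i j \<in> \<tau> i"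
  using e bij_betwE by blast

lemma m_le: "j \<le> n \<Longrightarrow> m i f \<le> f (e i j)"
  by (simp add: m_def)

lemma m_attained: obtains j where "j \<le> n" "f (e i j) = m i f"
proof -
  have "m i f \<in> (\<lambda>j. f (e i j)) ` {..n}" unfolding m_def by (intro Min_in) auto
  then show thesis using that by auto
qed

lemma m_nonneg: "f \<in> geom K \<Longrightarrow> 0 \<le> m i f"
  by (metis m_attained geomE)

text \<open>A positive minimum forces all of \<open>\<tau> i\<close> into the support, and
  maximality leaves room for nothing more.\<close>

lemma m_pos_face:
  assumes "i < k" "m i f > 0" "\<And>v. v \<notin> \<rho> \<Longrightarrow> f v = 0" "\<rho> \<in> K"
  shows "\<rho> = \<tau> i"
proof (rule \<tau>_max)
  show "\<tau> i \<subseteq> \<rho>"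
  proof
    fix v assume "v \<in> \<tau> i"
    then obtain j where "j \<le> n" "v = e i j" using e[OF assms(1)] by (auto simp: bij_betw_def)
    then show "v \<in> \<rho>" using m_le[of j i f] assms(2,3) by force
  qed
qed (use assms in auto)

lemma m_pos:
  assumes "f \<in> geom K" "i < k" "m i f > 0"
  shows "v \<notin> \<tau> i \<Longrightarrow> f v = 0" "(\<Sum>j\<le>n. f (e i j)) = 1"
proof -
  obtain \<rho> where \<rho>: "\<rho> \<in> K" "\<And>v. v \<notin> \<rho> \<Longrightarrow> f v = 0" "sum f \<rho> = 1"
    using assms by (elim geomE) blast
  then have "\<rho> = \<tau> i" using m_pos_face assms by blast
  then show "v \<notin> \<tau> i \<Longrightarrow> f v = 0" "(\<Sum>j\<le>n. f (e i j)) = 1"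
    using \<rho> sum.reindex_bij_betw[OF e[OF assms(2)], of f] by auto
qed

lemma m_pos_unique:
  assumes "f \<in> geom K" "i < k" "m i f > 0" "i' < k" "m i' f > 0"
  shows "i' = i"
proof -
  have "\<tau> i = \<tau> i'"
    using m_pos_face[of i' f "\<tau> i"] m_pos(1)[of f i] \<tau>_mem[of i] assms by auto
  then show ?thesis using inj_\<tau> assms by (auto simp: inj_on_def)
qed

lemma m_eq_0: "\<lbrakk>f \<in> geom K; i < k; m i f > 0; i' < k; i' \<noteq> i\<rbrakk> \<Longrightarrow> m i' f = 0"
  using m_pos_unique[of f i i'] m_nonneg[of f i'] by fastforce

lemma mem_C_minus_vertex:
  assumes "i < k" "v \<in> \<tau> i" shows "\<tau> i - {v} \<in> C"
proof -
  have "\<tau> i - {v} \<noteq> \<tau> i'" if "i' < k" for i'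
    using \<tau>_max[of i' "\<tau> i"] \<tau>_mem[of i] that assms by auto
  moreover have "\<tau> i - {v} \<in> K" using is_complexD[OF K(1) \<tau>_mem[OF assms(1)]] by auto
  ultimately show ?thesis by (auto simp: C_def)
qed

lemma geom_C_subset: "geom C \<subseteq> geom K"
  by (intro geom_mono) (auto simp: C_def)

lemma geom_C_iff:
  assumes f: "f \<in> geom K"
  shows "f \<in> geom C \<longleftrightarrow> (\<forall>i<k. m i f = 0)"
proof
  assume "f \<in> geom C"
  then obtain \<rho> where \<rho>: "\<rho> \<in> C" "\<And>v. v \<notin> \<rho> \<Longrightarrow> f v = 0"
    by (elim geomE) blast
  have False if "i < k" "m i f \<noteq> 0" for i
    using that m_pos_face[of i f \<rho>] \<rho> m_nonneg[OF f, of i] by (auto simp: C_def)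
  then show "\<forall>i<k. m i f = 0" by blast
next
  assume m0: "\<forall>i<k. m i f = 0"
  obtain \<rho> where \<rho>: "\<rho> \<in> K" "\<And>v. v \<notin> \<rho> \<Longrightarrow> f v = 0" "\<And>v. 0 \<le> f v" "sum f \<rho> = 1" "finite \<rho>"
    using f by (elim geomE) blast
  show "f \<in> geom C"
  proof (cases "\<rho> \<in> C")
    case True
    then show ?thesis using \<rho> by (intro geomI) auto
  next
    case False
    then obtain i where i: "i < k" "\<rho> = \<tau> i" using \<rho>(1) by (auto simp: C_def)
    obtain j where j: "j \<le> n" "f (e i j) = m i f" by (rule m_attained)
    show ?thesis
    proof (rule geomI)
      show "\<tau> i - {e i j} \<in> C" using i j e_mem by (intro mem_C_minus_vertex) auto
      show "f v = 0" if "v \<notin> \<tau> i - {e i j}" for v using that \<rho> i j m0 by auto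
      show "sum f (\<tau> i - {e i j}) = 1"
        using \<rho> i j m0 e_mem by (simp add: sum_diff1)
    qed (use \<rho> in auto)
  qed
qed

lemma continuous_m: "continuous_on S (m i)"
  unfolding m_def by (intro continuous_on_Min_image continuous_intros) auto

text \<open>The open simplex \<open>\<tau> i\<close> is mapped onto the punctured sphere by the inverse of the
  stereographic projection from the base point, after the homeomorphism onto Euclidean space
  with coordinates \<open>y i j f / m i f\<close>. The last summand of \<open>D\<close> vanishes on \<open>\<tau> i\<close> and
  keeps the denominator positive elsewhere.\<close>

definition y where "y i j f = (if j = 0 then m i f else f (e i j) - f (e i 0))" for f :: "'v \<Rightarrow> real"

definition D where "D i f = (\<Sum>j\<le>n. (y i j f)\<^sup>2) + (1 - (\<Sum>j\<le>n. f (e i j)))\<^sup>2" for f :: "'v \<Rightarrow> real"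

definition q where
  "q f = (\<lambda>(i, j). if i < k \<and> j \<le> n then 2 * m i f * y i j f / D i f else 0)" for f :: "'v \<Rightarrow> real"

definition W where
  "W = {x :: nat \<times> nat \<Rightarrow> real. \<exists>i<k. (\<forall>p. fst p \<noteq> i \<or> snd p > n \<longrightarrow> x p = 0) \<and>
              (\<Sum>j\<le>n. (x (i, j) - (if j = 0 then 1 else 0))\<^sup>2) = 1}"

text \<open>If all squares vanish, the coordinates on the cell are equal and their minimum is 0, so
  they are all 0; but the last square makes them add up to 1.\<close>

lemma D_pos: "D i f > 0"
proof (rule ccontr)
  assume "\<not> D i f > 0"
  then have "D i f = 0" by (simp add: D_def order_antisym_conv sum_nonneg add_nonneg_nonneg not_less)
  then have s: "(\<Sum>j\<le>n. (y i j f)\<^sup>2) = 0" "(\<Sum>j\<le>n. f (e i j)) = 1"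
    by (auto simp: D_def add_nonneg_eq_0_iff sum_nonneg)
  then have y0: "y i j f = 0" if "j \<le> n" for j
    using that by (simp add: sum_nonneg_eq_0_iff)
  have eq: "f (e i j) = f (e i 0)" if "j \<le> n" for j
    using y0[OF that] by (auto simp: y_def split: if_splits)
  obtain j where "j \<le> n" "f (e i j) = m i f" by (rule m_attained)
  then have "f (e i 0) = 0" using y0[of 0] eq[of j] by (simp add: y_def)
  with s eq show False by simp
qed

lemma q_cell: "\<lbrakk>i < k; j \<le> n\<rbrakk> \<Longrightarrow> q f (i, j) = 2 * m i f * y i j f / D i f"
  by (simp add: q_def)

lemma q_0_pos: "\<lbrakk>i < k; m i f \<noteq> 0\<rbrakk> \<Longrightarrow> q f (i, 0) > 0"
proof -
  assume "i < k" "m i f \<noteq> 0"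
  then have "q f (i, 0) = 2 * (m i f)\<^sup>2 / D i f" by (simp add: q_cell y_def power2_eq_square)
  then show ?thesis using D_pos[of i f] \<open>m i f \<noteq> 0\<close> by simp
qed

lemma q_eq_0_iff:
  assumes "f \<in> geom K" shows "q f = (\<lambda>_. 0) \<longleftrightarrow> f \<in> geom C"
proof
  assume "q f = (\<lambda>_. 0)"
  then have "m i f = 0" if "i < k" for i using q_0_pos[of i f] that by force
  then show "f \<in> geom C" using geom_C_iff assms by blast
next
  assume "f \<in> geom C"
  then have "m i f = 0" if "i < k" for i using geom_C_iff assms that by blast
  then show "q f = (\<lambda>_. 0)" by (auto simp: q_def fun_eq_iff)
qed

lemma continuous_q: "continuous_on S q"
proof (rule continuous_on_coordinatewise_then_product)
  fix p :: "nat \<times> nat"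
  obtain i j where p: "p = (i, j)" by (rule prod.exhaust)
  have "continuous_on S (y i j)" for j
    unfolding y_def by (cases "j = 0") (auto intro!: continuous_intros continuous_m)
  then have "continuous_on S (\<lambda>f. 2 * m i f * y i j f / D i f)"
    using D_pos[of i] unfolding D_def
    by (intro continuous_intros continuous_m) (auto simp: less_le)
  then show "continuous_on S (\<lambda>f. q f p)"
    by (cases "i < k \<and> j \<le> n") (auto simp: q_def p)
qed

lemma W_iff:
  "x \<in> W \<longleftrightarrow> (\<exists>i<k. (\<forall>p. fst p \<noteq> i \<or> snd p > n \<longrightarrow> x p = 0) \<and> (\<Sum>j\<le>n. (x (i, j))\<^sup>2) = 2 * x (i, 0))"
proof -
  have "(\<Sum>j\<le>n. (x (i, j) - (if j = 0 then 1 else 0))\<^sup>2) = 1 \<longleftrightarrow> (\<Sum>j\<le>n. (x (i, j))\<^sup>2) = 2 * x (i, 0)" for i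
    using sum_unit_sphere[where x = "\<lambda>j. x (i, j)"] by simp
  then show ?thesis unfolding W_def mem_Collect_eq by (simp only:)
qed

lemma q_in_W:
  assumes f: "f \<in> geom K" and "k > 0"
  shows "q f \<in> W"
proof (cases "f \<in> geom C")
  case True
  then have "q f = (\<lambda>_. 0)" using q_eq_0_iff f by blast
  then show ?thesis using \<open>k > 0\<close> by (auto simp: W_iff)
next
  case False
  then obtain i where i: "i < k" "m i f \<noteq> 0" using geom_C_iff f by blast
  then have m: "m i f > 0" using m_nonneg[OF f, of i] by simp
  have "(\<Sum>j\<le>n. (q f (i, j))\<^sup>2) = 2 * q f (i, 0)"
  proof -
    have D: "D i f = (\<Sum>j\<le>n. (y i j f)\<^sup>2)"
      using m_pos(2)[OF f i(1) m] by (simp add: D_def)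
    have "(\<Sum>j\<le>n. (q f (i, j))\<^sup>2) = (\<Sum>j\<le>n. (2 * m i f / D i f)\<^sup>2 * (y i j f)\<^sup>2)"
      using i by (intro sum.cong) (auto simp: q_cell power_mult_distrib power_divide)
    also have "\<dots> = (2 * m i f / D i f)\<^sup>2 * D i f"
      by (simp add: D sum_distrib_left)
    also have "\<dots> = 2 * q f (i, 0)"
      using D_pos[of i f] i by (simp add: q_cell y_def power2_eq_square)
    finally show ?thesis .
  qed
  moreover have "q f p = 0" if "fst p \<noteq> i \<or> snd p > n" for p
    using that m_eq_0[OF f i(1) m] by (cases p) (auto simp: q_def)
  ultimately show ?thesis using i by (auto simp: W_iff)
qed

text \<open>Stereographic projection is inverted by the quotient of \<open>q f (i, j)\<close> by
  \<open>q f (i, 0)\<close>, which is \<open>y i j f / m i f\<close>. These ratios determine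
  \<open>f\<close> on the cell up to a positive factor \<open>c\<close>, and the coordinate sum 1
  gives \<open>c = 1\<close>.\<close>

lemma q_inj:
  assumes f: "f \<in> geom K" and f': "f' \<in> geom K" and eq: "q f = q f'"
  shows "f = f' \<or> f \<in> geom C \<and> f' \<in> geom C"
proof (cases "f \<in> geom C")
  case True
  then show ?thesis using eq q_eq_0_iff f f' by metis
next
  case False
  then obtain i where i: "i < k" "m i f \<noteq> 0" using geom_C_iff f by blast
  then have m: "m i f > 0" using m_nonneg[OF f, of i] by simp
  have m': "m i f' > 0"
  proof (rule ccontr)
    assume "\<not> m i f' > 0"
    then have "q f' (i, 0) = 0" using m_nonneg[OF f', of i] i by (simp add: q_cell)
    then show False using q_0_pos[OF i] eq by simp
  qed
  define c where "c = m i f / m i f'"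
  have c: "c > 0" "m i f = c * m i f'" using m m' by (auto simp: c_def)
  have y: "y i j f = c * y i j f'" if j: "j \<le> n" for j
  proof -
    have "y i j f / m i f = q f (i, j) / q f (i, 0)"
      using D_pos[of i f] m i j by (simp add: q_cell y_def[of i 0])
    also have "\<dots> = y i j f' / m i f'"
      using D_pos[of i f'] m' i j by (simp add: eq q_cell y_def[of i 0])
    finally show ?thesis using m m' by (simp add: c_def field_simps)
  qed
  have d: "f (e i j) - f (e i 0) = c * (f' (e i j) - f' (e i 0))" if j: "j \<le> n" for j
    using y[OF j] by (cases "j = 0") (auto simp: y_def)
  \<comment> \<open>Differences of coordinates and minima both scale by \<open>c\<close>. Comparing
    at a vertex where \<open>f'\<close> is minimal, then at one where \<open>f\<close> is minimal,
    gives the two inequalities.\<close>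
  have f0: "f (e i 0) = c * f' (e i 0)"
  proof (rule antisym)
    obtain j where j: "j \<le> n" "f' (e i j) = m i f'" by (rule m_attained)
    have "c * m i f' \<le> f (e i j)" using m_le[OF j(1), of i f] c by simp
    then show "c * f' (e i 0) \<le> f (e i 0)" using d[OF j(1)] j by (simp add: algebra_simps)
    obtain j where j: "j \<le> n" "f (e i j) = m i f" by (rule m_attained)
    have "m i f \<le> c * f' (e i j)" using m_le[OF j(1), of i f'] c by simp
    then show "f (e i 0) \<le> c * f' (e i 0)" using d[OF j(1)] j by (simp add: algebra_simps)
  qed
  have fc: "f (e i j) = c * f' (e i j)" if "j \<le> n" for j
    using d[OF that] f0 by (simp add: algebra_simps)
  have "(\<Sum>j\<le>n. f (e i j)) = c * (\<Sum>j\<le>n. f' (e i j))"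
    by (simp add: fc sum_distrib_left)
  then have "c = 1" using m_pos(2)[OF f i(1) m] m_pos(2)[OF f' i(1) m'] by simp
  have "f v = f' v" for v
  proof (cases "v \<in> \<tau> i")
    case True
    then obtain j where "j \<le> n" "v = e i j" using e[OF i(1)] by (auto simp: bij_betw_def)
    then show ?thesis using fc \<open>c = 1\<close> by simp
  next
    case False
    then show ?thesis using m_pos(1)[OF f i(1) m] m_pos(1)[OF f' i(1) m'] by simp
  qed
  then show ?thesis by blast
qed

lemma W_subset_image:
  assumes "geom C \<noteq> {}"
  shows "W \<subseteq> q ` geom K"
proof
  fix x assume "x \<in> W"
  then obtain i where i: "i < k" and x0: "\<And>p. fst p \<noteq> i \<or> snd p > n \<Longrightarrow> x p = 0"
    and x2: "(\<Sum>j\<le>n. (x (i, j))\<^sup>2) = 2 * x (i, 0)"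
    by (auto simp: W_iff)
  show "x \<in> q ` geom K"
  proof (cases "x (i, 0) = 0")
    \<comment> \<open>This is the wedge point, the image of all of \<open>geom C\<close>; here the
      nonemptiness of \<open>geom C\<close> enters.\<close>
    case True
    then have "x (i, j) = 0" if "j \<le> n" for j
      using x2 that by (simp add: sum_nonneg_eq_0_iff)
    then have "x p = 0" for p using x0[of p] by (cases p) (metis fst_conv snd_conv not_le_imp_less)
    then have "x = (\<lambda>_. 0)" by (simp add: fun_eq_iff)
    moreover obtain f where "f \<in> geom C" using assms by blast
    ultimately show ?thesis using q_eq_0_iff geom_C_subset by (metis image_eqI subsetD)
  next
    case False
    have pos: "x (i, 0) > 0"
      using False x2 sum_nonneg[of "{..n}" "\<lambda>j. (x (i, j))\<^sup>2"] by simp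
    \<comment> \<open>The preimage is built from \<open>z\<close>, the differences to vertex 0
      measured in units of the minimum. Subtracting \<open>\<mu> - 1\<close> makes the smallest
      entry 1, and division by \<open>S\<close> makes the sum 1, so the minimum of \<open>f\<close>
      becomes \<open>1 / S\<close>.\<close>
    define z where "z j = (if j = 0 then 0 else x (i, j) / x (i, 0))" for j
    define \<mu> where "\<mu> = Min (z ` {..n})"
    define S where "S = (\<Sum>j\<le>n. z j - \<mu> + 1)"
    define f where "f v = (if v \<in> \<tau> i then (z (the_inv_into {..n} (e i) v) - \<mu> + 1) / S else 0)" for v
    have \<mu>: "\<mu> \<le> z j" if "j \<le> n" for j using that by (simp add: \<mu>_def)
    have "S > 0" unfolding S_def using \<mu> by (intro sum_pos) (auto simp: add_nonneg_pos)
    have fe: "f (e i j) = (z j - \<mu> + 1) / S" if "j \<le> n" for j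
      using that e[OF i] e_mem[OF i that] by (simp add: f_def the_inv_into_f_f bij_betw_def)
    have sum1: "(\<Sum>j\<le>n. f (e i j)) = 1"
      using \<open>S > 0\<close> by (simp add: fe S_def flip: sum_divide_distrib)
    have fin: "finite (\<tau> i)" using K \<tau>_mem[OF i] by (auto simp: is_complex_def)
    have f: "f \<in> geom K"
    proof (rule geomI)
      show "\<tau> i \<in> K" using \<tau>_mem i .
      show "f v = 0" if "v \<notin> \<tau> i" for v using that by (simp add: f_def)
      show "0 \<le> f v" for v
      proof (cases "v \<in> \<tau> i")
        case True
        then obtain j where "j \<le> n" "v = e i j" using e[OF i] by (auto simp: bij_betw_def)
        then show ?thesis using fe[of j] \<mu>[of j] \<open>S > 0\<close> by simp
      qed (simp add: f_def)
      show "sum f (\<tau> i) = 1" using sum1 sum.reindex_bij_betw[OF e[OF i], of f] by simp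
    qed
    have m: "m i f = 1 / S"
      unfolding m_def
    proof (rule Min_eqI)
      have "\<mu> \<in> z ` {..n}" unfolding \<mu>_def by (intro Min_in) auto
      then obtain j where "j \<le> n" "z j = \<mu>" by auto
      then show "1 / S \<in> (\<lambda>j. f (e i j)) ` {..n}" using fe[of j] by (auto intro!: image_eqI[of _ _ j])
      show "1 / S \<le> t" if t: "t \<in> (\<lambda>j. f (e i j)) ` {..n}" for t
        using t fe \<mu> \<open>S > 0\<close> by (auto simp: divide_right_mono)
    qed simp
    have y: "y i j f = x (i, j) / x (i, 0) / S" if "j \<le> n" for j
    proof (cases "j = 0")
      case True
      then show ?thesis using pos m by (simp add: y_def)
    next
      case False
      then show ?thesis using fe[of j] fe[of 0] that
        by (simp add: y_def z_def diff_divide_distrib[symmetric])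
    qed
    have "D i f = (\<Sum>j\<le>n. (x (i, j))\<^sup>2) / (x (i, 0) * S)\<^sup>2"
      using sum1 by (simp add: D_def y sum_divide_distrib power_divide power_mult_distrib)
    also have "\<dots> = 2 / (x (i, 0) * S\<^sup>2)"
      unfolding x2 using pos \<open>S > 0\<close> by (simp add: power2_eq_square)
    finally have D: "D i f = 2 / (x (i, 0) * S\<^sup>2)" .
    have "q f p = x p" for p
    proof (cases "fst p \<noteq> i \<or> snd p > n")
      case True
      have "m i f > 0" using m \<open>S > 0\<close> by simp
      then have "q f p = 0"
        using True m_eq_0[OF f i] by (cases p) (auto simp: q_def)
      then show ?thesis using x0[OF True] by simp
    next
      case False
      then obtain j where p: "p = (i, j)" "j \<le> n" by (cases p) auto
      then show ?thesis
        using pos \<open>S > 0\<close> i by (simp add: q_cell m y D power2_eq_square)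
    qed
    then show ?thesis using f by (intro image_eqI[of _ _ f]) auto
  qed
qed

lemma image_q:
  assumes "geom C \<noteq> {}" "k > 0" shows "q ` geom K = W"
  using W_subset_image q_in_W assms by blast


text \<open>\<open>G t\<close> stretches each cell radially from its barycentre, pushing a collar of width
  proportional to \<open>t\<close> onto the boundary; on the collar a homotopy of the boundary can then
  be run.\<close>

definition depth where "depth f = (\<Sum>i<k. (n + 1) * m i f)" for f :: "'v \<Rightarrow> real"

text \<open>The barycentre has \<open>m = 1 / (n + 1)\<close>, so \<open>depth\<close> runs from 0
  to 1 in a cell. At most \<open>t / 2\<close> of it is cut away, which keeps the denominator of
  \<open>G\<close> at least 1/2 for \<open>t \<le> 1\<close>.\<close>

definition cut where "cut t i f = min (m i f) (t / 2 / (n + 1))" for t :: real and f :: "'v \<Rightarrow> real"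

definition G where
  "G t f = (\<lambda>v. (f v - (\<Sum>i<k. if v \<in> \<tau> i then cut t i f else 0)) / (1 - (n + 1) * (\<Sum>i<k. cut t i f)))"
  for t :: real and f :: "'v \<Rightarrow> real"

lemma cut_eq_0: "\<lbrakk>m i f = 0; 0 \<le> t\<rbrakk> \<Longrightarrow> cut t i f = 0"
  by (simp add: cut_def)

lemma cut_0: "f \<in> geom K \<Longrightarrow> cut 0 i f = 0"
  using m_nonneg[of f i] by (simp add: cut_def)

lemma depth_nonneg: "f \<in> geom K \<Longrightarrow> 0 \<le> depth f"
  unfolding depth_def using m_nonneg by (intro sum_nonneg mult_nonneg_nonneg) auto

lemma depth_eq_0: "f \<in> geom C \<Longrightarrow> depth f = 0"
  using geom_C_iff[of f] geom_C_subset by (auto simp: depth_def)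

lemma G_eqI: "(\<And>i. i < k \<Longrightarrow> cut t i f = 0) \<Longrightarrow> G t f = f"
  by (simp add: G_def fun_eq_iff cong: if_cong)

lemma G_fixed: "\<lbrakk>f \<in> geom C; 0 \<le> t\<rbrakk> \<Longrightarrow> G t f = f"
  using geom_C_iff[of f] geom_C_subset by (intro G_eqI cut_eq_0) auto

lemma G_0: "f \<in> geom K \<Longrightarrow> G 0 f = f"
  by (intro G_eqI cut_0)

lemma G_cell:
  assumes f: "f \<in> geom K" and i: "i < k" "m i f > 0" and t: "0 \<le> t"
  shows "G t f v = (f v - (if v \<in> \<tau> i then cut t i f else 0)) / (1 - (n + 1) * cut t i f)"
proof -
  have "cut t i' f = 0" if "i' < k" "i' \<noteq> i" for i'
    using m_eq_0[OF f i that] t by (simp add: cut_def)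
  then have "(\<Sum>i'<k. cut t i' f) = cut t i f"
    "(\<Sum>i'<k. if v \<in> \<tau> i' then cut t i' f else 0) = (if v \<in> \<tau> i then cut t i f else 0)"
    using i by (simp_all add: sum.remove[of _ i] cong: if_cong)
  then show ?thesis by (simp add: G_def)
qed

lemma cut_bounds:
  assumes "f \<in> geom K" "0 \<le> t" "t \<le> 1"
  shows "0 \<le> cut t i f" "(n + 1) * cut t i f \<le> 1 / 2"
proof -
  show "0 \<le> cut t i f" using assms m_nonneg by (simp add: cut_def)
  have "(n + 1) * cut t i f \<le> (n + 1) * (t / 2 / (n + 1))"
    by (intro mult_left_mono) (auto simp: cut_def)
  also have "\<dots> = t / 2" by (simp add: field_simps)
  finally show "(n + 1) * cut t i f \<le> 1 / 2" using assms(3) by linarith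
qed

lemma G_in_geom:
  assumes f: "f \<in> geom K" and t: "0 \<le> t" "t \<le> 1"
  shows "G t f \<in> geom K" "depth f \<le> t / 2 \<Longrightarrow> G t f \<in> geom C"
proof -
  have "G t f \<in> geom K \<and> (depth f \<le> t / 2 \<longrightarrow> G t f \<in> geom C)"
  proof (cases "f \<in> geom C")
    case True
    then show ?thesis using G_fixed t f by simp
  next
    case False
    then obtain i where i: "i < k" "m i f \<noteq> 0" using geom_C_iff f by blast
    then have m: "m i f > 0" using m_nonneg[OF f, of i] by simp
    define s where "s = cut t i f"
    have s: "0 \<le> s" "(n + 1) * s \<le> 1 / 2" "s \<le> m i f"
      using cut_bounds[OF f t, of i] by (auto simp: s_def cut_def)
    have G: "G t f v = (f v - (if v \<in> \<tau> i then s else 0)) / (1 - (n + 1) * s)" for v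
      using G_cell[OF f i(1) m t(1)] by (simp add: s_def)
    have out: "G t f v = 0" if "v \<notin> \<tau> i" for v
      using that m_pos(1)[OF f i(1) m] by (simp add: G)
    have fe: "(\<Sum>j\<le>n. G t f (e i j)) = 1"
    proof -
      have "(\<Sum>j\<le>n. G t f (e i j)) = (\<Sum>j\<le>n. f (e i j) - s) / (1 - (n + 1) * s)"
        using e_mem[OF i(1)] by (simp add: G sum_divide_distrib)
      also have "(\<Sum>j\<le>n. f (e i j) - s) = 1 - (n + 1) * s"
        using m_pos(2)[OF f i(1) m] by (simp add: sum_subtractf)
      finally show ?thesis using s by simp
    qed
    have GK: "G t f \<in> geom K"
    proof (rule geomI)
      show "\<tau> i \<in> K" using \<tau>_mem i by blast
      show "0 \<le> G t f v" for v
      proof (cases "v \<in> \<tau> i")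
        case True
        then obtain j where "j \<le> n" "v = e i j" using e[OF i(1)] by (auto simp: bij_betw_def)
        then show ?thesis using m_le[of j i f] s True by (simp add: G)
      qed (simp add: out)
      show "sum (G t f) (\<tau> i) = 1" using fe sum.reindex_bij_betw[OF e[OF i(1)], of "G t f"] by simp
    qed (use out in auto)
    moreover have "G t f \<in> geom C" if d: "depth f \<le> t / 2"
    proof -
      have "depth f = (n + 1) * m i f"
        using m_eq_0[OF f i(1) m] i(1) by (simp add: depth_def sum.remove[of _ i])
      then have "m i f \<le> t / 2 / (n + 1)" using d by (simp add: field_simps)
      \<comment> \<open>In the collar the whole minimum is cut off, so the smallest coordinate
        becomes 0 and the point lands on the boundary of its cell.\<close>
      then have "s = m i f" by (simp add: s_def cut_def)
      obtain j where j: "j \<le> n" "f (e i j) = m i f" by (rule m_attained)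
      have "m i (G t f) \<le> 0"
        using m_le[OF j(1), of i "G t f"] j \<open>s = m i f\<close> e_mem[OF i(1) j(1)] by (simp add: G)
      moreover have "m i' (G t f) \<le> 0" if "i' < k" "i' \<noteq> i" for i'
      proof (rule ccontr)
        assume "\<not> ?thesis"
        then have "\<tau> i = \<tau> i'"
          using m_pos_face[of i' "G t f" "\<tau> i"] out \<tau>_mem[OF i(1)] that by auto
        then show False using inj_\<tau> i that by (auto simp: inj_on_def)
      qed
      ultimately have "m i' (G t f) = 0" if "i' < k" for i'
        using m_nonneg[OF GK, of i'] that by (metis order_antisym)
      then show ?thesis using geom_C_iff[OF GK] by blast
    qed
    ultimately show ?thesis by blast
  qed
  then show "G t f \<in> geom K" "depth f \<le> t / 2 \<Longrightarrow> G t f \<in> geom C" by auto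
qed

lemma continuous_m_snd: "continuous_on S (\<lambda>z. m i (snd z))" for S :: "(real \<times> ('v \<Rightarrow> real)) set"
  by (rule continuous_on_compose2[OF continuous_m[of UNIV]]) (auto intro!: continuous_intros)

lemma continuous_G: "continuous_on ({0..1} \<times> geom K) (\<lambda>z. G (fst z) (snd z))"
proof (rule continuous_on_coordinatewise_then_product)
  fix v
  have nz: "1 - (n + 1) * (\<Sum>i<k. cut t i f) \<noteq> 0" if t: "0 \<le> t" "t \<le> 1" and f: "f \<in> geom K" for t f
  proof (cases "f \<in> geom C")
    case True
    then have "cut t i f = 0" if "i < k" for i
      using geom_C_iff[OF f] that t by (simp add: cut_def)
    then show ?thesis by simp
  next
    case False
    then obtain i where i: "i < k" "m i f \<noteq> 0" using geom_C_iff f by blast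
    then have m: "m i f > 0" using m_nonneg[OF f, of i] by simp
    have "cut t i' f = 0" if "i' < k" "i' \<noteq> i" for i'
      using m_eq_0[OF f i(1) m that] t by (simp add: cut_def)
    then have "(\<Sum>i'<k. cut t i' f) = cut t i f"
      using i by (simp add: sum.remove[of _ i])
    then show ?thesis using cut_bounds[OF f t, of i] by simp
  qed
  have "continuous_on ({0..1} \<times> geom K) (\<lambda>z. cut (fst z) i (snd z))" for i
    unfolding cut_def by (intro continuous_intros continuous_m_snd) auto
  moreover from this have "continuous_on ({0..1} \<times> geom K) (\<lambda>z. if v \<in> \<tau> i then cut (fst z) i (snd z) else 0)" for i
    by (cases "v \<in> \<tau> i") auto
  ultimately show "continuous_on ({0..1} \<times> geom K) (\<lambda>z. G (fst z) (snd z) v)"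
    unfolding G_def by (intro continuous_intros) (use nz in auto)
qed

text \<open>The homotopy extension property of \<open>geom C\<close> in \<open>geom K\<close>, in
  the explicit form given by the collar.\<close>

lemma geom_contraction_extends:
  fixes h :: "real \<Rightarrow> ('v \<Rightarrow> real) \<Rightarrow> 'v \<Rightarrow> real"
  assumes h: "continuous_on ({0..1} \<times> geom C) (\<lambda>z. h (fst z) (snd z))"
    and h_mem: "\<And>t f. \<lbrakk>0 \<le> t; t \<le> 1; f \<in> geom C\<rbrakk> \<Longrightarrow> h t f \<in> geom C"
    and h_0: "\<And>f. f \<in> geom C \<Longrightarrow> h 0 f = f"
  obtains H where "continuous_on ({0..1} \<times> geom K) (\<lambda>z. H (fst z) (snd z))"
    "\<And>t f. \<lbrakk>0 \<le> t; t \<le> 1; f \<in> geom K\<rbrakk> \<Longrightarrow> H t f \<in> geom K"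
    "\<And>f. f \<in> geom K \<Longrightarrow> H 0 f = f"
    "\<And>t f. \<lbrakk>0 \<le> t; t \<le> 1; f \<in> geom C\<rbrakk> \<Longrightarrow> H t f = h t f"
proof -
  \<comment> \<open>The time left for \<open>h\<close> is \<open>t - 2 * depth f\<close>: all of
    \<open>t\<close> on \<open>geom C\<close>, and 0 at the inner rim of the collar, where
    \<open>h 0\<close> is the identity and the two branches agree.\<close>
  define H where "H t f = (if depth f - t / 2 \<le> 0 then h (t - 2 * depth f) (G t f) else G t f)" for t f
  let ?S = "{0..1} \<times> geom K"
  have cd: "continuous_on S (\<lambda>z. depth (snd z))" for S :: "(real \<times> ('v \<Rightarrow> real)) set"
    unfolding depth_def by (intro continuous_intros continuous_m_snd)
  show thesis
  proof
    show "continuous_on ?S (\<lambda>z. H (fst z) (snd z))"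
      unfolding H_def
    proof (rule continuous_on_cases_le)
      let ?A = "{z \<in> ?S. depth (snd z) - fst z / 2 \<le> 0}"
      have "continuous_on ?A (\<lambda>z. (fst z - 2 * depth (snd z), G (fst z) (snd z)))"
        by (intro continuous_intros cd continuous_on_subset[OF continuous_G]) auto
      moreover have "(\<lambda>z. (fst z - 2 * depth (snd z), G (fst z) (snd z))) ` ?A \<subseteq> {0..1} \<times> geom C"
        using G_in_geom(2) depth_nonneg by fastforce
      ultimately have "continuous_on ?A (\<lambda>z. h (fst (fst z - 2 * depth (snd z), G (fst z) (snd z)))
            (snd (fst z - 2 * depth (snd z), G (fst z) (snd z))))"
        by (rule continuous_on_compose2[OF h])
      then show "continuous_on ?A (\<lambda>z. h (fst z - 2 * depth (snd z)) (G (fst z) (snd z)))"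
        by simp
      show "continuous_on {z \<in> ?S. 0 \<le> depth (snd z) - fst z / 2} (\<lambda>z. G (fst z) (snd z))"
        by (rule continuous_on_subset[OF continuous_G]) auto
      show "continuous_on ?S (\<lambda>z. depth (snd z) - fst z / 2)"
        by (intro continuous_intros cd) auto
      show "h (fst z - 2 * depth (snd z)) (G (fst z) (snd z)) = G (fst z) (snd z)"
        if "z \<in> ?S" "depth (snd z) - fst z / 2 = 0" for z
        using that h_0 G_in_geom(2)[of "snd z" "fst z"] by auto
    qed
    show "H t f \<in> geom K" if "0 \<le> t" "t \<le> 1" "f \<in> geom K" for t f
      using G_in_geom[OF that(3,1,2)] h_mem[of "t - 2 * depth f" "G t f"] depth_nonneg[OF that(3)] that geom_C_subset
      by (auto simp: H_def)
    show "H 0 f = f" if f: "f \<in> geom K" for f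
    proof (cases "depth f \<le> 0")
      case True
      then have "depth f = 0" using depth_nonneg[OF f] by simp
      then show ?thesis using G_in_geom(2)[OF f, of 0] G_0[OF f] h_0 by (simp add: H_def)
    next
      case False
      then show ?thesis using G_0[OF f] by (simp add: H_def)
    qed
    show "H t f = h t f" if "0 \<le> t" "t \<le> 1" "f \<in> geom C" for t f
      using that depth_eq_0 G_fixed by (simp add: H_def)
  qed
qed

text \<open>The classical argument for collapsing a contractible subcomplex. The contraction of
  \<open>geom C\<close> extends to \<open>H\<close>. As \<open>H 1\<close> is constant on
  \<open>geom C\<close>, it factors through \<open>q\<close> and yields the inverse
  \<open>g\<close>; as every \<open>H t\<close> maps \<open>geom C\<close> into itself,
  \<open>q\<close> after \<open>H\<close> descends to a homotopy \<open>J\<close> on the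
  wedge.\<close>

theorem geom_homotopy_equivalent_wedge:
  assumes contr: "contractible (geom C)" and ne: "geom C \<noteq> {}" and k: "k > 0"
  shows "top_of_set (geom K) homotopy_equivalent_space top_of_set W"
proof -
  obtain c where "homotopic_with_canon (\<lambda>_. True) (geom C) (geom C) id (\<lambda>_. c)"
    using contr by (auto simp: contractible_def)
  then have "\<exists>h'. continuous_on ({0..1::real} \<times> geom C) h' \<and> h' \<in> {0..1} \<times> geom C \<rightarrow> geom C
      \<and> (\<forall>f. h' (0, f) = f) \<and> (\<forall>f. h' (1, f) = c)"
    by (auto simp: homotopic_with_def)
  then obtain h' where h': "continuous_on ({0..1::real} \<times> geom C) h'" "h' \<in> {0..1} \<times> geom C \<rightarrow> geom C"
      "\<And>f. h' (0, f) = f" "\<And>f. h' (1, f) = c"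
    by blast
  obtain H where H: "continuous_on ({0..1} \<times> geom K) (\<lambda>z. H (fst z) (snd z))"
      "\<And>t f. \<lbrakk>0 \<le> t; t \<le> 1; f \<in> geom K\<rbrakk> \<Longrightarrow> H t f \<in> geom K"
      "\<And>f. f \<in> geom K \<Longrightarrow> H 0 f = f"
      "\<And>t f. \<lbrakk>0 \<le> t; t \<le> 1; f \<in> geom C\<rbrakk> \<Longrightarrow> H t f = h' (t, f)"
    by (rule geom_contraction_extends[of "\<lambda>t f. h' (t, f)"]) (use h' in auto)
  have HC: "H t f \<in> geom C" if "0 \<le> t" "t \<le> 1" "f \<in> geom C" for t f
    using H(4)[OF that] h'(2) that by auto
  have q_lift: "H t f = H t f' \<or> H t f \<in> geom C \<and> H t f' \<in> geom C"
    if "f \<in> geom K" "f' \<in> geom K" "q f = q f'" "0 \<le> t" "t \<le> 1" for t f f'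
    using q_inj[OF that(1-3)] HC that(4,5) by blast
  let ?X = "top_of_set (geom K)" and ?W = "top_of_set W"
  have compactX: "compact (geom K)" by (intro compact_geom K)
  have q_map: "continuous_map ?X ?W q"
    using continuous_q q_in_W k by auto
  have q_quot: "quotient_map ?X ?W q"
    using compactX image_q[OF ne k] q_map
    by (intro continuous_closed_imp_quotient_map T1_Spaces.continuous_imp_closed_map)
       (auto simp: Hausdorff_top_of_set_fun compact_space_subtopology)
  have H1: "continuous_map ?X ?X (H 1)"
  proof -
    have "continuous_on (geom K) (\<lambda>f. (1::real, f))" by (intro continuous_intros)
    then have "continuous_on (geom K) (\<lambda>f. H (fst (1::real, f)) (snd (1::real, f)))"
      by (rule continuous_on_compose2[OF H(1)]) auto
    then show ?thesis using H(2)[of 1] by auto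
  qed
  have H1_eq: "H 1 f = H 1 f'" if "f \<in> topspace ?X" "f' \<in> topspace ?X" "q f = q f'" for f f'
    using q_inj[of f f'] that H(4)[of 1] h'(4) by auto
  obtain g where g: "continuous_map ?W ?X g" "g ` topspace ?W = H 1 ` topspace ?X"
      "\<And>f. f \<in> topspace ?X \<Longrightarrow> g (q f) = H 1 f"
    by (rule quotient_map_lift_exists[OF q_quot H1], erule (2) H1_eq, rule that)
  have gq: "homotopic_with (\<lambda>_. True) ?X ?X (g \<circ> q) id"
    by (rule homotopic_with_symD, rule homotopic_top_of_setI[of _ H]) (use H g(3) in auto)
  \<comment> \<open>To descend a homotopy, the product of the interval with \<open>q\<close> must be
    a quotient map. It is one for the same reason as \<open>q\<close>: compact source, Hausdorff
    target.\<close>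
  let ?IX = "top_of_set ({0..1::real} \<times> geom K)" and ?IW = "top_of_set ({0..1::real} \<times> W)"
  have "continuous_on ({0..1::real} \<times> geom K) (\<lambda>z. (fst z, q (snd z)))"
    by (intro continuous_intros continuous_on_compose2[OF continuous_q[of UNIV]]) auto
  then have "continuous_map ?IX ?IW (\<lambda>z. (fst z, q (snd z)))"
    using q_in_W k by auto
  moreover have "compact_space ?IX"
    using compactX by (simp add: compact_space_subtopology compact_Times)
  moreover have "Hausdorff_space ?IW"
    unfolding prod_topology_subtopology_eu[symmetric]
    by (simp add: Hausdorff_space_prod_topology Hausdorff_top_of_set_fun Hausdorff_space_subtopology)
  moreover have "(\<lambda>z. (fst z, q (snd z))) ` ({0..1} \<times> geom K) = {0..1} \<times> W"
    unfolding image_q[OF ne k, symmetric] by force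
  ultimately have quot: "quotient_map ?IX ?IW (\<lambda>z. (fst z, q (snd z)))"
    by (intro continuous_closed_imp_quotient_map T1_Spaces.continuous_imp_closed_map) auto
  have "continuous_on ({0..1} \<times> geom K) (\<lambda>z. q (H (fst z) (snd z)))"
    by (rule continuous_on_compose2[OF continuous_q[of UNIV] H(1)]) auto
  then have qH: "continuous_map ?IX ?W (\<lambda>z. q (H (fst z) (snd z)))"
    using H(2) q_in_W k by auto
  have qH_eq: "q (H (fst z) (snd z)) = q (H (fst z') (snd z'))"
    if z: "z \<in> topspace ?IX" "z' \<in> topspace ?IX" "(fst z, q (snd z)) = (fst z', q (snd z'))" for z z'
  proof -
    have "H (fst z) (snd z) = H (fst z) (snd z') \<or> H (fst z) (snd z) \<in> geom C \<and> H (fst z) (snd z') \<in> geom C"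
      using z by (intro q_lift) auto
    moreover have "q f = (\<lambda>_. 0)" if "f \<in> geom C" for f
      using q_eq_0_iff geom_C_subset that by blast
    ultimately show ?thesis using z(3) by force
  qed
  obtain J where J: "continuous_map ?IW ?W J"
      "J ` topspace ?IW = (\<lambda>z. q (H (fst z) (snd z))) ` topspace ?IX"
      "\<And>z. z \<in> topspace ?IX \<Longrightarrow> J (fst z, q (snd z)) = q (H (fst z) (snd z))"
    by (rule quotient_map_lift_exists[OF quot qH], erule (2) qH_eq, rule that)
  have J': "J (t, q f) = q (H t f)" if "0 \<le> t" "t \<le> 1" "f \<in> geom K" for t f
    using J(3)[of "(t, f)"] that by simp
  have qg: "homotopic_with (\<lambda>_. True) ?W ?W (q \<circ> g) id"
  proof (rule homotopic_with_symD, rule homotopic_top_of_setI[of _ "\<lambda>t x. J (t, x)"])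
    show "continuous_on ({0..1} \<times> W) (\<lambda>z. J (fst z, snd z))" using J(1) by simp
    show "J (t, x) \<in> W" if "0 \<le> t" "t \<le> 1" "x \<in> W" for t x using J(1) that by auto
    show "J (0, x) = id x" if "x \<in> W" for x
      using that J'[of 0] H(3) unfolding image_q[OF ne k, symmetric] by auto
    show "J (1, x) = (q \<circ> g) x" if "x \<in> W" for x
      using that J'[of 1] g(3) unfolding image_q[OF ne k, symmetric] by auto
  qed
  show ?thesis
    unfolding homotopy_equivalent_space_def using q_map g(1) gq qg by blast
qed

end

section \<open>Collapsibility checks on facet lists\<close>

text \<open>The lists are generators and need not be maximal faces. The empty list stands for the
  void complex, without even the empty face.\<close>

definition faces :: "'a list list \<Rightarrow> 'a set set" where
  "faces Fs = {\<rho>. \<exists>F\<in>set Fs. \<rho> \<subseteq> set F}"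

fun add_face :: "'a list \<Rightarrow> 'a list list \<Rightarrow> 'a list list" where
  "add_face F Gs = (if \<exists>G\<in>set Gs. set F \<subseteq> set G then Gs else F # Gs)"

text \<open>The faces of a generator \<open>F\<close> that do not contain \<open>s\<close> are the
  faces of the sets \<open>F - {x}\<close> with \<open>x\<close> in \<open>s\<close>. For
  \<open>s = []\<close> there are none, and the result is the void complex.\<close>

fun delete_star :: "'a list \<Rightarrow> 'a list list \<Rightarrow> 'a list list" where
  "delete_star s Fs = fold (\<lambda>F. fold (\<lambda>x. add_face (removeAll x F)) s)
     (filter (\<lambda>F. set s \<subseteq> set F) Fs) (filter (\<lambda>F. \<not> set s \<subseteq> set F) Fs)"

text \<open>Testing generators is enough: a face above \<open>s\<close> lies in a generator above
  \<open>s\<close>, which contains \<open>w\<close>, so the face can be joined with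
  \<open>w\<close>.\<close>

fun try_step :: "'a list \<times> 'a \<Rightarrow> 'a list list \<Rightarrow> 'a list list" where
  "try_step (s, w) Fs =
     (if w \<notin> set s \<and> (\<forall>F\<in>set Fs. set s \<subseteq> set F \<longrightarrow> w \<in> set F) then delete_star s Fs else Fs)"

fun cone :: "'a list list \<Rightarrow> bool" where
  "cone [] = True"
| "cone (F # Fs) = (\<exists>w\<in>set F. \<forall>G\<in>set Fs. w \<in> set G)"

definition collapses :: "('a list \<times> 'a) list \<Rightarrow> 'a list list \<Rightarrow> bool" where
  "collapses steps Fs = cone (fold try_step steps Fs)"

lemma faces_add_face: "faces (add_face F Gs) = faces (F # Gs)"
  by (auto simp: faces_def)

lemma faces_Cons: "faces (F # Fs) = Pow (set F) \<union> faces Fs"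
  by (auto simp: faces_def)

lemma faces_fold_add_face: "faces (fold add_face Fs Gs) = faces Fs \<union> faces Gs"
  by (induction Fs arbitrary: Gs) (auto simp: faces_add_face faces_Cons faces_def[of "[]"] simp del: add_face.simps)

lemma faces_delete_star: "faces (delete_star s Fs) = minus_star (faces Fs) (set s)"
proof -
  have inner: "faces (fold (\<lambda>x. add_face (removeAll x F)) s Gs)
      = {\<rho>. \<rho> \<subseteq> set F \<and> \<not> set s \<subseteq> \<rho>} \<union> faces Gs" if "set s \<subseteq> set F" for F and Gs
  proof -
    have "faces (fold (\<lambda>x. add_face (removeAll x F)) s' Gs) = (\<Union>x\<in>set s'. Pow (set F - {x})) \<union> faces Gs" for s'
      by (induction s' arbitrary: Gs) (auto simp: faces_add_face faces_Cons simp del: add_face.simps)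
    moreover have "(\<Union>x\<in>set s. Pow (set F - {x})) = {\<rho>. \<rho> \<subseteq> set F \<and> \<not> set s \<subseteq> \<rho>}"
      using that by auto
    ultimately show ?thesis by simp
  qed
  have "faces (fold (\<lambda>F. fold (\<lambda>x. add_face (removeAll x F)) s) Fs' Gs)
      = {\<rho>\<in>faces Fs'. \<not> set s \<subseteq> \<rho>} \<union> faces Gs" if "\<forall>F\<in>set Fs'. set s \<subseteq> set F" for Fs' Gs
    using that by (induction Fs' arbitrary: Gs) (auto simp: inner faces_Cons faces_def[of "[]"] simp del: add_face.simps)
  then show ?thesis
    by (auto simp: faces_def minus_star_def)
qed

lemma is_complex_faces: "is_complex (faces Fs)"
  by (auto simp: is_complex_def faces_def finite_subset)

lemma collapsible_faces:
  assumes "collapses steps Fs"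
  shows "collapsible (faces Fs)"
  using assms
proof (induction steps arbitrary: Fs)
  case Nil
  show ?case
  proof (cases Fs)
    case Nil
    then show ?thesis by (simp add: faces_def collapsible.empty)
  next
    case (Cons F Fs')
    then obtain w where w: "\<forall>G\<in>set Fs. w \<in> set G" using Nil by (auto simp: collapses_def)
    have "minus_star (faces Fs) {} = {}" by (simp add: minus_star_def)
    then show ?thesis
      using w by - (rule collapsible.step[of w "{}"], auto simp: faces_def collapsible.empty)
  qed
next
  case (Cons st steps)
  obtain s w where st: "st = (s, w)" by force
  have IH: "collapsible (faces (try_step st Fs))"
    using Cons by (auto simp: collapses_def)
  show ?case
  proof (cases "w \<notin> set s \<and> (\<forall>F\<in>set Fs. set s \<subseteq> set F \<longrightarrow> w \<in> set F)")
    case True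
    then have "collapsible (minus_star (faces Fs) (set s))"
      using IH unfolding st by (simp add: faces_delete_star del: delete_star.simps)
    moreover have "insert w \<rho> \<in> faces Fs" if "\<rho> \<in> faces Fs" "set s \<subseteq> \<rho>" for \<rho>
      using that True unfolding faces_def by (auto intro!: bexI)
    ultimately show ?thesis
      using True by - (rule collapsible.step[of w "set s"], auto)
  next
    case False
    then show ?thesis using IH by (simp only: st try_step.simps if_False)
  qed
qed

text \<open>The label \<open>V (v, w)\<close> stands for the pair \<open>v < {v, w}\<close> of the Hasse diagram. Naming a triangle by
  the opposite vertex, \<open>Q (t, s)\<close> is the pair matching the triangle \<open>t\<close> with the edge it shares with
  the triangle \<open>s\<close>, and \<open>T t\<close> matches the triangle \<open>t\<close> with the solid tetrahedron. A rooted tree is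
  encoded as a selfmap sending each point to its parent and the root to itself.\<close>

datatype pt = P0 | P1 | P2 | P3
type_synonym arc = "pt \<times> pt"
datatype selfmap = Selfmap pt pt pt pt
datatype lab = V arc | Q arc | T pt

section \<open>Enumeration of the tree pairs\<close>

definition pts :: "pt list" where "pts = [P0, P1, P2, P3]"

fun app :: "selfmap \<Rightarrow> pt \<Rightarrow> pt" where
  "app (Selfmap a b c d) v = (case v of P0 \<Rightarrow> a | P1 \<Rightarrow> b | P2 \<Rightarrow> c | P3 \<Rightarrow> d)"

definition root :: "selfmap \<Rightarrow> pt" where
  "root f = app f (app f (app f P0))"

definition arcs :: "selfmap \<Rightarrow> arc list" where
  "arcs f = filter (\<lambda>(v, w). v \<noteq> w) (map (\<lambda>v. (v, app f v)) pts)"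

text \<open>In a rooted tree on four points every point reaches the root in at most three steps.
  Conversely, if the third iterate is constant, its value is the only fixed point and there are no
  longer cycles.\<close>

definition rooted :: "selfmap \<Rightarrow> bool" where
  "rooted f \<longleftrightarrow> list_all (\<lambda>v. app f (app f (app f v)) = root f) pts"

definition trees_within :: "(pt \<Rightarrow> pt list) \<Rightarrow> selfmap list" where
  "trees_within N = filter rooted (map (\<lambda>(a, b, c, d). Selfmap a b c d)
     (List.product (N P0) (List.product (N P1) (List.product (N P2) (N P3)))))"

definition neighbours :: "selfmap \<Rightarrow> pt \<Rightarrow> pt list" where
  "neighbours f v = filter (\<lambda>s. s = v \<or> app f v = s \<or> app f s = v) pts"

text \<open>The triangles opposite \<open>v\<close> and \<open>s\<close> share the edge joining the
  other two points. That edge is free for the dual tree when every arc of \<open>f\<close> meets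
  \<open>{v, s}\<close>.\<close>

definition dual_neighbours :: "selfmap \<Rightarrow> pt \<Rightarrow> pt list" where
  "dual_neighbours f v = filter (\<lambda>s. s = v \<or> list_all (\<lambda>(a, b). a = v \<or> a = s \<or> b = v \<or> b = s) (arcs f)) pts"

type_synonym row = "selfmap list \<times> (pt \<times> arc list) list"

text \<open>One row for each of the 16 spanning trees, represented by its rooting at
  \<open>P0\<close>: its four rootings, and the four rootings of the dual tree on the complementary
  edges. The two choices in a row are independent, so the 16 rows encode 16 * 4 * 4 = 256
  pairs.\<close>

definition tree_table :: "row list" where
  "tree_table = map (\<lambda>f. (trees_within (neighbours f), map (\<lambda>g. (root g, arcs g)) (trees_within (dual_neighbours f))))
     (trees_within (\<lambda>v. if v = P0 then [P0] else pts))"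

text \<open>Rows left without a primal tree are dropped, so that every dual tree still listed
  belongs to a pair with the prescribed arc.\<close>

definition restrict_row :: "pt \<Rightarrow> pt \<Rightarrow> row list \<Rightarrow> row list" where
  "restrict_row v w R = filter (\<lambda>(fs, _). fs \<noteq> []) (map (\<lambda>(fs, gs). (filter (\<lambda>f. app f v = w) fs, gs)) R)"

text \<open>The transposition of \<open>P0\<close> and \<open>t\<close>, a symmetry of the
  situation: it carries the steps for the dual root \<open>P0\<close> to the dual root
  \<open>t\<close>.\<close>

definition swap :: "pt \<Rightarrow> pt \<Rightarrow> pt" where
  "swap t v = (if v = P0 then t else if v = t then P0 else v)"

definition swap_arc :: "pt \<Rightarrow> arc \<Rightarrow> arc" where
  "swap_arc t = map_prod (swap t) (swap t)"
text \<open>The collapsing sequences below were found by a computer search. Each of the first two serves for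
  many links at once, because steps that do not apply are skipped.\<close>

definition pair_steps :: "(arc list \<times> arc) list" where
  "pair_steps =
    [([(P0,P2)],(P1,P0)), ([(P3,P2)],(P1,P3)), ([(P2,P1)],(P3,P2)), ([(P1,P2)],(P3,P1)),
    ([(P0,P3)],(P1,P0)), ([(P0,P2)],(P3,P0)), ([(P3,P1)],(P2,P3)), ([(P0,P1)],(P3,P0)),
    ([(P1,P3)],(P2,P1)), ([(P0,P3)],(P2,P0)), ([(P0,P1)],(P2,P0)), ([(P1,P2)],(P0,P1)),
    ([(P1,P0)],(P2,P1)), ([(P1,P0)],(P3,P2)), ([(P2,P3)],(P1,P2)), ([(P2,P3)],(P0,P2)),
    ([(P3,P0)],(P2,P3)), ([(P2,P1)],(P0,P2)), ([(P2,P0)],(P1,P2)), ([(P0,P3)],(P3,P2)),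
    ([(P3,P0)],(P1,P3)), ([(P2,P3)],(P3,P0)), ([(P1,P3)],(P3,P2)), ([(P3,P2)],(P0,P3)),
    ([(P1,P0)],(P0,P3)), ([(P1,P3)],(P3,P0)), ([(P2,P0)],(P3,P2)), ([(P3,P1)],(P0,P3)),
    ([(P0,P3)],(P3,P1)), ([(P1,P0)],(P3,P1)), ([(P2,P1)],(P1,P0)), ([(P1,P3)],(P0,P1)),
    ([(P2,P0)],(P0,P1)), ([(P1,P0)],(P0,P2)), ([(P2,P0)],(P0,P3)), ([(P2,P1)],(P1,P3)),
    ([(P2,P3)],(P3,P1))]"

definition root_steps :: "(arc list \<times> arc) list" where
  "root_steps =
    [([(P1,P2),(P2,P3)],(P3,P0)), ([(P1,P2)],(P2,P0)), ([(P3,P1)],(P1,P0)),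
    ([(P1,P3),(P3,P2)],(P2,P0)), ([(P3,P2)],(P1,P0)), ([(P2,P3)],(P1,P0)), ([(P3,P1)],(P2,P0)),
    ([(P2,P1)],(P1,P0)), ([(P3,P2)],(P2,P0))]"


definition swap_steps :: "pt \<Rightarrow> (arc list \<times> arc) list" where
  "swap_steps t = map (map_prod (map (swap_arc t)) (swap_arc t)) root_steps"


text \<open>The checks recurse by pattern matching on concrete lists: under a binder the simplifier would
  evaluate them symbolically.\<close>

fun check_pairs :: "arc list \<Rightarrow> (pt \<times> arc list) list \<Rightarrow> bool" where
  "check_pairs (_ # _ # _) gs = collapses pair_steps (map snd gs)"
| "check_pairs _ gs = True"

definition check_root :: "pt \<Rightarrow> (pt \<times> arc list) list \<Rightarrow> bool" where
  "check_root t gs = collapses (swap_steps t) (map snd (filter (\<lambda>(r, _). r = t) gs))"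

definition check_link :: "arc list \<Rightarrow> (pt \<times> arc list) list \<Rightarrow> bool" where
  "check_link p gs \<longleftrightarrow> check_pairs p gs \<and>
     check_root P0 gs \<and> check_root P1 gs \<and> check_root P2 gs \<and> check_root P3 gs"

text \<open>A depth-first search through the sets \<open>p\<close> of arcs that lie in some primal
  tree: each point gets either no prescribed arc or an arc to another point, and \<open>R\<close>
  keeps the pairs that respect \<open>p\<close>. An empty \<open>R\<close> ends the branch, as no
  tree contains \<open>p\<close>.\<close>

fun check_extensions :: "pt list \<Rightarrow> arc list \<Rightarrow> row list \<Rightarrow> bool" where
  "check_extensions vs p [] = True"
| "check_extensions [] p (r # R) = check_link p (concat (map snd (r # R)))"
| "check_extensions (v # vs) p (r # R) \<longleftrightarrow> check_extensions vs p (r # R) \<and>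
     (v = P0 \<or> check_extensions vs ((v, P0) # p) (restrict_row v P0 (r # R))) \<and>
     (v = P1 \<or> check_extensions vs ((v, P1) # p) (restrict_row v P1 (r # R))) \<and>
     (v = P2 \<or> check_extensions vs ((v, P2) # p) (restrict_row v P2 (r # R))) \<and>
     (v = P3 \<or> check_extensions vs ((v, P3) # p) (restrict_row v P3 (r # R)))"

lemma check_extensions_tree_table: "check_extensions pts [] tree_table"
  by code_simp

text \<open>For each entry, the given arcs all have the same link; it becomes collapsible, by the given steps, once
  the listed nine triangles are removed.\<close>

definition critical_table :: "(arc list \<times> arc list list \<times> (arc list \<times> arc) list) list" where
  "critical_table = [
    ([(P0,P1)],
     [[(P1,P2),(P2,P0),(P3,P0)], [(P0,P1),(P2,P1),(P3,P0)], [(P0,P1),(P2,P0),(P3,P0)],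
     [(P0,P3),(P1,P3),(P2,P0)], [(P0,P3),(P1,P0),(P2,P0)], [(P1,P3),(P2,P0),(P3,P0)],
     [(P0,P2),(P1,P0),(P3,P0)], [(P0,P2),(P1,P3),(P3,P0)], [(P0,P3),(P1,P2),(P2,P0)]],
     [([(P1,P3),(P2,P0)],(P0,P1)), ([(P1,P3)],(P2,P1)), ([(P0,P3),(P1,P0)],(P2,P1)),
     ([(P0,P3)],(P3,P1)), ([(P0,P1),(P3,P0)],(P1,P2)), ([(P0,P1)],(P3,P1)),
     ([(P1,P2),(P3,P0)],(P0,P2)), ([(P1,P2)],(P3,P1)), ([(P2,P0)],(P1,P0)), ([(P3,P0)],(P2,P1)),
     ([],(P3,P1))]),
    ([(P0,P2)],
     [[(P0,P1),(P1,P2),(P3,P2)], [(P1,P0),(P2,P0),(P3,P0)], [(P1,P0),(P2,P0),(P3,P2)],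
     [(P1,P0),(P2,P1),(P3,P0)], [(P0,P3),(P1,P2),(P3,P2)], [(P0,P2),(P2,P1),(P3,P0)],
     [(P0,P3),(P2,P1),(P3,P2)], [(P0,P1),(P1,P2),(P2,P3)], [(P1,P2),(P2,P3),(P3,P0)]],
     [([(P2,P1),(P3,P0)],(P0,P1)), ([(P1,P0),(P2,P0)],(P0,P3)), ([(P0,P3),(P2,P1)],(P1,P0)),
     ([(P2,P1)],(P3,P2)), ([(P0,P1),(P3,P2)],(P2,P0)), ([(P0,P1)],(P3,P0)), ([(P2,P0)],(P1,P2)),
     ([(P0,P3),(P1,P2)],(P2,P3)), ([(P1,P2)],(P0,P2)), ([],(P1,P0))]),
    ([(P0,P3)],
     [[(P0,P1),(P2,P3),(P3,P0)], [(P1,P0),(P2,P0),(P3,P1)], [(P1,P0),(P2,P0),(P3,P2)],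
     [(P0,P2),(P1,P0),(P3,P1)], [(P0,P2),(P1,P3),(P3,P2)], [(P0,P2),(P1,P3),(P2,P3)],
     [(P0,P3),(P2,P0),(P3,P1)], [(P0,P1),(P1,P3),(P3,P2)], [(P1,P0),(P2,P0),(P3,P0)]],
     [([(P0,P2),(P1,P3)],(P3,P0)), ([(P1,P0),(P2,P0)],(P0,P3)), ([(P2,P0),(P3,P1)],(P0,P1)),
     ([(P3,P1)],(P2,P3)), ([(P0,P2)],(P1,P0)), ([(P1,P0),(P3,P0)],(P2,P3)), ([(P1,P0)],(P0,P3)),
     ([(P2,P3)],(P1,P3)), ([(P0,P1)],(P2,P0)), ([],(P1,P3))]),
    ([(P1,P2),(P2,P1)],
     [[(P0,P1),(P1,P3),(P2,P3)], [(P0,P1),(P1,P2),(P3,P1)], [(P0,P1),(P2,P3),(P3,P1)],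
     [(P0,P2),(P1,P3),(P2,P1)], [(P0,P2),(P1,P0),(P3,P1)], [(P1,P0),(P2,P3),(P3,P1)],
     [(P0,P2),(P2,P1),(P3,P2)], [(P0,P1),(P1,P3),(P2,P0)], [(P1,P0),(P2,P1),(P3,P1)]],
     [([(P1,P3),(P2,P1)],(P0,P1)), ([(P0,P1),(P2,P3)],(P1,P2)), ([(P2,P3)],(P0,P2)),
     ([(P1,P3)],(P3,P2)), ([(P1,P0),(P3,P1)],(P2,P0)), ([(P1,P0)],(P3,P2)),
     ([(P0,P2),(P3,P2)],(P1,P2)), ([(P0,P2)],(P3,P1)), ([(P2,P1)],(P0,P1)), ([(P3,P1)],(P2,P0)),
     ([],(P3,P2))]),
    ([(P1,P3),(P3,P1)],
     [[(P0,P1),(P2,P1),(P3,P2)], [(P0,P1),(P1,P3),(P3,P2)], [(P1,P2),(P2,P3),(P3,P0)],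
     [(P0,P1),(P2,P3),(P3,P1)], [(P1,P0),(P2,P1),(P3,P2)], [(P0,P1),(P1,P3),(P2,P3)],
     [(P1,P0),(P2,P1),(P3,P0)], [(P0,P3),(P2,P1),(P3,P1)], [(P0,P3),(P1,P3),(P2,P3)]],
     [([(P1,P3),(P2,P3)],(P3,P0)), ([(P0,P1),(P3,P2)],(P1,P2)), ([(P3,P2)],(P0,P3)),
     ([(P1,P3)],(P2,P1)), ([(P1,P0),(P3,P0)],(P2,P3)), ([(P3,P0)],(P0,P1)),
     ([(P0,P1),(P2,P3)],(P1,P2)), ([(P0,P1)],(P3,P1)), ([(P1,P2)],(P0,P3)), ([(P2,P1)],(P1,P0)),
     ([],(P2,P3))]),
    ([(P2,P3),(P3,P2)],
     [[(P0,P3),(P1,P3),(P2,P0)], [(P0,P3),(P1,P3),(P2,P1)], [(P0,P2),(P1,P2),(P3,P0)],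
     [(P0,P2),(P1,P2),(P2,P3)], [(P0,P3),(P1,P2),(P2,P0)], [(P1,P2),(P2,P3),(P3,P0)],
     [(P0,P3),(P2,P1),(P3,P2)], [(P0,P2),(P1,P3),(P2,P3)], [(P0,P2),(P1,P3),(P2,P1)]],
     [([(P1,P3),(P2,P1)],(P3,P0)), ([(P0,P2),(P2,P3)],(P3,P1)), ([(P2,P1),(P3,P0)],(P0,P2)),
     ([(P2,P1),(P3,P2)],(P0,P2)), ([(P2,P1)],(P3,P1)), ([(P1,P2),(P3,P0)],(P2,P0)),
     ([(P3,P0)],(P1,P3)), ([(P2,P3)],(P0,P3)), ([(P1,P3)],(P3,P2)), ([(P3,P2)],(P1,P2)),
     ([],(P3,P1))])]"

definition star_steps :: "(lab list \<times> lab) list" where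
  "star_steps =
    [([Q (P2,P3),Q (P3,P1)],V (P3,P0)), ([Q (P1,P3),Q (P2,P3)],V (P3,P0)),
    ([Q (P1,P3),Q (P2,P1)],V (P1,P0)), ([Q (P1,P2),Q (P3,P1)],V (P1,P0)),
    ([Q (P2,P1),Q (P3,P1)],V (P1,P0)), ([Q (P1,P2),Q (P3,P2)],V (P2,P0)),
    ([Q (P1,P2),Q (P2,P3)],V (P2,P0)), ([Q (P2,P1),Q (P3,P2)],V (P2,P0)),
    ([Q (P1,P3),Q (P3,P2)],V (P3,P0)), ([Q (P0,P1),Q (P1,P3)],Q (P2,P0)),
    ([Q (P0,P3),Q (P1,P2)],Q (P2,P0)), ([Q (P1,P2)],Q (P3,P0)),
    ([Q (P0,P3),V (P2,P0)],Q (P1,P0)), ([Q (P2,P1),V (P2,P0)],Q (P3,P0)),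
    ([Q (P2,P1)],V (P1,P0)), ([Q (P0,P2),V (P2,P0)],Q (P1,P0)),
    ([Q (P0,P3),V (P1,P0)],Q (P2,P0)), ([Q (P0,P3)],V (P3,P0)), ([Q (P1,P3)],Q (P3,P0)),
    ([Q (P0,P2)],Q (P1,P0)), ([Q (P2,P3)],Q (P3,P0)), ([],Q (P2,P0))]"

definition facets_at :: "arc \<Rightarrow> arc list list" where
  "facets_at x = map snd (concat (map snd (restrict_row (fst x) (snd x) tree_table)))"

fun check_critical :: "arc list \<Rightarrow> arc list list \<Rightarrow> (arc list \<times> arc) list \<Rightarrow> bool" where
  "check_critical [] cs steps = True"
| "check_critical (x # xs) cs steps \<longleftrightarrow> collapses steps (fold delete_star cs (facets_at x)) \<and>
     list_all (\<lambda>c. list_ex (\<lambda>F. set c \<subseteq> set F) (facets_at x)) cs \<and> check_critical xs cs steps"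

lemma check_critical_table:
  "list_all (\<lambda>(xs, cs, steps). check_critical xs cs steps) critical_table"
  by code_simp

section \<open>The 81 cells and the collapsible remainder\<close>

definition critical_pairs :: "(arc \<times> arc list) list" where
  "critical_pairs = concat (map (\<lambda>(xs, cs, _). List.product xs cs) critical_table)"

text \<open>All the sets involved have three elements, so non-inclusion is the same as being
  different.\<close>

definition distinct_pairs :: "(arc \<times> arc list) list \<Rightarrow> bool" where
  "distinct_pairs = sorted_wrt (\<lambda>(x, c) (x', c'). if x = x' then \<not> set c \<subseteq> set c' else True)"

lemma critical_pairs_distinct: "distinct_pairs critical_pairs"
  by code_simp

lemma critical_pairs_card:
  "length critical_pairs = 81" "list_all (\<lambda>(x, c). distinct c \<and> length c = 3) critical_pairs"
  by code_simp+

lemma critical_arcs_distinct: "distinct (concat (map fst critical_table))"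
  by code_simp

definition star_arcs :: "arc list" where
  "star_arcs = [(P1, P0), (P2, P0), (P3, P0)]"

lemma critical_or_star_arc:
  "list_all (\<lambda>(v, w). v = w \<or> (v, w) \<in> set star_arcs \<or> (v, w) \<in> set (concat (map fst critical_table))) (List.product pts pts)"
  "list_all (\<lambda>x. x \<notin> set (concat (map fst critical_table))) star_arcs"
  by code_simp+

definition all_facets :: "arc list list" where
  "all_facets = map snd (concat (map snd tree_table))"

text \<open>Generators of what is left once the open stars of the vertices \<open>V x\<close> of the
  nine critical arcs are gone: the complex of rooted dual forests, with a cone over the link of each
  arc into \<open>P0\<close>.\<close>

definition star_facets :: "lab list list" where
  "star_facets = fold add_face (map (map Q) all_facets)
     (concat (map (\<lambda>x. map (\<lambda>F. V x # map Q F) (facets_at x)) star_arcs))"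

lemma collapses_star_facets: "collapses star_steps star_facets"
  by code_simp

lemma tree_table_facts:
  "list_all (\<lambda>(fs, gs). fs \<noteq> [] \<and> list_all (\<lambda>(r, F). length F = 3) gs) tree_table"
  by code_simp

section \<open>Reduction to a 3-dimensional complex\<close>

lemma collapsible_image:
  assumes "inj f" "collapsible K"
  shows "collapsible ((`) f ` K)"
  using assms(2)
proof induction
  case empty
  then show ?case by (simp add: collapsible.empty)
next
  case (step w \<sigma> K)
  have sub: "f ` \<sigma> \<subseteq> f ` \<rho> \<longleftrightarrow> \<sigma> \<subseteq> \<rho>" for \<rho>
    using assms(1) by (rule inj_image_subset_iff)
  show ?case
  proof (rule collapsible.step[of "f w" "f ` \<sigma>"])
    show "f w \<notin> f ` \<sigma>" using step(1) assms(1) by (simp add: inj_image_mem_iff)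
    show "insert (f w) \<rho> \<in> (`) f ` K" if "\<rho> \<in> (`) f ` K" "f ` \<sigma> \<subseteq> \<rho>" for \<rho>
      using that step(2) sub by (force simp flip: image_insert)
    have "minus_star ((`) f ` K) (f ` \<sigma>) = (`) f ` minus_star K \<sigma>"
      by (auto simp: minus_star_def sub)
    then show "collapsible (minus_star ((`) f ` K) (f ` \<sigma>))" using step(4) by simp
  qed
qed

definition entries :: "row list \<Rightarrow> (selfmap \<times> pt \<times> arc list) set" where
  "entries R = {(f, r, F). \<exists>(fs, gs)\<in>set R. f \<in> set fs \<and> (r, F) \<in> set gs}"

lemma entries_restrict_row: "entries (restrict_row v w R) = {(f, r, F) \<in> entries R. app f v = w}"
proof (rule set_eqI, clarify, rule iffI)
  fix f r F
  assume "(f, r, F) \<in> entries (restrict_row v w R)"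
  then show "(f, r, F) \<in> {(f, r, F) \<in> entries R. app f v = w}"
    unfolding entries_def restrict_row_def by fastforce
next
  fix f r F
  assume "(f, r, F) \<in> {(f, r, F) \<in> entries R. app f v = w}"
  then obtain fs gs where "(fs, gs) \<in> set R" "f \<in> set fs" "(r, F) \<in> set gs" "app f v = w"
    by (auto simp: entries_def)
  then have "(filter (\<lambda>f. app f v = w) fs, gs) \<in> set (restrict_row v w R)"
    "f \<in> set (filter (\<lambda>f. app f v = w) fs)"
    by (auto simp: restrict_row_def image_iff filter_empty_conv intro!: bexI[of _ "(fs, gs)"])
  then show "(f, r, F) \<in> entries (restrict_row v w R)"
    using \<open>(r, F) \<in> set gs\<close> unfolding entries_def by blast
qed

lemma restrict_row_nonempty: "(fs, gs) \<in> set (restrict_row v w R) \<Longrightarrow> fs \<noteq> []"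
  by (auto simp: restrict_row_def)

lemma set_concat_rows:
  assumes "\<And>fs gs. (fs, gs) \<in> set R \<Longrightarrow> fs \<noteq> []"
  shows "set (concat (map snd R)) = {(r, F). \<exists>f. (f, r, F) \<in> entries R}"
proof (rule set_eqI, rule iffI)
  fix e assume "e \<in> set (concat (map snd R))"
  then obtain fs gs where "(fs, gs) \<in> set R" "e \<in> set gs" by auto
  moreover from this have "hd fs \<in> set fs" by (intro hd_in_set assms)
  ultimately have "(hd fs, fst e, snd e) \<in> entries R" unfolding entries_def by auto
  then show "e \<in> {(r, F). \<exists>f. (f, r, F) \<in> entries R}" by (cases e) (auto simp del: split_paired_Ex)
next
  fix e assume "e \<in> {(r, F). \<exists>f. (f, r, F) \<in> entries R}"
  then show "e \<in> set (concat (map snd R))" by (force simp: entries_def)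
qed

text \<open>The set \<open>X\<close> selects one branch of the search: at \<open>v\<close> the arc
  of \<open>X\<close> leaving \<open>v\<close>, or no arc. The pair \<open>(f0, r0, F0)\<close>
  survives every restriction on this branch, so the search is not cut short, and at its end
  \<open>gs\<close> generates the dual part of the link of \<open>X\<close>.\<close>

lemma check_extensions_link:
  assumes "check_extensions vs p R" "\<And>fs gs. (fs, gs) \<in> set R \<Longrightarrow> fs \<noteq> []"
    and "distinct vs" "\<And>v w. (v, w) \<in> X \<Longrightarrow> v \<in> set vs \<and> v \<noteq> w"
    and "(f0, r0, F0) \<in> entries R" "\<And>v w. (v, w) \<in> X \<Longrightarrow> app f0 v = w"
  shows "\<exists>p' gs. check_link p' gs \<and> set p' = set p \<union> X \<and>
           set gs = {(r, F). \<exists>f. (f, r, F) \<in> entries R \<and> (\<forall>(v, w)\<in>X. app f v = w)}"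
  using assms
proof (induction vs arbitrary: p R X)
  case Nil
  then have X: "X = {}" by auto
  obtain r R' where R: "R = r # R'" using Nil(5) by (cases R) (auto simp: entries_def)
  show ?case
  proof (intro exI conjI)
    show "check_link p (concat (map snd R))" using Nil(1) by (simp add: R)
    show "set p = set p \<union> X" by (simp add: X)
    have "set (concat (map snd R)) = {(r, F). \<exists>f. (f, r, F) \<in> entries R}"
      by (rule set_concat_rows) (rule Nil(2))
    then show "set (concat (map snd R)) =
        {(r, F). \<exists>f. (f, r, F) \<in> entries R \<and> (\<forall>(v, w)\<in>X. app f v = w)}"
      by (simp only: X ball_simps HOL.simp_thms)
  qed
next
  case (Cons v vs)
  obtain r R' where R: "R = r # R'" using Cons.prems(5) by (cases R) (auto simp: entries_def)
  show ?case
  proof (cases "\<exists>w. (v, w) \<in> X")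
    case False
    have "check_extensions vs p R" using Cons.prems(1) by (simp add: R)
    then show ?thesis
    proof (rule Cons.IH[OF _ Cons.prems(2)])
      show "v' \<in> set vs \<and> v' \<noteq> w" if "(v', w) \<in> X" for v' w
        using Cons.prems(4)[OF that] False that by auto
    qed (use Cons.prems in auto)
  next
    case True
    then obtain w where w: "(v, w) \<in> X" by blast
    have w': "app f0 v = w" "v \<noteq> w" using Cons.prems(4,6)[OF w] by auto
    have "check_extensions vs ((v, w) # p) (restrict_row v w R)"
      using Cons.prems(1) w'(2) unfolding R by (cases w) auto
    then have "\<exists>p' gs. check_link p' gs \<and> set p' = set ((v, w) # p) \<union> (X - {(v, w)}) \<and>
           set gs = {(r, F). \<exists>f. (f, r, F) \<in> entries (restrict_row v w R) \<and> (\<forall>(v, w)\<in>X - {(v, w)}. app f v = w)}"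
    proof (rule Cons.IH)
      show "(f0, r0, F0) \<in> entries (restrict_row v w R)"
        using Cons.prems(5) w' by (simp add: entries_restrict_row)
      show "v' \<in> set vs \<and> v' \<noteq> w''" if "(v', w'') \<in> X - {(v, w)}" for v' w''
        using Cons.prems(4,6)[of v' w''] that w' by auto
    qed (use Cons.prems restrict_row_nonempty in auto)
    moreover have "set ((v, w) # p) \<union> (X - {(v, w)}) = set p \<union> X" using w by auto
    moreover have "(f, r, F) \<in> entries (restrict_row v w R) \<and> (\<forall>(v, w)\<in>X - {(v, w)}. app f v = w)
        \<longleftrightarrow> (f, r, F) \<in> entries R \<and> (\<forall>(v, w)\<in>X. app f v = w)" for f r F
    proof -
      have "(\<forall>(v, w)\<in>X. app f v = w) \<longleftrightarrow> app f v = w \<and> (\<forall>(v, w)\<in>X - {(v, w)}. app f v = w)"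
        using Set.ball_simps(7)[of "(v, w)" "X - {(v, w)}" "\<lambda>(v, w). app f v = w"]
        by (simp only: insert_Diff[OF w] case_prod_conv)
      then show ?thesis by (simp add: entries_restrict_row)
    qed
    ultimately show ?thesis by (simp only:)
  qed
qed

definition pairs :: "(selfmap \<times> pt \<times> arc list) set" where
  "pairs = entries tree_table"

lemma tree_table_nonempty: "(fs, gs) \<in> set tree_table \<Longrightarrow> fs \<noteq> []"
  using tree_table_facts by (auto simp: list_all_iff)

lemma length_pairs: "(f, r, F) \<in> pairs \<Longrightarrow> length F = 3"
  using tree_table_facts by (fastforce simp: list_all_iff pairs_def entries_def)

lemma set_pts: "v \<in> set pts"
  by (cases v) (auto simp: pts_def)

lemma mem_arcs: "(v, w) \<in> set (arcs f) \<longleftrightarrow> v \<noteq> w \<and> app f v = w"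
  using set_pts[of v] by (auto simp: arcs_def)

text \<open>The first statement serves to delete sets of two or more arcs, the second to delete the
  label \<open>T t\<close>, alone or with arcs; there \<open>X\<close> may be empty.\<close>

lemma collapsible_links:
  assumes X: "(f0, r0, F0) \<in> pairs" "X \<subseteq> set (arcs f0)"
  shows "2 \<le> card X \<Longrightarrow> collapsible {q. \<exists>f r F. (f, r, F) \<in> pairs \<and> X \<subseteq> set (arcs f) \<and> q \<subseteq> set F}"
    and "collapsible {q. \<exists>f r F. (f, r, F) \<in> pairs \<and> r = t \<and> X \<subseteq> set (arcs f) \<and> q \<subseteq> set F}"
proof -
  have "\<exists>p' gs. check_link p' gs \<and> set p' = set [] \<union> X \<and>
           set gs = {(r, F). \<exists>f. (f, r, F) \<in> entries tree_table \<and> (\<forall>(v, w)\<in>X. app f v = w)}"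
  proof (rule check_extensions_link[OF check_extensions_tree_table tree_table_nonempty])
    show "distinct pts" by (simp add: pts_def)
    show "(f0, r0, F0) \<in> entries tree_table" using X by (simp add: pairs_def)
    fix v w assume "(v, w) \<in> X"
    then show "v \<in> set pts \<and> v \<noteq> w" "app f0 v = w" using X(2) by (auto simp: mem_arcs set_pts)
  qed
  then obtain p gs where p: "check_link p gs" "set p = X"
    and gs: "set gs = {(r, F). \<exists>f. (f, r, F) \<in> pairs \<and> (\<forall>(v, w)\<in>X. app f v = w)}"
    by (auto simp: pairs_def)
  \<comment> \<open>\<open>arcs\<close> omits the fixed points; since \<open>X\<close> contains no
    loops, agreeing with \<open>app f\<close> on \<open>X\<close> is the same as being contained in
    \<open>arcs f\<close>.\<close>
  have X_iff: "(\<forall>(v, w)\<in>X. app f v = w) \<longleftrightarrow> X \<subseteq> set (arcs f)" for f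
  proof -
    have "app f v = w \<longleftrightarrow> (v, w) \<in> set (arcs f)" if "(v, w) \<in> X" for v w
      using X(2) that by (auto simp: mem_arcs dest!: subsetD)
    then have "(\<forall>(v, w)\<in>X. app f v = w) \<longleftrightarrow> (\<forall>(v, w)\<in>X. (v, w) \<in> set (arcs f))"
      by (intro ball_cong refl) auto
    also have "\<dots> \<longleftrightarrow> X \<subseteq> set (arcs f)" by auto
    finally show ?thesis .
  qed
  show "collapsible {q. \<exists>f r F. (f, r, F) \<in> pairs \<and> X \<subseteq> set (arcs f) \<and> q \<subseteq> set F}" if "2 \<le> card X"
  proof -
    have "length p \<ge> 2" using that p(2) card_length[of p] by simp
    then have "collapses pair_steps (map snd gs)"
      using p(1) unfolding check_link_def by (cases p; cases "tl p") auto
    then have "collapsible (faces (map snd gs))" by (rule collapsible_faces)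
    also have "faces (map snd gs) = {q. \<exists>f r F. (f, r, F) \<in> pairs \<and> X \<subseteq> set (arcs f) \<and> q \<subseteq> set F}"
      using gs by (fastforce simp: faces_def X_iff)
    finally show ?thesis .
  qed
  have "check_root t gs" using p(1) unfolding check_link_def by (cases t) auto
  then have "collapsible (faces (map snd (filter (\<lambda>(r, _). r = t) gs)))"
    unfolding check_root_def by (rule collapsible_faces)
  also have "faces (map snd (filter (\<lambda>(r, _). r = t) gs)) =
      {q. \<exists>f r F. (f, r, F) \<in> pairs \<and> r = t \<and> X \<subseteq> set (arcs f) \<and> q \<subseteq> set F}"
    using gs by (fastforce simp: faces_def X_iff)
  finally show "collapsible {q. \<exists>f r F. (f, r, F) \<in> pairs \<and> r = t \<and> X \<subseteq> set (arcs f) \<and> q \<subseteq> set F}" .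
qed

instance pt :: finite
proof
  have "UNIV = {P0, P1, P2, P3}" using pt.exhaust by auto
  then show "finite (UNIV :: pt set)" by (metis finite.emptyI finite_insert)
qed

instance lab :: finite
proof
  have "x \<in> range V \<union> range Q \<union> range T" for x by (cases x) auto
  then have "UNIV = range V \<union> range Q \<union> range T" by blast
  moreover have "finite (range V \<union> range Q \<union> range T)"
    by (intro finite_UnI finite_imageI) simp_all
  ultimately show "finite (UNIV :: lab set)" by simp
qed

section \<open>The two pure complexes in terms of labels, and their common core\<close>

definition Kb :: "lab set set" where
  "Kb = {\<rho>. \<exists>f r F. (f, r, F) \<in> pairs \<and> \<rho> \<subseteq> V ` set (arcs f) \<union> Q ` set F}"

definition Kf :: "lab set set" where
  "Kf = {\<rho>. \<exists>f r F. (f, r, F) \<in> pairs \<and> \<rho> \<subseteq> insert (T r) (V ` set (arcs f) \<union> Q ` set F)}"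

abbreviation P :: "lab set" where "P \<equiv> range V \<union> range T"

definition K1 :: "lab set set" where
  "K1 = {\<rho> \<in> Kb. card (\<rho> \<inter> P) \<le> 1}"

lemma is_complex_lab: "is_complex K" if "\<And>\<rho> \<tau>. \<lbrakk>\<rho> \<in> K; \<tau> \<subseteq> \<rho>\<rbrakk> \<Longrightarrow> \<tau> \<in> K" for K :: "lab set set"
  using that by (auto simp: is_complex_def)

lemma is_complex_Kb: "is_complex Kb"
  unfolding Kb_def by (rule is_complex_lab) blast

lemma is_complex_Kf: "is_complex Kf"
  unfolding Kf_def by (rule is_complex_lab) blast

lemma is_complex_K1: "is_complex K1"
proof (rule is_complex_lab)
  fix \<rho> \<tau> assume "\<rho> \<in> K1" "\<tau> \<subseteq> \<rho>"
  moreover from this have "card (\<tau> \<inter> P) \<le> card (\<rho> \<inter> P)" by (intro card_mono) auto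
  ultimately show "\<tau> \<in> K1"
    using is_complexD[OF is_complex_Kb, of \<rho> \<tau>] by (auto simp: K1_def)
qed

lemma image_Q_if_disjoint_P: "\<tau> \<inter> P = {} \<Longrightarrow> \<exists>q. \<tau> = Q ` q"
proof -
  assume "\<tau> \<inter> P = {}"
  then have "\<tau> \<subseteq> range Q" by (auto; metis Int_iff UnI1 UnI2 empty_iff lab.exhaust rangeI)
  then show ?thesis by (metis subset_imageE)
qed

lemma disjoint_P_eq_image: "{\<tau>. \<tau> \<inter> P = {} \<and> \<Phi> \<tau>} = (`) Q ` {q. \<Phi> (Q ` q)}"
proof (rule set_eqI, rule iffI)
  fix \<tau> assume "\<tau> \<in> {\<tau>. \<tau> \<inter> P = {} \<and> \<Phi> \<tau>}"
  then obtain q where "\<tau> = Q ` q" "\<Phi> \<tau>" using image_Q_if_disjoint_P by blast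
  then show "\<tau> \<in> (`) Q ` {q. \<Phi> (Q ` q)}" by blast
qed auto

lemma inj_Q: "inj Q" by (auto simp: inj_def)

lemma links_in_lab:
  "{\<tau>. \<tau> \<inter> P = {} \<and> V ` X \<union> \<tau> \<in> Kb} = (`) Q ` {q. \<exists>f r F. (f, r, F) \<in> pairs \<and> X \<subseteq> set (arcs f) \<and> q \<subseteq> set F}"
  "{\<tau>. \<tau> \<inter> P = {} \<and> V ` X \<union> \<tau> \<in> Kf} = (`) Q ` {q. \<exists>f r F. (f, r, F) \<in> pairs \<and> X \<subseteq> set (arcs f) \<and> q \<subseteq> set F}"
  "{\<tau>. \<tau> \<inter> P = {} \<and> insert (T t) (V ` X) \<union> \<tau> \<in> Kf} =
     (`) Q ` {q. \<exists>f r F. (f, r, F) \<in> pairs \<and> r = t \<and> X \<subseteq> set (arcs f) \<and> q \<subseteq> set F}"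
proof -
  have sub: "V ` X \<union> Q ` q \<subseteq> V ` A \<union> Q ` B \<longleftrightarrow> X \<subseteq> A \<and> q \<subseteq> B"
    "V ` X \<union> Q ` q \<subseteq> insert (T r) (V ` A \<union> Q ` B) \<longleftrightarrow> X \<subseteq> A \<and> q \<subseteq> B"
    "insert (T t) (V ` X) \<union> Q ` q \<subseteq> insert (T r) (V ` A \<union> Q ` B) \<longleftrightarrow> r = t \<and> X \<subseteq> A \<and> q \<subseteq> B"
    for q A B r by auto
  show "{\<tau>. \<tau> \<inter> P = {} \<and> V ` X \<union> \<tau> \<in> Kb} = (`) Q ` {q. \<exists>f r F. (f, r, F) \<in> pairs \<and> X \<subseteq> set (arcs f) \<and> q \<subseteq> set F}"
    unfolding disjoint_P_eq_image Kb_def mem_Collect_eq sub ..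
  show "{\<tau>. \<tau> \<inter> P = {} \<and> V ` X \<union> \<tau> \<in> Kf} = (`) Q ` {q. \<exists>f r F. (f, r, F) \<in> pairs \<and> X \<subseteq> set (arcs f) \<and> q \<subseteq> set F}"
    unfolding disjoint_P_eq_image Kf_def mem_Collect_eq sub ..
  show "{\<tau>. \<tau> \<inter> P = {} \<and> insert (T t) (V ` X) \<union> \<tau> \<in> Kf} =
     (`) Q ` {q. \<exists>f r F. (f, r, F) \<in> pairs \<and> r = t \<and> X \<subseteq> set (arcs f) \<and> q \<subseteq> set F}"
    unfolding disjoint_P_eq_image Kf_def mem_Collect_eq sub ..
qed

lemma Kb_homotopy_equivalent_K1: "top_of_set (geom Kb) homotopy_equivalent_space top_of_set (geom K1)"
proof -
  define \<S> where "\<S> = {s \<in> Kb. s \<subseteq> P \<and> 2 \<le> card s}"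
  have "top_of_set (geom Kb) homotopy_equivalent_space top_of_set (geom {\<rho> \<in> Kb. \<rho> \<inter> P \<notin> \<S>})"
  proof (rule geom_remove_stars)
    show "s' \<in> \<S>" if "s \<in> \<S>" "s \<subseteq> s'" "s' \<subseteq> P" "s' \<in> Kb" for s s'
      using that card_mono[of s' s] by (auto simp: \<S>_def)
    show "collapsible {\<tau>. \<tau> \<inter> P = {} \<and> s \<union> \<tau> \<in> Kb}" if s: "s \<in> \<S>" for s
    proof -
      obtain f r F where fF: "(f, r, F) \<in> pairs" "s \<subseteq> V ` set (arcs f) \<union> Q ` set F"
        using s by (auto simp: \<S>_def Kb_def)
      then have "s \<subseteq> V ` set (arcs f)" using s by (auto simp: \<S>_def)
      then obtain X where X: "X \<subseteq> set (arcs f)" "s = V ` X" by (auto elim: subset_imageE)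
      have "card X \<ge> 2" using s X(2) by (auto simp: \<S>_def card_image inj_on_def)
      then show ?thesis
        unfolding X(2) links_in_lab using fF(1) X(1)
        by (intro collapsible_image inj_Q collapsible_links(1))
    qed
  qed (auto simp: \<S>_def is_complex_Kb)
  also have "{\<rho> \<in> Kb. \<rho> \<inter> P \<notin> \<S>} = K1"
    using is_complexD[OF is_complex_Kb] by (auto simp: \<S>_def K1_def)
  finally show ?thesis .
qed

text \<open>Compared with \<open>Kb\<close>, the family to be deleted also contains every set of
  primal labels with a label \<open>T\<close>, even a single one. Faces of \<open>Kf\<close> without
  such a label are exactly the faces of \<open>Kb\<close>, so the same core remains.\<close>

lemma Kf_homotopy_equivalent_K1: "top_of_set (geom Kf) homotopy_equivalent_space top_of_set (geom K1)"
proof -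
  define \<S> where "\<S> = {s \<in> Kf. s \<subseteq> P \<and> (2 \<le> card s \<or> s \<inter> range T \<noteq> {})}"
  have "top_of_set (geom Kf) homotopy_equivalent_space top_of_set (geom {\<rho> \<in> Kf. \<rho> \<inter> P \<notin> \<S>})"
  proof (rule geom_remove_stars)
    show "s' \<in> \<S>" if "s \<in> \<S>" "s \<subseteq> s'" "s' \<subseteq> P" "s' \<in> Kf" for s s'
      using that card_mono[of s' s] by (auto simp: \<S>_def)
    show "collapsible {\<tau>. \<tau> \<inter> P = {} \<and> s \<union> \<tau> \<in> Kf}" if s: "s \<in> \<S>" for s
    proof -
      obtain f r F where fF: "(f, r, F) \<in> pairs" "s \<subseteq> insert (T r) (V ` set (arcs f) \<union> Q ` set F)"
        using s by (auto simp: \<S>_def Kf_def)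
      \<comment> \<open>A dual tree has one root, so \<open>T r\<close> is the only label of its
        kind that \<open>s\<close> can contain.\<close>
      then have "s - {T r} \<subseteq> V ` set (arcs f)" using s by (auto simp: \<S>_def)
      then obtain X where X: "X \<subseteq> set (arcs f)" "s - {T r} = V ` X" by (auto elim: subset_imageE)
      show ?thesis
      proof (cases "T r \<in> s")
        case True
        then have "s = insert (T r) (V ` X)" using X(2) by auto
        then show ?thesis
          using fF(1) X(1) by (simp only: links_in_lab) (intro collapsible_image inj_Q collapsible_links(2))
      next
        case False
        then have sX: "s = V ` X" using X(2) by auto
        then have "card X \<ge> 2" using s by (auto simp: \<S>_def card_image inj_on_def)
        then show ?thesis
          unfolding sX links_in_lab using fF(1) X(1)
          by (intro collapsible_image inj_Q collapsible_links(1))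
      qed
    qed
  qed (auto simp: \<S>_def is_complex_Kf)
  also have "{\<rho> \<in> Kf. \<rho> \<inter> P \<notin> \<S>} = K1"
  proof -
    have "\<rho> \<in> Kf \<and> \<rho> \<inter> P \<notin> \<S> \<longleftrightarrow> \<rho> \<in> Kf \<and> card (\<rho> \<inter> P) \<le> 1 \<and> \<rho> \<inter> range T = {}" for \<rho>
      using is_complexD[OF is_complex_Kf, of \<rho> "\<rho> \<inter> P"] by (auto simp: \<S>_def)
    moreover have "\<rho> \<in> Kf \<and> \<rho> \<inter> range T = {} \<longleftrightarrow> \<rho> \<in> Kb" for \<rho>
    proof -
      have eq: "\<rho> \<subseteq> insert (T r) (V ` A \<union> Q ` B) \<and> \<rho> \<inter> range T = {} \<longleftrightarrow> \<rho> \<subseteq> V ` A \<union> Q ` B" for r A B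
        by auto
      show ?thesis
      proof
        assume "\<rho> \<in> Kf \<and> \<rho> \<inter> range T = {}"
        then obtain f r F where "(f, r, F) \<in> pairs" "\<rho> \<subseteq> V ` set (arcs f) \<union> Q ` set F"
          unfolding Kf_def using eq by blast
        then show "\<rho> \<in> Kb" unfolding Kb_def by blast
      next
        assume "\<rho> \<in> Kb"
        then obtain f r F where "(f, r, F) \<in> pairs" "\<rho> \<subseteq> V ` set (arcs f) \<union> Q ` set F"
          unfolding Kb_def by blast
        then show "\<rho> \<in> Kf \<and> \<rho> \<inter> range T = {}" unfolding Kf_def using eq[of r "set (arcs f)" "set F"] by blast
      qed
    qed
    ultimately show ?thesis by (auto simp: K1_def)
  qed
  finally show ?thesis .
qed

section \<open>The 3-dimensional complex\<close>

lemma critical_tableD: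
  assumes "(xs, cs, steps) \<in> set critical_table" "x \<in> set xs"
  shows "collapsible (faces (fold delete_star cs (facets_at x)))"
    and "c \<in> set cs \<Longrightarrow> set c \<in> faces (facets_at x)"
proof -
  have row: "check_critical xs cs steps"
    using check_critical_table assms(1) by (auto simp: list_all_iff)
  have "check_critical xs cs steps \<Longrightarrow> x \<in> set xs \<Longrightarrow> collapses steps (fold delete_star cs (facets_at x)) \<and>
     (\<forall>c\<in>set cs. \<exists>F\<in>set (facets_at x). set c \<subseteq> set F)" for xs
    by (induction xs) (auto simp: list_all_iff list_ex_iff simp del: delete_star.simps)
  then have "collapses steps (fold delete_star cs (facets_at x))"
    "\<forall>c\<in>set cs. \<exists>F\<in>set (facets_at x). set c \<subseteq> set F"
    using row assms(2) by blast+
  then show "collapsible (faces (fold delete_star cs (facets_at x)))"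
    "c \<in> set cs \<Longrightarrow> set c \<in> faces (facets_at x)"
    by (auto simp: faces_def[of "facets_at x"] intro: collapsible_faces)
qed

lemma faces_fold_delete_star:
  "faces (fold delete_star cs Fs) = {q \<in> faces Fs. \<forall>c\<in>set cs. \<not> set c \<subseteq> q}"
  by (induction cs arbitrary: Fs) (auto simp: faces_delete_star minus_star_def simp del: delete_star.simps)

lemma distinct_concat_map_fst:
  "\<lbrakk>distinct (concat (map fst L)); a \<in> set L; b \<in> set L; x \<in> set (fst a); x \<in> set (fst b)\<rbrakk> \<Longrightarrow> a = b"
  by (induction L) auto

lemma set_critical_pairs:
  "(x, c) \<in> set critical_pairs \<longleftrightarrow> (\<exists>xs cs steps. (xs, cs, steps) \<in> set critical_table \<and> x \<in> set xs \<and> c \<in> set cs)"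
  unfolding critical_pairs_def by fastforce

text \<open>Every critical arc occurs in only one row of the table, so the cells at \<open>x\<close>
  are given by that row alone.\<close>

lemma critical_pairs_row:
  assumes "(xs, cs, steps) \<in> set critical_table" "x \<in> set xs"
  shows "(x, c) \<in> set critical_pairs \<longleftrightarrow> c \<in> set cs"
proof
  assume "(x, c) \<in> set critical_pairs"
  then obtain xs' cs' steps' where row': "(xs', cs', steps') \<in> set critical_table" "x \<in> set xs'" "c \<in> set cs'"
    unfolding set_critical_pairs by blast
  have "(xs', cs', steps') = (xs, cs, steps)"
    by (rule distinct_concat_map_fst[OF critical_arcs_distinct row'(1) assms(1), of x])
       (use row'(2) assms(2) in simp_all)
  then show "c \<in> set cs" using row'(3) by simp
next
  assume "c \<in> set cs"
  then show "(x, c) \<in> set critical_pairs" using assms unfolding set_critical_pairs by blast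
qed

lemma critical_pairsD:
  assumes "(x, c) \<in> set critical_pairs"
  shows "distinct c" "length c = 3" "set c \<in> faces (facets_at x)" "x \<in> set (concat (map fst critical_table))"
proof -
  show "distinct c" "length c = 3"
    using critical_pairs_card(2) assms by (auto simp: list_all_iff)
  obtain xs cs steps where row: "(xs, cs, steps) \<in> set critical_table" "x \<in> set xs" "c \<in> set cs"
    using assms unfolding set_critical_pairs by blast
  then show "set c \<in> faces (facets_at x)" by (rule critical_tableD(2))
  show "x \<in> set (concat (map fst critical_table))" using row(1,2) by force
qed

lemma mem_faces_facets_at: "q \<in> faces (facets_at (v, w)) \<longleftrightarrow> (\<exists>f r F. (f, r, F) \<in> pairs \<and> app f v = w \<and> q \<subseteq> set F)"
proof -
  have "set (concat (map snd (restrict_row v w tree_table))) = {(r, F). \<exists>f. (f, r, F) \<in> entries (restrict_row v w tree_table)}"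
    by (rule set_concat_rows) (rule restrict_row_nonempty)
  then have "set (facets_at (v, w)) = {F. \<exists>f r. (f, r, F) \<in> pairs \<and> app f v = w}"
    unfolding facets_at_def fst_conv snd_conv set_map by (force simp: entries_restrict_row pairs_def)
  then show ?thesis by (auto simp: faces_def)
qed

lemma mem_faces_all_facets: "q \<in> faces all_facets \<longleftrightarrow> (\<exists>f r F. (f, r, F) \<in> pairs \<and> q \<subseteq> set F)"
proof -
  have "set (concat (map snd tree_table)) = {(r, F). \<exists>f. (f, r, F) \<in> entries tree_table}"
    by (rule set_concat_rows) (rule tree_table_nonempty)
  then have "set all_facets = {F. \<exists>f r. (f, r, F) \<in> pairs}"
    unfolding all_facets_def set_map by (force simp: pairs_def)
  then show ?thesis by (auto simp: faces_def)
qed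

lemma Q_image_mem_K1: "Q ` q \<in> K1 \<longleftrightarrow> q \<in> faces all_facets"
proof -
  have "Q ` q \<inter> P = {}" by auto
  moreover have "Q ` q \<subseteq> V ` A \<union> Q ` B \<longleftrightarrow> q \<subseteq> B" for A B by auto
  ultimately show ?thesis unfolding K1_def Kb_def mem_faces_all_facets by simp
qed

lemma insert_V_mem_K1: "insert (V (v, w)) (Q ` q) \<in> K1 \<longleftrightarrow> v \<noteq> w \<and> q \<in> faces (facets_at (v, w))"
proof -
  have eq: "insert (V (v, w)) (Q ` q) \<inter> P = {V (v, w)}" by auto
  have "card (insert (V (v, w)) (Q ` q) \<inter> P) \<le> 1" unfolding eq by simp
  moreover have "insert (V x) (Q ` q) \<subseteq> V ` A \<union> Q ` B \<longleftrightarrow> x \<in> A \<and> q \<subseteq> B" for A B x by auto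
  ultimately show ?thesis
    unfolding K1_def Kb_def mem_faces_facets_at mem_Collect_eq by (simp only: mem_arcs) blast
qed

lemma K1_cases:
  assumes "\<rho> \<in> K1"
  obtains q where "\<rho> = Q ` q" | v w q where "\<rho> = insert (V (v, w)) (Q ` q)"
proof -
  have noT: "\<rho> \<inter> range T = {}" using assms unfolding K1_def Kb_def by blast
  obtain q where q: "\<rho> - P = Q ` q" using image_Q_if_disjoint_P[of "\<rho> - P"] by auto
  have "card (\<rho> \<inter> P) \<le> 1" using assms by (simp add: K1_def)
  then consider "\<rho> \<inter> P = {}" | x where "\<rho> \<inter> P = {x}"
    by (metis card_1_singletonE card_0_eq finite le_Suc_eq le_zero_eq One_nat_def)
  then show thesis
  proof cases
    case 1
    then have "\<rho> = Q ` q" using q Diff_triv by metis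
    then show ?thesis using that by blast
  next
    case 2
    then have "x \<in> range V" using noT by blast
    then obtain v w where "x = V (v, w)" by auto
    moreover have "\<rho> = insert x (Q ` q)" using Int_Diff_Un[of \<rho> P] 2 q by simp
    ultimately show ?thesis using that by blast
  qed
qed

lemma critical_arc_proper: "x \<in> set (concat (map fst critical_table)) \<Longrightarrow> fst x \<noteq> snd x"
  using critical_or_star_arc by (auto simp: critical_table_def)

definition cells :: "lab list list" where
  "cells = map (\<lambda>(x, c). V x # map Q c) critical_pairs"

lemma mem_set_cells: "\<rho> \<in> set ` set cells \<longleftrightarrow> (\<exists>x c. (x, c) \<in> set critical_pairs \<and> \<rho> = insert (V x) (Q ` set c))"
proof -
  have "set ` set cells = (\<lambda>(x, c). insert (V x) (Q ` set c)) ` set critical_pairs"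
    unfolding cells_def set_map image_image by (rule image_cong) auto
  then show ?thesis by (simp add: image_iff Bex_def)
qed

lemma card_faces_K1: "\<rho> \<in> K1 \<Longrightarrow> card \<rho> \<le> 4"
proof -
  assume \<rho>: "\<rho> \<in> K1"
  then obtain f r F where "(f, r, F) \<in> pairs" "\<rho> \<subseteq> V ` set (arcs f) \<union> Q ` set F"
    unfolding K1_def Kb_def by blast
  then have "\<rho> - P \<subseteq> Q ` set F" "length F = 3" using length_pairs by auto
  then have "card (\<rho> - P) \<le> 3"
    by (metis List.finite_set card_image_le card_length card_mono dual_order.trans finite_imageI)
  moreover have "card \<rho> = card (\<rho> \<inter> P) + card (\<rho> - P)"
    by (subst card_Un_disjoint[symmetric]) (auto intro: arg_cong[where f = card])
  ultimately show ?thesis using \<rho> by (simp add: K1_def)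
qed

lemma card_cell: "(x, c) \<in> set critical_pairs \<Longrightarrow> card (insert (V x) (Q ` set c)) = 4"
proof -
  assume xc: "(x, c) \<in> set critical_pairs"
  have "card (Q ` set c) = 3" using critical_pairsD(1,2)[OF xc] inj_Q by (metis card_image distinct_card inj_on_subset subset_UNIV)
  moreover have "V x \<notin> Q ` set c" by auto
  ultimately show ?thesis by simp
qed

lemma cell_mem_K1: "(x, c) \<in> set critical_pairs \<Longrightarrow> insert (V x) (Q ` set c) \<in> K1"
  using critical_pairsD(3,4) critical_arc_proper by (cases x) (force simp: insert_V_mem_K1)

text \<open>A face of \<open>K1\<close> has at most one primal label and three dual ones. The cells
  have four labels, hence are maximal, and their dimension is 3.\<close>

interpretation cells: maximal_cells K1 3 81 "\<lambda>i. set (cells ! i)" "\<lambda>i j. cells ! i ! j"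
proof
  have len: "length cells = 81" using critical_pairs_card(1) by (simp add: cells_def)
  have nth: "\<exists>x c. critical_pairs ! i = (x, c) \<and> (x, c) \<in> set critical_pairs \<and> cells ! i = V x # map Q c" if "i < 81" for i
  proof -
    obtain x c where xc: "critical_pairs ! i = (x, c)" by (rule prod.exhaust)
    have "(x, c) \<in> set critical_pairs" unfolding xc[symmetric] using that critical_pairs_card(1) by (intro nth_mem) simp
    moreover have "cells ! i = V x # map Q c" using that critical_pairs_card(1) xc by (simp add: cells_def)
    ultimately show ?thesis using xc by blast
  qed
  show "is_complex K1" by (rule is_complex_K1)
  show "finite K1" by simp
  have ne: "set (cells ! i) \<noteq> set (cells ! j)" if ij: "i < j" "j < 81" for i j
  proof
    assume eq: "set (cells ! i) = set (cells ! j)"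
    obtain x c x' c' where i: "critical_pairs ! i = (x, c)" "cells ! i = V x # map Q c"
      and j: "critical_pairs ! j = (x', c')" "cells ! j = V x' # map Q c'"
      using nth[of i] nth[of j] ij by auto
    have "x = x'" "Q ` set c = Q ` set c'" using eq i j by auto
    then have "x = x'" "set c = set c'" using inj_Q by (auto simp: inj_image_eq_iff)
    moreover have "if x = x' then \<not> set c \<subseteq> set c' else True"
      using sorted_wrt_nth_less[OF critical_pairs_distinct[unfolded distinct_pairs_def] ij(1)] ij(2)
        critical_pairs_card(1) i j by simp
    ultimately show False by simp
  qed
  show "inj_on (\<lambda>i. set (cells ! i)) {..<81}"
    by (rule linorder_inj_onI) (use ne in auto)
  show mem: "set (cells ! i) \<in> K1" if i: "i < 81" for i
    using nth[OF i] cell_mem_K1 by auto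
  have card: "card (set (cells ! i)) = 4" if i: "i < 81" for i
    using nth[OF i] card_cell by auto
  show "\<rho> = set (cells ! i)" if i: "i < 81" and "\<rho> \<in> K1" "set (cells ! i) \<subseteq> \<rho>" for i \<rho>
    using card_seteq[of \<rho> "set (cells ! i)"] card[OF i] card_faces_K1 that by auto
  show "bij_betw (\<lambda>j. cells ! i ! j) {..3} (set (cells ! i))" if i: "i < 81" for i
  proof -
    obtain x c where xc: "(x, c) \<in> set critical_pairs" "cells ! i = V x # map Q c" using nth[OF i] by auto
    then have l: "length (cells ! i) = 4" using critical_pairsD(2) by simp
    then have "distinct (cells ! i)" using card[OF i] by (simp add: card_distinct)
    moreover have "{..3} = {..<length (cells ! i)}" using l by auto
    ultimately show ?thesis by (simp add: bij_betw_nth)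
  qed
qed

lemma cells_C: "cells.C = K1 - set ` set cells"
proof -
  have "length cells = 81" using critical_pairs_card(1) by (simp add: cells_def)
  then have "(\<lambda>i. set (cells ! i)) ` {..<81} = set ` set cells"
    unfolding set_conv_nth[of cells] by auto
  then show ?thesis by (simp add: cells.C_def)
qed

lemma mem_C_iff:
  "\<rho> \<in> cells.C \<longleftrightarrow> \<rho> \<in> K1 \<and> (\<forall>x c. (x, c) \<in> set critical_pairs \<longrightarrow> \<rho> \<noteq> insert (V x) (Q ` set c))"
  unfolding cells_C Diff_iff mem_set_cells by blast

lemma is_complex_C: "is_complex cells.C"
proof (rule is_complex_lab)
  fix \<rho> \<tau> assume \<rho>: "\<rho> \<in> cells.C" "\<tau> \<subseteq> \<rho>"
  then have "\<tau> \<in> K1" "\<rho> \<in> K1" using is_complexD[OF is_complex_K1] by (auto simp: cells_C)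
  moreover have "\<tau> \<noteq> insert (V x) (Q ` set c)" if "(x, c) \<in> set critical_pairs" for x c
  proof
    assume \<tau>: "\<tau> = insert (V x) (Q ` set c)"
    have "\<tau> = \<rho>" using card_cell[OF that] card_faces_K1[OF \<open>\<rho> \<in> K1\<close>] \<rho>(2) by (intro card_seteq) (auto simp: \<tau>)
    then show False using \<rho>(1) that \<tau> unfolding mem_C_iff by blast
  qed
  ultimately show "\<tau> \<in> cells.C" unfolding mem_C_iff by blast
qed

text \<open>Without its nine cells, the link of a critical vertex \<open>V x\<close> has lost nine
  triangles and is collapsible, so the open star of \<open>V x\<close> can be deleted. The remaining
  complex, generated by \<open>star_facets\<close>, is collapsible by computation.\<close>

lemma contractible_C: "contractible (geom cells.C)"
proof -
  let ?A = "set (concat (map fst critical_table))"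
  define \<S> where "\<S> = {{V x} | x. x \<in> ?A}"
  have C_K1: "\<rho> \<in> cells.C \<Longrightarrow> \<rho> \<in> K1" for \<rho> by (simp add: cells_C)
  have "top_of_set (geom cells.C) homotopy_equivalent_space top_of_set (geom {\<rho> \<in> cells.C. \<rho> \<inter> P \<notin> \<S>})"
  proof (rule geom_remove_stars)
    show "is_complex cells.C" by (rule is_complex_C)
    show "s' \<in> \<S>" if h: "s \<in> \<S>" "s \<subseteq> s'" "s' \<subseteq> P" "s' \<in> cells.C" for s s'
    proof -
      obtain x where x: "s = {V x}" using h(1) unfolding \<S>_def by blast
      \<comment> \<open>Faces of \<open>K1\<close> have at most one label in \<open>P\<close>, so no
        two deleted vertices are joined and upward closure is immediate.\<close>
      have "card s' \<le> 1" using C_K1[OF h(4)] h(3) by (simp add: K1_def Int_absorb2)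
      then have "s' = s" using h(2) x card_seteq[of s' s] by auto
      then show ?thesis using h(1) by simp
    qed
    show "collapsible {\<tau>. \<tau> \<inter> P = {} \<and> s \<union> \<tau> \<in> cells.C}" if "s \<in> \<S>" for s
    proof -
      obtain x where x: "s = {V x}" "x \<in> ?A" using \<open>s \<in> \<S>\<close> unfolding \<S>_def by blast
      then obtain xs cs steps where row: "(xs, cs, steps) \<in> set critical_table" "x \<in> set xs" by auto
      obtain v w where vw: "x = (v, w)" "v \<noteq> w" using critical_arc_proper[OF x(2)] by (cases x) auto
      have "s \<union> Q ` q \<in> cells.C \<longleftrightarrow> q \<in> faces (fold delete_star cs (facets_at x))" for q
      proof -
        have "insert (V x) (Q ` q) = insert (V x') (Q ` set c) \<longleftrightarrow> x' = x \<and> q = set c" for x' c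
          using inj_Q by (auto simp: inj_def)
        then have 1: "s \<union> Q ` q \<in> cells.C \<longleftrightarrow> q \<in> faces (facets_at x) \<and> (\<forall>c\<in>set cs. q \<noteq> set c)"
          unfolding x(1) mem_C_iff using insert_V_mem_K1[of v w q] vw critical_pairs_row[OF row]
          by auto
        \<comment> \<open>Faces of the link have at most three elements, so deleting the open star
          of the triangle \<open>c\<close> removes \<open>c\<close> and nothing else.\<close>
        moreover have "set c \<subseteq> q \<longleftrightarrow> q = set c" if c_q: "c \<in> set cs" "q \<in> faces (facets_at x)" for c
        proof -
          have c: "(x, c) \<in> set critical_pairs" using critical_pairs_row[OF row] that by simp
          obtain f r F where F: "(f, r, F) \<in> pairs" "q \<subseteq> set F"
            using c_q(2) unfolding vw mem_faces_facets_at by blast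
          then have "card q \<le> 3" using length_pairs card_length[of F] card_mono[of "set F" q] by force
          moreover have "card (set c) = 3" using critical_pairsD(1,2)[OF c] distinct_card by metis
          moreover have "finite q" using F by (auto intro: finite_subset)
          ultimately show ?thesis using card_seteq[of q "set c"] by auto
        qed
        ultimately show ?thesis unfolding faces_fold_delete_star by auto
      qed
      then have "{\<tau>. \<tau> \<inter> P = {} \<and> s \<union> \<tau> \<in> cells.C} = (`) Q ` faces (fold delete_star cs (facets_at x))"
        unfolding disjoint_P_eq_image by simp
      then show ?thesis using collapsible_image[OF inj_Q critical_tableD(1)[OF row]] by simp
    qed
  qed (auto simp: \<S>_def)
  also have "{\<rho> \<in> cells.C. \<rho> \<inter> P \<notin> \<S>} = faces star_facets"
  proof -
    have star: "\<rho> \<in> faces star_facets \<longleftrightarrow> (\<exists>q. \<rho> = Q ` q \<and> q \<in> faces all_facets) \<or>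
        (\<exists>x\<in>set star_arcs. \<exists>q \<in> faces (facets_at x). \<rho> \<subseteq> insert (V x) (Q ` q))" for \<rho>
    proof -
      have "faces (map (map Q) L) = (`) Q ` faces L" for L
        unfolding faces_def by (auto simp: subset_image_iff)
      moreover have "faces (concat (map (\<lambda>x. map (\<lambda>F. V x # map Q F) (facets_at x)) star_arcs))
          = {\<rho>. \<exists>x\<in>set star_arcs. \<exists>q \<in> faces (facets_at x). \<rho> \<subseteq> insert (V x) (Q ` q)}"
      proof (rule set_eqI)
        fix \<rho>
        have "\<rho> \<in> faces (concat (map (\<lambda>x. map (\<lambda>F. V x # map Q F) (facets_at x)) star_arcs)) \<longleftrightarrow>
            (\<exists>x\<in>set star_arcs. \<exists>F\<in>set (facets_at x). \<rho> \<subseteq> insert (V x) (Q ` set F))"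
          by (auto simp: faces_def)
        also have "\<dots> \<longleftrightarrow> (\<exists>x\<in>set star_arcs. \<exists>q \<in> faces (facets_at x). \<rho> \<subseteq> insert (V x) (Q ` q))"
        proof (intro bex_cong refl iffI)
          fix x assume "\<exists>F\<in>set (facets_at x). \<rho> \<subseteq> insert (V x) (Q ` set F)"
          then obtain F where F: "F \<in> set (facets_at x)" "\<rho> \<subseteq> insert (V x) (Q ` set F)" by blast
          then have "set F \<in> faces (facets_at x)" unfolding faces_def by blast
          then show "\<exists>q \<in> faces (facets_at x). \<rho> \<subseteq> insert (V x) (Q ` q)" using F(2) by blast
        next
          fix x assume "\<exists>q \<in> faces (facets_at x). \<rho> \<subseteq> insert (V x) (Q ` q)"
          then obtain q F where F: "F \<in> set (facets_at x)" "q \<subseteq> set F" "\<rho> \<subseteq> insert (V x) (Q ` q)"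
            unfolding faces_def by blast
          then have "\<rho> \<subseteq> insert (V x) (Q ` set F)" by (meson image_mono insert_mono subset_trans)
          then show "\<exists>F\<in>set (facets_at x). \<rho> \<subseteq> insert (V x) (Q ` set F)" using F(1) by blast
        qed
        finally show "\<rho> \<in> faces (concat (map (\<lambda>x. map (\<lambda>F. V x # map Q F) (facets_at x)) star_arcs)) \<longleftrightarrow>
            \<rho> \<in> {\<rho>. \<exists>x\<in>set star_arcs. \<exists>q \<in> faces (facets_at x). \<rho> \<subseteq> insert (V x) (Q ` q)}" by simp
      qed
      ultimately show ?thesis
        unfolding star_facets_def faces_fold_add_face by auto
    qed
    have star_arc: "x \<in> set star_arcs \<longleftrightarrow> fst x \<noteq> snd x \<and> x \<notin> ?A" for x
    proof
      assume "fst x \<noteq> snd x \<and> x \<notin> ?A"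
      moreover have "x \<in> set (List.product pts pts)" using set_pts by (cases x) auto
      ultimately show "x \<in> set star_arcs"
        using critical_or_star_arc(1) unfolding list_all_iff by (cases x) auto
    next
      assume "x \<in> set star_arcs"
      moreover from this have "fst x \<noteq> snd x" by (auto simp: star_arcs_def)
      ultimately show "fst x \<noteq> snd x \<and> x \<notin> ?A" using critical_or_star_arc(2) by (simp add: list_all_iff)
    qed
    have not_cell: "\<rho> \<in> cells.C" if "\<rho> \<in> K1" "\<And>x. x \<in> ?A \<Longrightarrow> V x \<notin> \<rho>" for \<rho>
      unfolding mem_C_iff using that critical_pairsD(4) by blast
    have "\<rho> \<in> cells.C \<and> \<rho> \<inter> P \<notin> \<S> \<longleftrightarrow> \<rho> \<in> faces star_facets" for \<rho>
    proof
      assume \<rho>: "\<rho> \<in> cells.C \<and> \<rho> \<inter> P \<notin> \<S>"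
      then have K1: "\<rho> \<in> K1" using C_K1 by blast
      then show "\<rho> \<in> faces star_facets"
      proof (cases rule: K1_cases)
        case (1 q)
        then show ?thesis using K1 Q_image_mem_K1 star by blast
      next
        case (2 v w q)
        then have "\<rho> \<inter> P = {V (v, w)}" by auto
        then have "(v, w) \<notin> ?A" using \<rho> unfolding \<S>_def by blast
        moreover have "v \<noteq> w" "q \<in> faces (facets_at (v, w))" using K1 2 insert_V_mem_K1 by auto
        ultimately have "(v, w) \<in> set star_arcs" "\<rho> \<subseteq> insert (V (v, w)) (Q ` q)" "q \<in> faces (facets_at (v, w))"
          using star_arc[of "(v, w)"] 2 by auto
        then show ?thesis unfolding star by blast
      qed
    next
      assume "\<rho> \<in> faces star_facets"
      then consider q where "\<rho> = Q ` q" "q \<in> faces all_facets"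
        | x q where "x \<in> set star_arcs" "q \<in> faces (facets_at x)" "\<rho> \<subseteq> insert (V x) (Q ` q)"
        unfolding star by blast
      then show "\<rho> \<in> cells.C \<and> \<rho> \<inter> P \<notin> \<S>"
      proof cases
        case 1
        then have "\<rho> \<in> K1" using Q_image_mem_K1 by simp
        moreover have "\<rho> \<inter> P = {}" using 1 by auto
        ultimately show ?thesis using not_cell[of \<rho>] unfolding \<S>_def by blast
      next
        case 2
        have "insert (V x) (Q ` q) \<in> K1"
          using insert_V_mem_K1[of "fst x" "snd x" q] star_arc[of x] 2 by simp
        then have "\<rho> \<in> K1" using is_complexD[OF is_complex_K1] 2(3) by blast
        moreover have V\<rho>: "V x' \<notin> \<rho>" if "x' \<in> ?A" for x'
          using that 2(3) star_arc[of x] 2(1) by auto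
        ultimately show ?thesis using not_cell[of \<rho>] unfolding \<S>_def by blast
      qed
    qed
    then show ?thesis by blast
  qed
  finally show ?thesis
    using contractible_geom_collapsible[OF collapsible_faces[OF collapses_star_facets] is_complex_faces]
    by (metis contractible_space_top_of_set homotopy_equivalent_space_contractibility)
qed

theorem K1_homotopy_equivalent_wedge: "top_of_set (geom K1) homotopy_equivalent_space wedge_spheres 81 3"
proof -
  have "geom cells.C \<noteq> {}"
  proof -
    obtain x c where "hd critical_pairs = (x, c)" by (rule prod.exhaust)
    moreover have "critical_pairs \<noteq> []" using critical_pairs_card(1) by force
    ultimately have xc: "(x, c) \<in> set critical_pairs" using hd_in_set by metis
    have "{V x} \<subseteq> insert (V x) (Q ` set c)" by auto
    then have "{V x} \<in> K1" using is_complexD[OF is_complex_K1 cell_mem_K1[OF xc]] by blast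
    moreover have "{V x} \<noteq> insert (V x') (Q ` set c')" if "(x', c') \<in> set critical_pairs" for x' c'
    proof
      assume "{V x} = insert (V x') (Q ` set c')"
      then have "card {V x} = 4" using card_cell[OF that] by (simp only:)
      then show False by simp
    qed
    ultimately have "{V x} \<in> cells.C" unfolding mem_C_iff by blast
    then have "(\<lambda>v. if v = V x then 1 else 0) \<in> geom cells.C"
      by (rule geomI) auto
    then show ?thesis by blast
  qed
  then have "top_of_set (geom K1) homotopy_equivalent_space top_of_set cells.W"
    by (intro cells.geom_homotopy_equivalent_wedge contractible_C) auto
  also have "top_of_set cells.W = wedge_spheres 81 3"
    by (simp add: wedge_spheres_def cells.W_def euclidean_product_topology)
  finally show ?thesis .
qed

section \<open>The Hasse diagrams\<close>

fun num :: "pt \<Rightarrow> nat" where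
  "num P0 = 0" | "num P1 = 1" | "num P2 = 2" | "num P3 = 3"

fun enc :: "lab \<Rightarrow> nat set \<times> nat set" where
  "enc (V (v, w)) = ({num v}, {num v, num w})"
| "enc (Q (t, s)) = ({0..3} - {num t, num s}, {0..3} - {num t})"
| "enc (T t) = ({0..3} - {num t}, {0..3})"

lemma num_inject [simp]: "num v = num w \<longleftrightarrow> v = w"
  by (cases v; cases w) auto

lemma num_le3 [simp]: "num v \<le> 3"
  by (cases v) auto

lemma num_surj: "n \<le> 3 \<Longrightarrow> \<exists>v. n = num v"
proof -
  assume "n \<le> 3"
  then have "n = num P0 \<or> n = num P1 \<or> n = num P2 \<or> n = num P3" by auto
  then show ?thesis by blast
qed

lemma card_compl:
  "card ({0..3} - {num t}) = 3" "t \<noteq> s \<Longrightarrow> card ({0..3} - {num t, num s}) = 2"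
  by (auto simp: card_Diff_subset)

lemma compl_inject: "{0..3} - {num t} = {0..3} - {num t'} \<longleftrightarrow> t = t'"
proof
  assume eq: "{0..3} - {num t} = {0..3} - {num t'}"
  have "num t' \<in> {0..3} - {num t} \<longleftrightarrow> num t' \<in> {0..3} - {num t'}" by (simp only: eq)
  then show "t = t'" by simp
qed simp

lemma edge_eq_compl_iff:
  assumes "v \<noteq> w" "t \<noteq> s"
  shows "{num v, num w} = {0..3} - {num t, num s} \<longleftrightarrow> v \<noteq> t \<and> v \<noteq> s \<and> w \<noteq> t \<and> w \<noteq> s"
proof
  assume "{num v, num w} = {0..3} - {num t, num s}"
  then have "num v \<in> {0..3} - {num t, num s}" "num w \<in> {0..3} - {num t, num s}" by auto
  then show "v \<noteq> t \<and> v \<noteq> s \<and> w \<noteq> t \<and> w \<noteq> s" by simp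
next
  assume "v \<noteq> t \<and> v \<noteq> s \<and> w \<noteq> t \<and> w \<noteq> s"
  then have "{num v, num w} \<subseteq> {0..3} - {num t, num s}" by simp
  then show "{num v, num w} = {0..3} - {num t, num s}"
    by (rule card_subset_eq[rotated]) (use assms in \<open>simp_all add: card_compl\<close>)
qed

lemma compl2_inject: "{0..3} - {num t, num s} = {0..3} - {num t', num s'} \<longleftrightarrow> {t, s} = {t', s'}"
proof
  assume eq: "{0..3} - {num t, num s} = {0..3} - {num t', num s'}"
  have "num p \<in> {0..3} - {num t, num s} \<longleftrightarrow> num p \<in> {0..3} - {num t', num s'}" for p
    by (simp only: eq)
  then have "p = t \<or> p = s \<longleftrightarrow> p = t' \<or> p = s'" for p by auto
  then show "{t, s} = {t', s'}" by auto
next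
  assume "{t, s} = {t', s'}"
  then show "{0..3} - {num t, num s} = {0..3} - {num t', num s'}"
    by (auto simp: doubleton_eq_iff)
qed

lemma card_compl2_neq_1: "card ({0..3} - {num t, num s}) \<noteq> 1"
  by (cases "t = s") (simp_all add: card_compl)

text \<open>Sizes separate the three kinds of labels. The lower set of \<open>Q (t, s)\<close> is
  only known not to be a singleton, because for \<open>t = s\<close> it has three elements.\<close>

lemma card_enc:
  "card (fst (enc (V a))) = 1"
  "card (fst (enc (Q a))) \<noteq> 1" "card (snd (enc (Q a))) = 3"
  "card (fst (enc (T t))) = 3" "card (snd (enc (T t))) = 4"
  using card_compl2_neq_1 by (cases a; simp add: card_compl; fail)+

lemma inj_enc: "inj enc"
proof (rule injI)
  fix a b assume eq: "enc a = enc b"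
  then have c: "card (fst (enc a)) = card (fst (enc b))" "card (snd (enc a)) = card (snd (enc b))" by simp_all
  have VV: "a' = b'" if "enc (V a') = enc (V b')" for a' b'
    using that by (cases a'; cases b') (auto simp: doubleton_eq_iff)
  have QQ: "a' = b'" if h: "enc (Q a') = enc (Q b')" for a' b'
  proof -
    obtain t s t' s' where ab: "a' = (t, s)" "b' = (t', s')" by (cases a'; cases b')
    from h have "{t, s} = {t', s'} \<and> t = t'"
      unfolding ab enc.simps prod.inject compl_inject compl2_inject .
    then show ?thesis using ab by (auto simp: doubleton_eq_iff)
  qed
  show "a = b"
  proof (cases a; cases b)
    fix a' b' assume "a = V a'" "b = V b'"
    then show ?thesis using VV eq by simp
  next
    fix a' b' assume "a = Q a'" "b = Q b'"
    then show ?thesis using QQ eq by simp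
  next
    fix t t' assume "a = T t" "b = T t'"
    then show ?thesis using eq by (simp add: compl_inject)
  qed (use c card_enc in \<open>(simp_all only: numeral_eq_iff numeral_eq_one_iff num.distinct)?, (metis numeral_eq_iff num.distinct numeral_eq_one_iff)?\<close>)
qed

text \<open>The labels \<open>V (v, v)\<close> and \<open>Q (t, t)\<close> have a value under
  \<open>enc\<close> that is not an edge of the Hasse diagram.\<close>

definition proper :: "lab set" where
  "proper = V ` {(v, w). v \<noteq> w} \<union> Q ` {(t, s). t \<noteq> s}"

lemma proper_V: "v \<noteq> w \<Longrightarrow> V (v, w) \<in> proper" and proper_Q: "t \<noteq> s \<Longrightarrow> Q (t, s) \<in> proper"
  by (auto simp: proper_def)

lemma hasse_edges_fullI:
  assumes "\<sigma> \<noteq> {}" "\<tau> \<subseteq> {0..3}" "\<sigma> \<subseteq> \<tau>" "card \<tau> = card \<sigma> + 1"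
  shows "(\<sigma>, \<tau>) \<in> hasse_edges full_simplex3"
proof -
  have "\<sigma> \<subset> \<tau>" using assms(3,4) by auto
  then show ?thesis
    unfolding hasse_edges_def full_simplex3_def using assms by blast
qed

text \<open>The size of the lower simplex decides the kind of label. The point added to it is the
  second entry of \<open>V\<close> or \<open>Q\<close>; for the solid tetrahedron it is the name of
  the triangle.\<close>

lemma hasse_edges_full: "hasse_edges full_simplex3 = enc ` (proper \<union> range T)"
proof (rule set_eqI, rule iffI)
  fix e assume "e \<in> hasse_edges full_simplex3"
  then obtain \<sigma> \<tau> where e: "e = (\<sigma>, \<tau>)" and st: "\<sigma> \<noteq> {}" "\<tau> \<subseteq> {0..3}" "\<sigma> \<subset> \<tau>" "card \<tau> = card \<sigma> + 1"
    by (auto simp: hasse_edges_def full_simplex3_def)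
  have fin\<tau>: "finite \<tau>" by (rule finite_subset[OF st(2)]) simp
  then have fin: "finite \<tau>" "finite \<sigma>" using finite_subset[of \<sigma> \<tau>] st(3) by auto
  obtain x where x: "x \<in> \<tau>" "x \<notin> \<sigma>" using st(3) by auto
  have \<tau>: "\<tau> = insert x \<sigma>"
    using fin st x by (intro card_seteq[symmetric]) auto
  have "x \<le> 3" using x(1) st(2) by auto
  then obtain w where w: "x = num w" using num_surj by blast
  have c\<sigma>: "card \<sigma> \<ge> 1" "card \<sigma> \<le> 3"
    using st fin card_mono[of "{0..3}" \<tau>] by (auto simp: Suc_le_eq card_gt_0_iff)
  consider "card \<sigma> = 1" | "card \<tau> = 3" | "card \<tau> = 4" using c\<sigma> st(4) by linarith
  then show "e \<in> enc ` (proper \<union> range T)"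
  proof cases
    case 1
    then obtain y where y: "\<sigma> = {y}" by (auto simp: card_1_singleton_iff)
    then have "y \<le> 3" using st(2,3) by auto
    then obtain v where "y = num v" using num_surj by blast
    then have "e = enc (V (v, w))" "v \<noteq> w" using e y \<tau> w x by auto
    then show ?thesis using proper_V by blast
  next
    case 2
    then have "card ({0..3} - \<tau>) = 1" using st fin by (simp add: card_Diff_subset)
    then obtain y where y: "{0..3} - \<tau> = {y}" by (auto simp: card_1_singleton_iff)
    then have "y \<le> 3" by auto
    then obtain t where t: "y = num t" using num_surj by blast
    have "\<tau> = {0..3} - {num t}" using y t st(2) by auto
    moreover from this have "\<sigma> = {0..3} - {num t, num w}" "t \<noteq> w" using \<tau> w x by auto
    ultimately have "e = enc (Q (t, w))" "t \<noteq> w" using e by auto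
    then show ?thesis using proper_Q by blast
  next
    case 3
    then have "\<tau> = {0..3}" using st by (intro card_subset_eq) auto
    then have "e = enc (T w)" using e \<tau> w x by auto
    then show ?thesis by blast
  qed
next
  fix e assume "e \<in> enc ` (proper \<union> range T)"
  then consider v w where "e = enc (V (v, w))" "v \<noteq> w" | t s where "e = enc (Q (t, s))" "t \<noteq> s" | t where "e = enc (T t)"
    by (auto simp: proper_def)
  then show "e \<in> hasse_edges full_simplex3"
  proof cases
    case 1
    show ?thesis unfolding 1 enc.simps
      by (rule hasse_edges_fullI) (use 1 in auto)
  next
    case 2
    show ?thesis unfolding 2 enc.simps
    proof (rule hasse_edges_fullI)
      show "{0..3} - {num t, num s} \<noteq> {}" using card_compl(2)[OF 2(2)] by (metis card.empty zero_neq_numeral)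
      show "card ({0..3} - {num t}) = card ({0..3} - {num t, num s}) + 1"
        using card_compl(1)[of t] card_compl(2)[OF 2(2)] by linarith
    qed blast+
  next
    case 3
    show ?thesis unfolding 3 enc.simps
    proof (rule hasse_edges_fullI)
      show "{0..3} - {num t} \<noteq> {}" using card_compl(1)[of t] by (metis card.empty zero_neq_numeral)
      show "card {0..3::nat} = card ({0..3} - {num t}) + 1" using card_compl(1)[of t] by simp
    qed blast+
  qed
qed

lemma hasse_edges_boundary: "hasse_edges boundary_simplex3 = enc ` proper"
proof -
  have "hasse_edges boundary_simplex3 = {e \<in> hasse_edges full_simplex3. snd e \<noteq> {0..3}}"
    by (auto simp: hasse_edges_def boundary_simplex3_def full_simplex3_def)
  also have "\<dots> = {e \<in> enc ` (proper \<union> range T). snd e \<noteq> {0..3}}" by (simp only: hasse_edges_full)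
  also have "\<dots> = enc ` proper"
  proof -
    have "snd (enc a) \<noteq> {0..3}" if "a \<in> proper" for a
    proof -
      have "card (snd (enc a)) \<noteq> 4"
        using that by (auto simp: proper_def card_compl)
      moreover have "card {0..3::nat} = 4" by simp
      ultimately show ?thesis by metis
    qed
    then show ?thesis by auto
  qed
  finally show ?thesis .
qed

section \<open>Rooted trees\<close>

definition all_selfmaps :: "selfmap list" where
  "all_selfmaps = map (\<lambda>(a, b, c, d). Selfmap a b c d) (List.product pts (List.product pts (List.product pts pts)))"

lemma mem_all_selfmaps: "f \<in> set all_selfmaps"
  using set_pts by (cases f) (force simp: all_selfmaps_def)

definition has_short_cycle :: "selfmap \<Rightarrow> bool" where
  "has_short_cycle f = list_ex (\<lambda>v. app f v \<noteq> v \<and> (app f (app f v) = v \<or> app f (app f (app f v)) = v)) pts"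

text \<open>With three arcs there is exactly one fixed point, so a cycle can only have length 2 or
  3; without one, every point flows to the fixed point. The check runs over all 256
  selfmaps.\<close>

definition rooted_or_cyclic :: "selfmap \<Rightarrow> bool" where
  "rooted_or_cyclic f \<longleftrightarrow> rooted f \<or> has_short_cycle f \<or> length (arcs f) \<noteq> 3"

lemma all_rooted_or_cyclic: "list_all rooted_or_cyclic all_selfmaps"
  by code_simp

fun row_covers :: "selfmap \<Rightarrow> (pt \<times> arc list) list \<Rightarrow> row list \<Rightarrow> bool" where
  "row_covers f gs [] = False"
| "row_covers f gs ((fs, gs') # R) = (if f \<in> set fs then set gs \<subseteq> set gs' else row_covers f gs R)"

definition dual_trees :: "selfmap \<Rightarrow> (pt \<times> arc list) list" where
  "dual_trees f = map (\<lambda>g. (root g, arcs g)) (trees_within (dual_neighbours f))"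

fun table_complete :: "row list \<Rightarrow> selfmap list \<Rightarrow> bool" where
  "table_complete R [] = True"
| "table_complete R (f # fs) \<longleftrightarrow> row_covers f (dual_trees f) R \<and> table_complete R fs"

text \<open>The dual trees of a row are computed from the rooting at \<open>P0\<close>. This checks
  that the same row also serves the other rootings, so that no compatible pair is missing from the
  table.\<close>

lemma tree_table_complete: "table_complete tree_table (trees_within (\<lambda>_. pts))"
  by code_simp

lemma table_completeD: "\<lbrakk>table_complete R fs; f \<in> set fs\<rbrakk> \<Longrightarrow> row_covers f (dual_trees f) R"
  by (induction fs) auto

lemma row_coversD: "row_covers f gs R \<Longrightarrow> \<exists>fs gs'. (fs, gs') \<in> set R \<and> f \<in> set fs \<and> set gs \<subseteq> set gs'"
  by (induction R) (auto split: if_splits, blast+)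

lemma rootedD: "rooted f \<Longrightarrow> app f (app f (app f v)) = root f"
  using set_pts[of v] by (auto simp: rooted_def list_all_iff)

lemma app_root: "rooted f \<Longrightarrow> app f (root f) = root f"
  using rootedD[of f] unfolding root_def by metis

lemma app_eq_self_iff: "rooted f \<Longrightarrow> app f v = v \<longleftrightarrow> v = root f"
  using rootedD[of f v] app_root by auto

lemma mem_trees_within: "f \<in> set (trees_within N) \<longleftrightarrow> rooted f \<and> (\<forall>v. app f v \<in> set (N v))"
proof (cases f)
  case (Selfmap a b c d)
  have "(\<forall>v. app f v \<in> set (N v)) \<longleftrightarrow> a \<in> set (N P0) \<and> b \<in> set (N P1) \<and> c \<in> set (N P2) \<and> d \<in> set (N P3)"
  proof
    assume h: "\<forall>v. app f v \<in> set (N v)"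
    then show "a \<in> set (N P0) \<and> b \<in> set (N P1) \<and> c \<in> set (N P2) \<and> d \<in> set (N P3)"
      using h[THEN spec, of P0] h[THEN spec, of P1] h[THEN spec, of P2] h[THEN spec, of P3] Selfmap by simp
  next
    assume h: "a \<in> set (N P0) \<and> b \<in> set (N P1) \<and> c \<in> set (N P2) \<and> d \<in> set (N P3)"
    show "\<forall>v. app f v \<in> set (N v)"
    proof
      fix v show "app f v \<in> set (N v)" using h Selfmap by (cases v) auto
    qed
  qed
  then show ?thesis by (auto simp: trees_within_def Selfmap image_iff)
qed

text \<open>If \<open>{v, w}\<close> and \<open>{t, s}\<close> were disjoint, \<open>{v, w}\<close>
  would be the edge shared by the triangles \<open>t\<close> and \<open>s\<close>, and both trees
  would use it.\<close>

definition compatible :: "arc set \<Rightarrow> arc set \<Rightarrow> bool" where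
  "compatible X Y \<longleftrightarrow> (\<forall>(v, w)\<in>X. \<forall>(t, s)\<in>Y. v = t \<or> v = s \<or> w = t \<or> w = s)"

lemma mem_dual_neighbours:
  "s \<in> set (dual_neighbours f t) \<longleftrightarrow> s = t \<or> (\<forall>(a, b)\<in>set (arcs f). a = t \<or> a = s \<or> b = t \<or> b = s)"
  using set_pts by (auto simp: dual_neighbours_def list_all_iff)

text \<open>That listed pairs are compatible follows from how the neighbour lists are defined; that
  all compatible pairs are listed rests on the computation
  \<open>tree_table_complete\<close>.\<close>

lemma mem_pairs_iff:
  "(f, r, F) \<in> pairs \<longleftrightarrow> (\<exists>g. rooted f \<and> rooted g \<and> compatible (set (arcs f)) (set (arcs g)) \<and> r = root g \<and> F = arcs g)"
proof
  assume "(f, r, F) \<in> pairs"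
  then obtain f0 g where f0: "f \<in> set (trees_within (neighbours f0))" "g \<in> set (trees_within (dual_neighbours f0))"
    "r = root g" "F = arcs g"
    by (auto simp: pairs_def entries_def tree_table_def)
  have "compatible (set (arcs f)) (set (arcs g))"
  proof -
    have "v = t \<or> v = s \<or> w = t \<or> w = s" if h: "(v, w) \<in> set (arcs f)" "(t, s) \<in> set (arcs g)" for v w t s
    proof -
      have "v \<noteq> w" "w \<in> set (neighbours f0 v)"
        using h(1) f0(1) by (auto simp: mem_arcs mem_trees_within)
      then have "(v, w) \<in> set (arcs f0) \<or> (w, v) \<in> set (arcs f0)"
        by (auto simp: neighbours_def mem_arcs)
      moreover have "t \<noteq> s" "s \<in> set (dual_neighbours f0 t)"
        using h(2) f0(2) by (auto simp: mem_arcs mem_trees_within)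
      then have "\<forall>(a, b)\<in>set (arcs f0). a = t \<or> a = s \<or> b = t \<or> b = s"
        unfolding mem_dual_neighbours by blast
      ultimately show ?thesis by blast
    qed
    then show ?thesis unfolding compatible_def by blast
  qed
  then show "\<exists>g. rooted f \<and> rooted g \<and> compatible (set (arcs f)) (set (arcs g)) \<and> r = root g \<and> F = arcs g"
    using f0 by (auto simp: mem_trees_within)
next
  assume "\<exists>g. rooted f \<and> rooted g \<and> compatible (set (arcs f)) (set (arcs g)) \<and> r = root g \<and> F = arcs g"
  then obtain g where g: "rooted f" "rooted g" "compatible (set (arcs f)) (set (arcs g))" "r = root g" "F = arcs g"
    by blast
  have "f \<in> set (trees_within (\<lambda>_. pts))" using g(1) set_pts by (simp add: mem_trees_within)
  then have "row_covers f (dual_trees f) tree_table" by (rule table_completeD[OF tree_table_complete])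
  then have "\<exists>fs gs. (fs, gs) \<in> set tree_table \<and> f \<in> set fs \<and> set (dual_trees f) \<subseteq> set gs"
    by (rule row_coversD)
  moreover have "(r, F) \<in> set (dual_trees f)"
  proof -
    have "app g t \<in> set (dual_neighbours f t)" for t
      using g(3) mem_arcs[of t "app g t" g] unfolding mem_dual_neighbours compatible_def by fastforce
    then show ?thesis using g(2,4,5) by (auto simp: dual_trees_def mem_trees_within)
  qed
  ultimately show "(f, r, F) \<in> pairs" unfolding pairs_def entries_def by blast
qed

lemma card_pt_minus: "card (UNIV - {r :: pt}) = 3"
proof -
  have U: "(UNIV :: pt set) = {P0, P1, P2, P3}" using pt.exhaust by auto
  have "card (UNIV :: pt set) = 4" unfolding U by simp
  then show ?thesis by (simp add: card_Diff_subset)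
qed

text \<open>A finite acyclic relation has a point without outgoing arc, and each of the other three
  points has at most one.\<close>

lemma acyclic_functional_card_le:
  fixes X :: "arc set"
  assumes "acyclic X" "single_valued X"
  shows "card X \<le> 3"
proof -
  have "wf (X\<inverse>)" using assms(1) by (intro finite_acyclic_wf_converse) auto
  then obtain r where r: "\<And>w. (r, w) \<notin> X"
    by (rule wfE_min[of _ undefined UNIV]) auto
  have "inj_on fst X" using assms(2) by (auto simp: inj_on_def single_valued_def)
  then have "card X = card (fst ` X)" by (simp add: card_image)
  also have "\<dots> \<le> card (UNIV - {r})" using r by (intro card_mono) auto
  also have "\<dots> = 3" by (rule card_pt_minus)
  finally show ?thesis .
qed

lemma acyclic_functional_is_rooted_tree:
  fixes X :: "arc set"
  assumes ac: "acyclic X" and sv: "single_valued X" and card: "card X = 3"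
  shows "\<exists>f. rooted f \<and> X = set (arcs f)"
proof -
  define h where "h v = (if \<exists>w. (v, w) \<in> X then SOME w. (v, w) \<in> X else v)" for v
  define f where "f = Selfmap (h P0) (h P1) (h P2) (h P3)"
  have f: "app f v = h v" for v by (cases v) (auto simp: f_def)
  have irr: "(v, v) \<notin> X" for v using ac by (auto simp: acyclic_def)
  have X: "(v, w) \<in> X \<longleftrightarrow> v \<noteq> w \<and> app f v = w" for v w
  proof
    assume vw: "(v, w) \<in> X"
    then have "(v, h v) \<in> X" unfolding h_def by (auto intro: someI)
    then have "h v = w" using sv vw by (auto simp: single_valued_def)
    then show "v \<noteq> w \<and> app f v = w" using irr vw f by auto
  next
    assume h: "v \<noteq> w \<and> app f v = w"
    then have "\<exists>u. (v, u) \<in> X" unfolding f h_def by (auto split: if_splits)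
    then have "(v, h v) \<in> X" unfolding h_def by (auto intro: someI)
    then show "(v, w) \<in> X" using h f by simp
  qed
  then have Xf: "X = set (arcs f)" by (auto simp: mem_arcs)
  have "distinct (arcs f)" by (simp add: arcs_def pts_def distinct_map)
  then have "length (arcs f) = 3" using card Xf distinct_card by metis
  moreover have "\<not> has_short_cycle f"
  proof
    assume "has_short_cycle f"
    then obtain v where v: "app f v \<noteq> v" "app f (app f v) = v \<or> app f (app f (app f v)) = v"
      by (auto simp: has_short_cycle_def list_ex_iff)
    have step: "(u, app f u) \<in> X" if "app f u \<noteq> u" for u using that X by auto
    have "(v, v) \<in> X\<^sup>+"
      using v(2)
    proof
      assume "app f (app f v) = v"
      then have "(v, app f v) \<in> X" "(app f v, v) \<in> X" using v(1) X by auto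
      then show ?thesis by (meson trancl.simps)
    next
      assume 3: "app f (app f (app f v)) = v"
      have "app f (app f v) \<noteq> app f v" using 3 v(1) by metis
      moreover have "app f (app f v) \<noteq> v" using 3 v(1) by metis
      ultimately have "(v, app f v) \<in> X" "(app f v, app f (app f v)) \<in> X" "(app f (app f v), v) \<in> X"
        using v(1) 3 X by auto
      then show ?thesis by (meson trancl.simps)
    qed
    then show False using ac by (auto simp: acyclic_def)
  qed
  ultimately have "rooted f"
    using all_rooted_or_cyclic mem_all_selfmaps[of f] by (auto simp: list_all_iff rooted_or_cyclic_def)
  then show ?thesis using Xf by blast
qed

section \<open>Acyclic matchings yield pairs of rooted trees\<close>

lemma trancl_reverse_map:
  assumes "(a, b) \<in> X\<^sup>+" "\<And>v w. (v, w) \<in> X \<Longrightarrow> (g w, g v) \<in> R\<^sup>+"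
  shows "(g b, g a) \<in> R\<^sup>+"
  using assms(1) by induction (auto intro: assms(2) trancl_trans)

lemma trancl_map:
  assumes "(a, b) \<in> X\<^sup>+" "\<And>v w. (v, w) \<in> X \<Longrightarrow> (g v, g w) \<in> R\<^sup>+"
  shows "(g a, g b) \<in> R\<^sup>+"
  using assms(1) by induction (auto intro: assms(2) trancl_trans)

lemma acyclic_matching_arcs:
  assumes am: "acyclic_matching K W"
    and H: "enc ` proper \<subseteq> hasse_edges K" "hasse_edges K \<subseteq> enc ` (proper \<union> range T)"
    and X_def: "X = {x. enc (V x) \<in> W}" and Y_def: "Y = {y. enc (Q y) \<in> W}" and Z_def: "Z = {t. enc (T t) \<in> W}"
  shows "W = enc ` (V ` X \<union> Q ` Y \<union> T ` Z)"
    and "single_valued X" "acyclic X" "single_valued Y" "acyclic Y"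
    and "compatible X Y" "\<And>t t'. \<lbrakk>t \<in> Z; t' \<in> Z\<rbrakk> \<Longrightarrow> t = t'" "\<And>t s. \<lbrakk>t \<in> Z; (t, s) \<in> Y\<rbrakk> \<Longrightarrow> False"
proof -
  define R where "R = modified_hasse K W"
  have R: "acyclic R" using am by (simp add: acyclic_matching_def R_def)
  have WH: "W \<subseteq> hasse_edges K" using am by (simp add: acyclic_matching_def is_matching_def)
  have eqI: "a = b" if "enc a \<in> W" "enc b \<in> W" "{fst (enc a), snd (enc a)} \<inter> {fst (enc b), snd (enc b)} \<noteq> {}" for a b
  proof -
    have "enc a = enc b"
      using am that unfolding acyclic_matching_def is_matching_def by blast
    then show ?thesis using inj_enc by (simp add: inj_eq)
  qed
  have down: "(snd (enc a), fst (enc a)) \<in> R" if "enc a \<in> W" for a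
    using that by (cases "enc a") (auto simp: R_def modified_hasse_def)
  have up: "(fst (enc a), snd (enc a)) \<in> R" if "a \<in> proper" "enc a \<notin> W" for a
    using that H(1) by (auto simp: R_def modified_hasse_def)
  have mem: "a \<in> proper \<union> range T" if "enc a \<in> W" for a
    using that WH H(2) inj_enc by (metis (no_types, lifting) inj_image_mem_iff subset_iff)
  have XP: "v \<noteq> w" if "(v, w) \<in> X" for v w
    using mem[of "V (v, w)"] that by (auto simp: X_def proper_def)
  have YP: "t \<noteq> s" if "(t, s) \<in> Y" for t s
    using mem[of "Q (t, s)"] that by (auto simp: Y_def proper_def)
  show "W = enc ` (V ` X \<union> Q ` Y \<union> T ` Z)"
  proof (rule set_eqI, rule iffI)
    fix e assume e: "e \<in> W"
    then obtain a where a: "e = enc a" using WH H(2) by blast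
    have "a \<in> V ` X \<union> Q ` Y \<union> T ` Z"
      using e unfolding a X_def Y_def Z_def by (cases a) (simp_all del: enc.simps)
    then show "e \<in> enc ` (V ` X \<union> Q ` Y \<union> T ` Z)" using a by blast
  qed (auto simp: X_def Y_def Z_def simp del: enc.simps)
  show "single_valued X"
    using eqI[of "V (_, _)" "V (_, _)"] unfolding single_valued_def X_def by fastforce
  show "single_valued Y"
    using eqI[of "Q (_, _)" "Q (_, _)"] unfolding single_valued_def Y_def by fastforce
  \<comment> \<open>For an arc from \<open>v\<close> to \<open>w\<close> the modified diagram goes
    up from \<open>{w}\<close> to the edge and down to \<open>{v}\<close>. Its paths thus run
    against the primal arcs.\<close>
  have "({num w}, {num v}) \<in> R\<^sup>+" if vw: "(v, w) \<in> X" for v w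
  proof -
    have "enc (V (w, v)) \<notin> W"
      using eqI[of "V (v, w)" "V (w, v)"] vw XP[OF vw] by (auto simp: X_def insert_commute)
    then have "({num w}, {num v, num w}) \<in> R"
      using up[of "V (w, v)"] XP[OF vw] by (auto simp: proper_V insert_commute)
    moreover have "({num v, num w}, {num v}) \<in> R" using down[of "V (v, w)"] vw by (simp add: X_def)
    ultimately show ?thesis by (meson trancl.simps)
  qed
  then show "acyclic X"
    using R trancl_reverse_map[of _ _ X "\<lambda>v. {num v}" R] unfolding acyclic_def by blast
  \<comment> \<open>Here the modified diagram goes down from the triangle \<open>t\<close> to the
    shared edge and up to the triangle \<open>s\<close>, so its paths follow the dual arcs.\<close>
  have "({0..3} - {num t}, {0..3} - {num s}) \<in> R\<^sup>+" if ts: "(t, s) \<in> Y" for t s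
  proof -
    have "enc (Q (s, t)) \<notin> W"
      using eqI[of "Q (t, s)" "Q (s, t)"] ts YP[OF ts] by (auto simp: Y_def insert_commute)
    then have "({0..3} - {num t, num s}, {0..3} - {num s}) \<in> R"
      using up[of "Q (s, t)"] YP[OF ts] by (auto simp: proper_Q insert_commute)
    moreover have "({0..3} - {num t}, {0..3} - {num t, num s}) \<in> R" using down[of "Q (t, s)"] ts by (simp add: Y_def)
    ultimately show ?thesis by (meson trancl.simps)
  qed
  then show "acyclic Y"
    using R trancl_map[of _ _ Y "\<lambda>t. {0..3} - {num t}" R] unfolding acyclic_def by blast
  have "v = t \<or> v = s \<or> w = t \<or> w = s" if vw: "(v, w) \<in> X" and ts: "(t, s) \<in> Y" for v w t s
  proof (rule ccontr)
    assume "\<not> ?thesis"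
    then have "{num v, num w} = {0..3} - {num t, num s}"
      using edge_eq_compl_iff[OF XP[OF vw] YP[OF ts]] by blast
    then show False
      using eqI[of "V (v, w)" "Q (t, s)"] vw ts by (simp add: X_def Y_def)
  qed
  then show "compatible X Y" unfolding compatible_def by blast
  show "t = t'" if "t \<in> Z" "t' \<in> Z" for t t'
    using eqI[of "T t" "T t'"] that by (auto simp: Z_def)
  show False if "t \<in> Z" "(t, s) \<in> Y" for t s
    using eqI[of "T t" "Q (t, s)"] that by (auto simp: Z_def Y_def)
qed

text \<open>Pairs with the solid tetrahedron are counted apart, so that one statement covers the
  boundary and the full simplex. The bound 6 is attained only if both forests are spanning
  trees.\<close>

lemma acyclic_matching_card:
  assumes am: "acyclic_matching K W"
    and H: "enc ` proper \<subseteq> hasse_edges K" "hasse_edges K \<subseteq> enc ` (proper \<union> range T)"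
  shows "card {e \<in> W. e \<notin> enc ` range T} \<le> 6" "card {e \<in> W. e \<in> enc ` range T} \<le> 1"
    "card {e \<in> W. e \<notin> enc ` range T} = 6 \<Longrightarrow>
      \<exists>f r F. (f, r, F) \<in> pairs \<and> W \<subseteq> enc ` insert (T r) (V ` set (arcs f) \<union> Q ` set F)"
proof -
  define X where "X = {x. enc (V x) \<in> W}"
  define Y where "Y = {y. enc (Q y) \<in> W}"
  define Z where "Z = {t. enc (T t) \<in> W}"
  note s = acyclic_matching_arcs[OF am H X_def Y_def Z_def]
  have inj: "inj_on enc A" for A using inj_enc inj_on_subset by blast
  have 1: "{e \<in> W. e \<notin> enc ` range T} = enc ` (V ` X \<union> Q ` Y)"
    unfolding s(1) using inj_enc by (auto simp: inj_eq simp del: enc.simps)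
  have 2: "{e \<in> W. e \<in> enc ` range T} = enc ` T ` Z"
    unfolding s(1) using inj_enc by (auto simp: inj_eq simp del: enc.simps)
  have "card (V ` X \<union> Q ` Y) = card (V ` X) + card (Q ` Y)"
    by (intro card_Un_disjoint) auto
  then have c: "card {e \<in> W. e \<notin> enc ` range T} = card X + card Y"
    unfolding 1 by (simp add: card_image[OF inj] card_image inj_on_def)
  have le: "card X \<le> 3" "card Y \<le> 3" using s acyclic_functional_card_le by auto
  then show "card {e \<in> W. e \<notin> enc ` range T} \<le> 6" using c by simp
  show "card {e \<in> W. e \<in> enc ` range T} \<le> 1"
  proof -
    have "card Z \<le> 1" using s(7) by (intro card_le_Suc0_iff_eq[THEN iffD2, folded One_nat_def]) auto
    then show ?thesis unfolding 2 by (simp add: card_image[OF inj] card_image inj_on_def)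
  qed
  assume "card {e \<in> W. e \<notin> enc ` range T} = 6"
  then have "card X = 3" "card Y = 3" using c le by auto
  then obtain f g where fg: "rooted f" "X = set (arcs f)" "rooted g" "Y = set (arcs g)"
    using s(2-5) acyclic_functional_is_rooted_tree by meson
  then have "(f, root g, arcs g) \<in> pairs" using s(6) unfolding mem_pairs_iff by blast
  \<comment> \<open>A triangle matched with the tetrahedron is not matched with an edge, so it has
    no outgoing arc and must be the root of the dual tree.\<close>
  moreover have "Z \<subseteq> {root g}"
  proof
    fix t assume "t \<in> Z"
    then have "(t, app g t) \<notin> set (arcs g)" using s(8) fg(4) by blast
    then have "app g t = t" by (auto simp: mem_arcs)
    then show "t \<in> {root g}" using app_eq_self_iff[OF fg(3)] by simp
  qed
  then have "W \<subseteq> enc ` insert (T (root g)) (V ` set (arcs f) \<union> Q ` set (arcs g))"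
    unfolding s(1) fg(2,4) by blast
  ultimately show "\<exists>f r F. (f, r, F) \<in> pairs \<and> W \<subseteq> enc ` insert (T r) (V ` set (arcs f) \<union> Q ` set F)"
    by blast
qed

section \<open>Pairs of rooted trees yield acyclic matchings\<close>

definition depth_of :: "selfmap \<Rightarrow> pt \<Rightarrow> nat" where
  "depth_of f v = (if v = root f then 0 else if app f v = root f then 1 else if app f (app f v) = root f then 2 else 3)"

lemma depth_of_le: "depth_of f v \<le> 3"
  by (simp add: depth_of_def)

lemma depth_of_pos: "v \<noteq> root f \<Longrightarrow> depth_of f v > 0"
  by (simp add: depth_of_def)

lemma depth_of_app: "\<lbrakk>rooted f; v \<noteq> root f\<rbrakk> \<Longrightarrow> depth_of f v = Suc (depth_of f (app f v))"
  using rootedD[of f v] by (auto simp: depth_of_def)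

lemma arcs_not_root: "\<lbrakk>rooted f; (v, w) \<in> set (arcs f)\<rbrakk> \<Longrightarrow> v \<noteq> root f \<and> w = app f v"
  using app_root by (auto simp: mem_arcs)

lemma arcs_antisym: "\<lbrakk>rooted f; (v, w) \<in> set (arcs f)\<rbrakk> \<Longrightarrow> (w, v) \<notin> set (arcs f)"
proof
  assume f: "rooted f" and vw: "(v, w) \<in> set (arcs f)" and wv: "(w, v) \<in> set (arcs f)"
  have "depth_of f v = Suc (depth_of f w)" using depth_of_app[OF f] arcs_not_root[OF f vw] by metis
  moreover have "depth_of f w = Suc (depth_of f v)" using depth_of_app[OF f] arcs_not_root[OF f wv] by metis
  ultimately show False by simp
qed

lemma compatibleD:
  assumes "compatible X Y" "(v, w) \<in> X" "(t, s) \<in> Y"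
  shows "v = t \<or> v = s \<or> w = t \<or> w = s"
proof -
  have "\<forall>(t, s)\<in>Y. v = t \<or> v = s \<or> w = t \<or> w = s"
    using bspec[OF assms(1)[unfolded compatible_def] assms(2)] by simp
  from bspec[OF this assms(3)] show ?thesis by simp
qed

lemma pair_disjointI:
  assumes "card x1 \<noteq> card y1 \<or> x1 \<noteq> y1" "card x2 \<noteq> card y2 \<or> x2 \<noteq> y2"
    "card x1 \<noteq> card y2 \<or> x1 \<noteq> y2" "card x2 \<noteq> card y1 \<or> x2 \<noteq> y1"
  shows "{x1, x2} \<inter> {y1, y2} = {}"
  using assms by blast

locale tree_pair =
  fixes f g :: selfmap
  assumes f: "rooted f" and g: "rooted g" and fg: "compatible (set (arcs f)) (set (arcs g))"
begin

definition vmatched where "vmatched \<sigma> v \<longleftrightarrow> (v, app f v) \<in> set (arcs f) \<and> \<sigma> = {num v, num (app f v)}"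
definition tmatched where "tmatched \<sigma> t \<longleftrightarrow> (t, app g t) \<in> set (arcs g) \<and> \<sigma> = {0..3} - {num t, num (app g t)}"

text \<open>Part of a height function that increases along the modified diagram. A vertex at depth
  \<open>d\<close> has rank \<open>2 * d\<close>; its matched edge, entered from the parent of rank
  \<open>2 * d - 2\<close>, has \<open>2 * d - 1\<close>. A triangle at depth \<open>d\<close> has
  \<open>26 - 2 * d\<close>; its matched edge, leading to the parent of rank
  \<open>28 - 2 * d\<close>, has \<open>27 - 2 * d\<close>. The default 10 separates the primal
  ranks, at most 6, from the dual ranks, at least 20.\<close>

definition edge_rank :: "nat set \<Rightarrow> nat" where
  "edge_rank \<sigma> = (if \<exists>v. vmatched \<sigma> v then 2 * depth_of f (SOME v. vmatched \<sigma> v) - 1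
     else if \<exists>t. tmatched \<sigma> t then 27 - 2 * depth_of g (SOME t. tmatched \<sigma> t) else 10)"

text \<open>The tetrahedron gets 25, between the root triangle with 26, to which its matched edge
  leads, and the other triangles with at most 24, from which it is entered.\<close>

definition rank :: "nat set \<Rightarrow> nat" where
  "rank \<sigma> = (if card \<sigma> = 1 then 2 * depth_of f (SOME v. \<sigma> = {num v})
     else if card \<sigma> = 2 then edge_rank \<sigma>
     else if card \<sigma> = 3 then 26 - 2 * depth_of g (SOME t. \<sigma> = {0..3} - {num t}) else 25)"

lemma vmatched_unique: "\<lbrakk>vmatched \<sigma> v; vmatched \<sigma> v'\<rbrakk> \<Longrightarrow> v = v'"
  using arcs_antisym[OF f, of v "app f v"] by (auto simp: vmatched_def doubleton_eq_iff)

lemma tmatched_unique: "\<lbrakk>tmatched \<sigma> t; tmatched \<sigma> t'\<rbrakk> \<Longrightarrow> t = t'"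
proof -
  assume h: "tmatched \<sigma> t" "tmatched \<sigma> t'"
  then have "{0..3} - {num t, num (app g t)} = {0..3} - {num t', num (app g t')}"
    unfolding tmatched_def by metis
  then have "{t, app g t} = {t', app g t'}" unfolding compl2_inject .
  moreover have m: "(t, app g t) \<in> set (arcs g)" "(t', app g t') \<in> set (arcs g)"
    using h unfolding tmatched_def by blast+
  ultimately show ?thesis
    using arcs_antisym[OF g m(1)] by (auto simp only: doubleton_eq_iff)
qed

lemma not_vmatched_and_tmatched: "vmatched \<sigma> v \<Longrightarrow> \<not> tmatched \<sigma> t"
proof
  assume h: "vmatched \<sigma> v" "tmatched \<sigma> t"
  then have "{num v, num (app f v)} = {0..3} - {num t, num (app g t)}"
    unfolding vmatched_def tmatched_def by metis
  moreover have "v \<noteq> app f v" "t \<noteq> app g t" using h by (simp_all add: vmatched_def tmatched_def mem_arcs)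
  ultimately have "v \<noteq> t \<and> v \<noteq> app g t \<and> app f v \<noteq> t \<and> app f v \<noteq> app g t"
    using edge_eq_compl_iff by blast
  moreover have m: "(v, app f v) \<in> set (arcs f)" "(t, app g t) \<in> set (arcs g)"
    using h by (simp_all only: vmatched_def tmatched_def)
  ultimately show False using compatibleD[OF fg m] by metis
qed

lemma edge_rank_vmatched: "vmatched \<sigma> v \<Longrightarrow> edge_rank \<sigma> = 2 * depth_of f v - 1"
proof -
  assume h: "vmatched \<sigma> v"
  then have "(SOME v. vmatched \<sigma> v) = v" using vmatched_unique by (intro some_equality) auto
  then show ?thesis using h by (auto simp: edge_rank_def)
qed

lemma edge_rank_tmatched: "tmatched \<sigma> t \<Longrightarrow> edge_rank \<sigma> = 27 - 2 * depth_of g t"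
proof -
  assume h: "tmatched \<sigma> t"
  then have "(SOME t. tmatched \<sigma> t) = t" using tmatched_unique by (intro some_equality) auto
  then show ?thesis using h not_vmatched_and_tmatched by (auto simp: edge_rank_def)
qed

lemma edge_rank_not_vmatched: "(\<And>v. \<not> vmatched \<sigma> v) \<Longrightarrow> edge_rank \<sigma> \<ge> 10"
  using depth_of_le[of g "SOME t. tmatched \<sigma> t"] by (auto simp: edge_rank_def)

lemma edge_rank_not_tmatched: "(\<And>t. \<not> tmatched \<sigma> t) \<Longrightarrow> edge_rank \<sigma> \<le> 10"
  using depth_of_le[of f "SOME v. vmatched \<sigma> v"] by (auto simp: edge_rank_def)

lemma rank_vertex: "rank {num v} = 2 * depth_of f v"
proof -
  have "(SOME v'. {num v} = {num v'}) = v" by (rule some_equality) auto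
  then show ?thesis by (simp add: rank_def)
qed

lemma rank_triangle: "rank ({0..3} - {num t}) = 26 - 2 * depth_of g t"
proof -
  have "(SOME t'. {0..3} - {num t} = {0..3} - {num t'}) = t"
    by (rule some_equality) (auto simp only: compl_inject)
  then show ?thesis using card_compl(1)[of t] by (simp add: rank_def)
qed

lemma rank_edge: "v \<noteq> w \<Longrightarrow> rank {num v, num w} = edge_rank {num v, num w}"
  by (simp add: rank_def)

lemma rank_coedge: "t \<noteq> s \<Longrightarrow> rank ({0..3} - {num t, num s}) = edge_rank ({0..3} - {num t, num s})"
  using card_compl(2)[of t s] by (simp add: rank_def)

lemma rank_top: "rank {0..3} = 25"
  by (simp add: rank_def)

lemma rank_V:
  assumes "v \<noteq> w"
  shows "(v, w) \<in> set (arcs f) \<Longrightarrow> rank {num v, num w} < rank {num v}"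
    and "(v, w) \<notin> set (arcs f) \<Longrightarrow> rank {num v} < rank {num v, num w}"
proof -
  assume vw: "(v, w) \<in> set (arcs f)"
  then have "vmatched {num v, num w} v" by (auto simp: vmatched_def mem_arcs)
  then show "rank {num v, num w} < rank {num v}"
    using depth_of_pos[of v f] arcs_not_root[OF f vw] assms
    by (simp add: rank_edge rank_vertex edge_rank_vmatched)
next
  assume vw: "(v, w) \<notin> set (arcs f)"
  show "rank {num v} < rank {num v, num w}"
  proof (cases "(w, v) \<in> set (arcs f)")
    case True
    then have m: "vmatched {num v, num w} w" by (auto simp: vmatched_def mem_arcs)
    have "depth_of f w = Suc (depth_of f v)" using arcs_not_root[OF f True] depth_of_app[OF f] by metis
    then show ?thesis using assms by (simp add: rank_edge rank_vertex edge_rank_vmatched[OF m])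
  next
    case False
    have "\<not> vmatched {num v, num w} u" for u
      using vw False by (auto simp: vmatched_def doubleton_eq_iff)
    then have "edge_rank {num v, num w} \<ge> 10" by (rule edge_rank_not_vmatched)
    then show ?thesis using assms depth_of_le[of f v] by (simp add: rank_edge rank_vertex)
  qed
qed

lemma rank_Q:
  assumes "t \<noteq> s"
  shows "(t, s) \<in> set (arcs g) \<Longrightarrow> rank ({0..3} - {num t}) < rank ({0..3} - {num t, num s})"
    and "(t, s) \<notin> set (arcs g) \<Longrightarrow> rank ({0..3} - {num t, num s}) < rank ({0..3} - {num t})"
proof -
  assume ts: "(t, s) \<in> set (arcs g)"
  then have "tmatched ({0..3} - {num t, num s}) t" by (simp add: tmatched_def mem_arcs)
  then show "rank ({0..3} - {num t}) < rank ({0..3} - {num t, num s})"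
    using depth_of_le[of g t] by (simp add: rank_coedge[OF assms] rank_triangle edge_rank_tmatched)
next
  assume ts: "(t, s) \<notin> set (arcs g)"
  show "rank ({0..3} - {num t, num s}) < rank ({0..3} - {num t})"
  proof (cases "(s, t) \<in> set (arcs g)")
    case True
    then have m: "tmatched ({0..3} - {num t, num s}) s" by (simp add: tmatched_def mem_arcs insert_commute)
    have "depth_of g s = Suc (depth_of g t)" using arcs_not_root[OF g True] depth_of_app[OF g] by metis
    then show ?thesis
      using depth_of_le[of g s] by (simp add: rank_coedge[OF assms] rank_triangle edge_rank_tmatched[OF m])
  next
    case False
    have "\<not> tmatched ({0..3} - {num t, num s}) u" for u
      unfolding tmatched_def compl2_inject using ts False by (auto simp: doubleton_eq_iff)
    then have "edge_rank ({0..3} - {num t, num s}) \<le> 10" by (rule edge_rank_not_tmatched)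
    then show ?thesis using depth_of_le[of g t] by (simp add: rank_coedge[OF assms] rank_triangle)
  qed
qed

text \<open>\<open>A\<close> is empty for the boundary and \<open>range T\<close> for the full
  simplex; the intersection adds the tetrahedron, matched with the dual root, in the latter case
  only.\<close>

definition labels :: "lab set \<Rightarrow> lab set" where
  "labels A = V ` set (arcs f) \<union> Q ` set (arcs g) \<union> (A \<inter> {T (root g)})"

lemma rank_label:
  assumes "a \<in> proper \<union> range T" "A = range T \<or> a \<notin> range T"
  shows "a \<in> labels A \<Longrightarrow> rank (snd (enc a)) < rank (fst (enc a))"
    and "a \<notin> labels A \<Longrightarrow> rank (fst (enc a)) < rank (snd (enc a))"
proof -
  have "(a \<in> labels A \<longrightarrow> rank (snd (enc a)) < rank (fst (enc a))) \<and>
        (a \<notin> labels A \<longrightarrow> rank (fst (enc a)) < rank (snd (enc a)))"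
  proof (cases a)
    case (V x)
    obtain v w where x: "x = (v, w)" by (rule prod.exhaust)
    have "v \<noteq> w" using assms(1) V x by (auto simp: proper_def)
    moreover have "a \<in> labels A \<longleftrightarrow> (v, w) \<in> set (arcs f)" unfolding V x labels_def by auto
    ultimately show ?thesis using rank_V unfolding V x enc.simps fst_conv snd_conv by blast
  next
    case (Q x)
    obtain t s where x: "x = (t, s)" by (rule prod.exhaust)
    have "t \<noteq> s" using assms(1) Q x by (auto simp: proper_def)
    moreover have "a \<in> labels A \<longleftrightarrow> (t, s) \<in> set (arcs g)" unfolding Q x labels_def by auto
    ultimately show ?thesis using rank_Q unfolding Q x enc.simps fst_conv snd_conv by blast
  next
    case (T t)
    have "a \<in> labels A \<longleftrightarrow> t = root g" using assms(2) unfolding T labels_def by auto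
    moreover have "t = root g \<Longrightarrow> depth_of g t = 0" by (simp add: depth_of_def)
    ultimately show ?thesis
      unfolding T enc.simps fst_conv snd_conv rank_top rank_triangle
      using depth_of_pos[of t g] depth_of_le[of g t] by auto
  qed
  then show "a \<in> labels A \<Longrightarrow> rank (snd (enc a)) < rank (fst (enc a))"
    "a \<notin> labels A \<Longrightarrow> rank (fst (enc a)) < rank (snd (enc a))" by blast+
qed

lemma labels_subset: "labels A \<subseteq> proper \<union> A"
proof -
  have "V (v, w) \<in> proper" "Q (v, w) \<in> proper" if "(v, w) \<in> set (arcs h)" for v w h
    using that by (simp_all add: mem_arcs proper_V proper_Q)
  then show ?thesis unfolding labels_def by auto
qed

lemma labels_cases:
  assumes "a \<in> labels A"
  shows "(\<exists>v w. a = V (v, w) \<and> (v, w) \<in> set (arcs f)) \<or> (\<exists>t s. a = Q (t, s) \<and> (t, s) \<in> set (arcs g)) \<or>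
    a = T (root g)"
  using assms unfolding labels_def by auto

text \<open>Sizes settle all coincidences except three kinds: within one tree, where each point has
  one parent and no arc is reversed; an edge used by both trees, excluded by compatibility; and the
  root triangle, which has no arc of its own.\<close>

lemma labels_disjoint:
  assumes "a \<in> labels A" "b \<in> labels A" "a \<noteq> b"
  shows "{fst (enc a), snd (enc a)} \<inter> {fst (enc b), snd (enc b)} = {}"
proof -
  have VV: "v \<noteq> v' \<and> {num v, num w} \<noteq> {num v', num w'}"
    if "(v, w) \<in> set (arcs f)" "(v', w') \<in> set (arcs f)" "(v, w) \<noteq> (v', w')" for v w v' w'
    using that arcs_antisym[OF f that(1)] by (auto simp: mem_arcs doubleton_eq_iff)
  have QQ: "t \<noteq> t' \<and> {0..3} - {num t, num s} \<noteq> {0..3} - {num t', num s'}"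
    if "(t, s) \<in> set (arcs g)" "(t', s') \<in> set (arcs g)" "(t, s) \<noteq> (t', s')" for t s t' s'
    unfolding compl2_inject
    using that arcs_antisym[OF g that(1)] by (auto simp: mem_arcs doubleton_eq_iff)
  have VQ: "{num v, num w} \<noteq> {0..3} - {num t, num s}"
    if "(v, w) \<in> set (arcs f)" "(t, s) \<in> set (arcs g)" for v w t s
  proof -
    have "v \<noteq> w" "t \<noteq> s" using that by (simp_all add: mem_arcs)
    moreover have "v = t \<or> v = s \<or> w = t \<or> w = s" using compatibleD[OF fg that] .
    ultimately show ?thesis using edge_eq_compl_iff by blast
  qed
  have QT: "t \<noteq> root g" if "(t, s) \<in> set (arcs g)" for t s
    using arcs_not_root[OF g that] by blast
  define c where "c a = (card (fst (enc a)), card (snd (enc a)))" for a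
  have c: "c (V (v, w)) = (1, 2)" "c (Q (v, w)) = (2, 3)" if "v \<noteq> w" for v w
    using that by (simp_all add: c_def card_compl)
  have cT: "c (T t) = (3, 4)" for t by (simp add: c_def card_compl)
  have pr: "v \<noteq> w" if "(v, w) \<in> set (arcs h)" for v w h using that by (simp add: mem_arcs)
  consider v w v' w' where "a = V (v, w)" "b = V (v', w')" "(v, w) \<in> set (arcs f)" "(v', w') \<in> set (arcs f)"
    | v w t s where "a = V (v, w)" "b = Q (t, s)" "(v, w) \<in> set (arcs f)" "(t, s) \<in> set (arcs g)"
    | v w where "a = V (v, w)" "b = T (root g)" "(v, w) \<in> set (arcs f)"
    | t s v w where "a = Q (t, s)" "b = V (v, w)" "(t, s) \<in> set (arcs g)" "(v, w) \<in> set (arcs f)"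
    | t s t' s' where "a = Q (t, s)" "b = Q (t', s')" "(t, s) \<in> set (arcs g)" "(t', s') \<in> set (arcs g)"
    | t s where "a = Q (t, s)" "b = T (root g)" "(t, s) \<in> set (arcs g)"
    | v w where "a = T (root g)" "b = V (v, w)" "(v, w) \<in> set (arcs f)"
    | t s where "a = T (root g)" "b = Q (t, s)" "(t, s) \<in> set (arcs g)"
    using labels_cases[OF assms(1)] labels_cases[OF assms(2)] assms(3)
    by (elim disjE exE conjE; (metis | blast))
  then show ?thesis
  proof cases
    case 1
    then have "v \<noteq> v'" "{num v, num w} \<noteq> {num v', num w'}" using VV assms(3) by blast+
    moreover have "{num v} \<noteq> {num v', num w'}" "{num v, num w} \<noteq> {num v'}"
      using pr[OF 1(3)] pr[OF 1(4)] by (auto simp: doubleton_eq_iff)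
    ultimately show ?thesis unfolding 1 enc.simps fst_conv snd_conv by (intro pair_disjointI) simp_all
  next
    case 2
    then have cc: "c a = (1, 2)" "c b = (2, 3)" using c cT pr by simp_all
    have "snd (enc a) \<noteq> fst (enc b)" using VQ 2 by simp
    then show ?thesis using cc unfolding c_def prod.inject by (intro pair_disjointI) simp_all
  next
    case 3
    then have cc: "c a = (1, 2)" "c b = (3, 4)" using c cT pr by simp_all
    then show ?thesis unfolding c_def prod.inject by (intro pair_disjointI) simp_all
  next
    case 4
    then have cc: "c a = (2, 3)" "c b = (1, 2)" using c cT pr by simp_all
    have "fst (enc a) \<noteq> snd (enc b)" using VQ 4 by (metis enc.simps(1,2) fst_conv snd_conv)
    then show ?thesis using cc unfolding c_def prod.inject by (intro pair_disjointI) simp_all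
  next
    case 5
    then have cc: "c a = (2, 3)" "c b = (2, 3)" using c cT pr by simp_all
    have "t \<noteq> t'" "{0..3} - {num t, num s} \<noteq> {0..3} - {num t', num s'}" using QQ 5 assms(3) by blast+
    then have "fst (enc a) \<noteq> fst (enc b)" "snd (enc a) \<noteq> snd (enc b)"
      unfolding 5 enc.simps fst_conv snd_conv compl_inject by blast+
    then show ?thesis using cc unfolding c_def prod.inject by (intro pair_disjointI) simp_all
  next
    case 6
    then have cc: "c a = (2, 3)" "c b = (3, 4)" using c cT pr by simp_all
    have "snd (enc a) \<noteq> fst (enc b)"
      unfolding 6 enc.simps fst_conv snd_conv compl_inject using QT 6 by blast
    then show ?thesis using cc unfolding c_def prod.inject by (intro pair_disjointI) simp_all
  next
    case 7
    then have cc: "c a = (3, 4)" "c b = (1, 2)" using c cT pr by simp_all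
    then show ?thesis unfolding c_def prod.inject by (intro pair_disjointI) simp_all
  next
    case 8
    then have cc: "c a = (3, 4)" "c b = (2, 3)" using c cT pr by simp_all
    have "fst (enc a) \<noteq> snd (enc b)"
      unfolding 8 enc.simps fst_conv snd_conv compl_inject using QT 8 by blast
    then show ?thesis using cc unfolding c_def prod.inject by (intro pair_disjointI) simp_all
  qed
qed

text \<open>Acyclicity holds because \<open>rank\<close> embeds the modified diagram into the order
  of the natural numbers.\<close>

lemma acyclic_matching_labels:
  assumes H: "hasse_edges K = enc ` (proper \<union> A)" and A: "A = {} \<or> A = range T"
  shows "acyclic_matching K (enc ` labels A)"
proof -
  have "is_matching K (enc ` labels A)"
    unfolding is_matching_def H using labels_subset[of A] labels_disjoint[of _ A] by blast
  moreover have "modified_hasse K (enc ` labels A) \<subseteq> Wellfounded.measure rank"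
  proof
    fix e assume "e \<in> modified_hasse K (enc ` labels A)"
    then have "e \<in> enc ` (proper \<union> A) - enc ` labels A \<or> e \<in> (enc ` labels A)\<inverse>"
      unfolding modified_hasse_def H by blast
    then consider a where "a \<in> proper \<union> A" "e = enc a" "a \<notin> labels A" | a where "a \<in> labels A" "e = (snd (enc a), fst (enc a))"
    proof
      assume "e \<in> enc ` (proper \<union> A) - enc ` labels A"
      then show ?thesis using that(1) by blast
    next
      assume "e \<in> (enc ` labels A)\<inverse>"
      then have "(snd e, fst e) \<in> enc ` labels A" by (cases e) simp
      then obtain a where "a \<in> labels A" "(snd e, fst e) = enc a" by blast
      moreover from this have "e = (snd (enc a), fst (enc a))" by (metis fst_conv snd_conv prod.collapse)
      ultimately show ?thesis using that(2) by blast
    qed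
    then show "e \<in> Wellfounded.measure rank"
    proof cases
      case 1
      then have "a \<in> proper \<union> range T" "A = range T \<or> a \<notin> range T" using A by (auto simp: proper_def)
      then have "rank (fst (enc a)) < rank (snd (enc a))" using rank_label(2) 1(3) by blast
      then have "(fst (enc a), snd (enc a)) \<in> Wellfounded.measure rank" by (simp only: in_measure)
      then show ?thesis by (simp only: 1(2) prod.collapse)
    next
      case 2
      then have "a \<in> proper \<union> A" using labels_subset by blast
      then have "a \<in> proper \<union> range T" "A = range T \<or> a \<notin> range T" using A by (auto simp: proper_def)
      then have "rank (snd (enc a)) < rank (fst (enc a))" using rank_label(1) 2(1) by blast
      then show ?thesis by (simp only: 2(2) in_measure)
    qed
  qed
  then have "wf (modified_hasse K (enc ` labels A))" by (rule wf_subset[OF wf_measure])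
  ultimately show ?thesis by (simp add: acyclic_matching_def wf_acyclic)
qed

lemma card_labels: "card (labels A) = 6 + card (A \<inter> {T (root g)})"
proof -
  have c3: "card (set (arcs h)) = 3" if h: "rooted h" for h
  proof -
    have "(v, w) \<in> set (arcs h) \<longleftrightarrow> (v, w) \<in> (\<lambda>v. (v, app h v)) ` (UNIV - {root h})" for v w
    proof -
      have "(v, w) \<in> (\<lambda>v. (v, app h v)) ` (UNIV - {root h}) \<longleftrightarrow> v \<noteq> root h \<and> w = app h v"
        by (simp only: image_iff Bex_def prod.inject Diff_iff UNIV_I singleton_iff HOL.simp_thms) metis
      then show ?thesis using app_eq_self_iff[OF h, of v] unfolding mem_arcs by metis
    qed
    then have "set (arcs h) = (\<lambda>v. (v, app h v)) ` (UNIV - {root h})" by (intro set_eqI) (simp only: split_paired_all)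
    also have "card \<dots> = card (UNIV - {root h})" by (rule card_image) (simp add: inj_on_def)
    also have "\<dots> = 3" by (rule card_pt_minus)
    finally show ?thesis .
  qed
  have "card (labels A) = card (V ` set (arcs f) \<union> Q ` set (arcs g)) + card (A \<inter> {T (root g)})"
    unfolding labels_def by (rule card_Un_disjoint) (simp, simp, blast)
  also have "card (V ` set (arcs f) \<union> Q ` set (arcs g)) = card (V ` set (arcs f)) + card (Q ` set (arcs g))"
    by (rule card_Un_disjoint) (simp, simp, blast)
  also have "card (V ` set (arcs f)) = 3" using c3[OF f] by (subst card_image) (simp_all add: inj_on_def)
  also have "card (Q ` set (arcs g)) = 3" using c3[OF g] by (subst card_image) (simp_all add: inj_on_def)
  finally show ?thesis by simp
qed

end

section \<open>Transfer from labels to Hasse edges, and conclusion\<close>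

lemma geom_image_homeomorphic:
  assumes "inj f"
  shows "top_of_set (geom K) homeomorphic_space top_of_set (geom ((`) f ` K))"
proof -
  define push where "push x w = (if w \<in> range f then x (inv f w) else 0)" for x :: "'a \<Rightarrow> real" and w
  define pull where "pull y v = y (f v)" for y :: "'b \<Rightarrow> real" and v
  have push_f: "push x (f v) = x v" for x v using assms by (simp add: push_def)
  have mem_f: "f v \<in> f ` \<rho> \<longleftrightarrow> v \<in> \<rho>" for v \<rho> using assms by (rule inj_image_mem_iff)
  have sum_f: "sum y (f ` \<rho>) = sum (\<lambda>v. y (f v)) \<rho>" for y :: "'b \<Rightarrow> real" and \<rho>
    using assms by (subst sum.reindex) (auto intro: inj_on_subset)
  have push: "push x \<in> geom ((`) f ` K)" if x: "x \<in> geom K" for x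
  proof -
    obtain \<rho> where \<rho>: "\<rho> \<in> K" "\<And>v. v \<notin> \<rho> \<Longrightarrow> x v = 0" "\<And>v. 0 \<le> x v" "sum x \<rho> = 1"
      using x by (elim geomE) blast
    show ?thesis
    proof (rule geomI)
      show "f ` \<rho> \<in> (`) f ` K" using \<rho>(1) by blast
      show "push x w = 0" if "w \<notin> f ` \<rho>" for w
      proof (cases "w \<in> range f")
        case True
        then obtain v where "w = f v" by blast
        then show ?thesis using that \<rho>(2) by (auto simp: push_f)
      qed (simp add: push_def)
      show "0 \<le> push x w" for w using \<rho>(3) by (simp add: push_def)
      show "sum (push x) (f ` \<rho>) = 1" using \<rho>(4) by (simp add: sum_f push_f)
    qed
  qed
  have pull: "pull y \<in> geom K \<and> push (pull y) = y" if y: "y \<in> geom ((`) f ` K)" for y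
  proof -
    obtain \<rho>' where \<rho>': "\<rho>' \<in> (`) f ` K" "\<And>w. w \<notin> \<rho>' \<Longrightarrow> y w = 0" "\<And>w. 0 \<le> y w" "sum y \<rho>' = 1"
      using y by (elim geomE) blast
    then obtain \<rho> where "\<rho> \<in> K" "\<rho>' = f ` \<rho>" by blast
    note \<rho> = this(1) \<rho>'(2-4)[unfolded this(2)]
    have "pull y \<in> geom K"
    proof (rule geomI)
      show "\<rho> \<in> K" by (rule \<rho>(1))
      show "pull y v = 0" if "v \<notin> \<rho>" for v using that \<rho>(2)[of "f v"] by (simp add: pull_def mem_f)
      show "0 \<le> pull y v" for v using \<rho>(3) by (simp add: pull_def)
      show "sum (pull y) \<rho> = 1" using \<rho>(4) by (simp add: sum_f pull_def)
    qed
    moreover have "push (pull y) w = y w" for w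
    proof (cases "w \<in> range f")
      case True
      then obtain v where "w = f v" by blast
      then show ?thesis by (simp add: push_f pull_def)
    next
      case False
      then have "y w = 0" using \<rho>(2) by blast
      then show ?thesis using False by (simp add: push_def)
    qed
    ultimately show ?thesis by blast
  qed
  have "continuous_on S push" for S
  proof (rule continuous_on_coordinatewise_then_product)
    show "continuous_on S (\<lambda>x. push x w)" for w
      by (cases "w \<in> range f") (simp_all add: push_def continuous_on_coordinate)
  qed
  moreover have "continuous_on S pull" for S
    unfolding pull_def by (intro continuous_on_coordinatewise_then_product continuous_on_coordinate)
  moreover have "pull (push x) = x" for x by (rule ext) (simp add: pull_def push_f)
  ultimately show ?thesis
    unfolding homeomorphic_space_def homeomorphic_maps_def
    using push pull by (intro exI[of _ push] exI[of _ pull]) auto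
qed

lemma pairs_nonempty: "\<exists>f r F. (f, r, F) \<in> pairs"
proof -
  obtain x c where "hd critical_pairs = (x, c)" by (rule prod.exhaust)
  moreover have "critical_pairs \<noteq> []" using critical_pairs_card(1) by force
  ultimately have "(x, c) \<in> set critical_pairs" using hd_in_set by metis
  then have "set c \<in> faces (facets_at x)" by (rule critical_pairsD(3))
  moreover obtain v w where "x = (v, w)" by (rule prod.exhaust)
  ultimately have "set c \<in> faces (facets_at (v, w))" by simp
  then show ?thesis unfolding mem_faces_facets_at by blast
qed

text \<open>Every tree pair attains the upper bound for the size of an acyclic matching, and every
  matching of that size comes from a tree pair. The left-hand side is completed by \<open>{}\<close>
  because the label complexes contain the empty face.\<close>

lemma pure_morse_complex_eq:
  assumes H: "hasse_edges K = enc ` (proper \<union> A)" and A: "A = {} \<or> A = range T"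
  shows "insert {} (pure_morse_complex K)
    = (`) enc ` {\<rho>. \<exists>f r F. (f, r, F) \<in> pairs \<and> \<rho> \<subseteq> V ` set (arcs f) \<union> Q ` set F \<union> (A \<inter> {T r})}"
proof -
  define S where "S f r F = V ` set (arcs f) \<union> Q ` set F \<union> (A \<inter> {T r})" for f r F
  \<comment> \<open>Three arcs in each tree, and one more pair when the solid tetrahedron is
    present.\<close>
  define N where "N = 6 + (if A = {} then 0 else 1 :: nat)"
  have fin: "finite W" if "acyclic_matching K W" for W
    using that finite_subset[of W "enc ` (proper \<union> A)"] H by (simp add: acyclic_matching_def is_matching_def)
  have S: "enc ` S f r F \<in> morse_complex K \<and> card (enc ` S f r F) = N" if p: "(f, r, F) \<in> pairs" for f r F
  proof -
    obtain g where fgr: "rooted f" "rooted g" "compatible (set (arcs f)) (set (arcs g))" "r = root g" "F = arcs g"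
      using p unfolding mem_pairs_iff by blast
    interpret tree_pair f g using fgr by unfold_locales
    have S_eq: "S f r F = labels A" unfolding S_def labels_def fgr(4,5) ..
    have "card (enc ` labels A) = card (labels A)" using inj_enc by (intro card_image) (rule inj_on_subset, auto)
    also have "\<dots> = N" using A by (auto simp: card_labels N_def)
    finally have c: "card (enc ` labels A) = N" .
    then have "enc ` labels A \<noteq> {}" by (auto simp: N_def)
    then show ?thesis
      using c acyclic_matching_labels[OF H A] by (simp add: S_eq morse_complex_def)
  qed
  have H1: "enc ` proper \<subseteq> hasse_edges K" "hasse_edges K \<subseteq> enc ` (proper \<union> range T)"
    using A unfolding H by blast+
  have W: "card W \<le> N \<and> (card W = N \<longrightarrow> (\<exists>f r F. (f, r, F) \<in> pairs \<and> W \<subseteq> enc ` S f r F))"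
    if "W \<in> morse_complex K" for W
  proof -
    have am: "acyclic_matching K W" using that by (simp add: morse_complex_def)
    note b = acyclic_matching_card[OF am H1]
    let ?W1 = "{e \<in> W. e \<notin> enc ` range T}" and ?W2 = "{e \<in> W. e \<in> enc ` range T}"
    have WH: "W \<subseteq> enc ` (proper \<union> A)" using am by (simp add: acyclic_matching_def is_matching_def H)
    have "W = ?W1 \<union> ?W2" by blast
    then have "card W = card (?W1 \<union> ?W2)" by (rule arg_cong)
    also have "\<dots> = card ?W1 + card ?W2" using fin[OF am] by (intro card_Un_disjoint) auto
    finally have cW: "card W = card ?W1 + card ?W2" .
    have noT: "?W2 = {}" if "A = {}"
    proof -
      have "enc a \<notin> enc ` range T" if "a \<in> proper" for a
        using that inj_enc by (auto simp: proper_def inj_image_mem_iff simp del: enc.simps)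
      then have "e \<notin> enc ` range T" if "e \<in> enc ` proper" for e using that by (elim imageE) simp
      moreover have "W \<subseteq> enc ` proper" using WH \<open>A = {}\<close> by simp
      ultimately show ?thesis by blast
    qed
    have W2: "card ?W2 \<le> (if A = {} then 0 else 1)" using b(2) noT by auto
    have "\<exists>f r F. (f, r, F) \<in> pairs \<and> W \<subseteq> enc ` S f r F" if "card W = N"
    proof -
      \<comment> \<open>At most \<open>N - 6\<close> edges of \<open>W\<close> involve the
        tetrahedron, so size \<open>N\<close> leaves no slack in the bound 6 for the others.\<close>
      have "card ?W1 = 6" using that cW W2 b(1) unfolding N_def by linarith
      then obtain f r F where p: "(f, r, F) \<in> pairs" "W \<subseteq> enc ` insert (T r) (V ` set (arcs f) \<union> Q ` set F)"
        using b(3) by blast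
      have "W \<subseteq> enc ` S f r F"
      proof (cases "A = {}")
        case True
        have "W \<subseteq> enc ` (V ` set (arcs f) \<union> Q ` set F)"
        proof
          fix e assume "e \<in> W"
          moreover from this have "e \<notin> enc ` range T" using noT[OF True] by blast
          ultimately show "e \<in> enc ` (V ` set (arcs f) \<union> Q ` set F)" using p(2) by blast
        qed
        then show ?thesis unfolding S_def by blast
      next
        case False
        then have "A \<inter> {T r} = {T r}" using A by auto
        then have "S f r F = insert (T r) (V ` set (arcs f) \<union> Q ` set F)" unfolding S_def by simp
        then show ?thesis using p(2) by simp
      qed
      then show ?thesis using p(1) by blast
    qed
    then show ?thesis using cW W2 b(1) unfolding N_def by auto
  qed
  obtain f0 r0 F0 where p0: "(f0, r0, F0) \<in> pairs" using pairs_nonempty by blast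
  have "insert {} (pure_morse_complex K) = {W. \<exists>f r F. (f, r, F) \<in> pairs \<and> W \<subseteq> enc ` S f r F}"
  proof (rule set_eqI, rule iffI)
    fix W0 assume "W0 \<in> insert {} (pure_morse_complex K)"
    then consider "W0 = {}" | U where "U \<in> morse_complex K" "W0 \<subseteq> U" "\<forall>U'\<in>morse_complex K. card U' \<le> card U"
      unfolding pure_morse_complex_def by blast
    then show "W0 \<in> {W. \<exists>f r F. (f, r, F) \<in> pairs \<and> W \<subseteq> enc ` S f r F}"
    proof cases
      case 1
      then show ?thesis using p0 by blast
    next
      case 2
      have "card U = N" using S[OF p0] W[OF 2(1)] 2(3) by (metis order_antisym)
      then show ?thesis using W[OF 2(1)] 2(2) by blast
    qed
  next
    fix W0 assume "W0 \<in> {W. \<exists>f r F. (f, r, F) \<in> pairs \<and> W \<subseteq> enc ` S f r F}"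
    then obtain f r F where p: "(f, r, F) \<in> pairs" "W0 \<subseteq> enc ` S f r F" by blast
    have "\<forall>U'\<in>morse_complex K. card U' \<le> card (enc ` S f r F)" using W S[OF p(1)] by metis
    then show "W0 \<in> insert {} (pure_morse_complex K)"
      using p(2) S[OF p(1)] unfolding pure_morse_complex_def by blast
  qed
  also have "\<dots> = (`) enc ` {\<rho>. \<exists>f r F. (f, r, F) \<in> pairs \<and> \<rho> \<subseteq> S f r F}"
  proof (rule set_eqI, rule iffI)
    fix W0 assume "W0 \<in> {W. \<exists>f r F. (f, r, F) \<in> pairs \<and> W \<subseteq> enc ` S f r F}"
    then obtain f r F where p: "(f, r, F) \<in> pairs" "W0 \<subseteq> enc ` S f r F" by blast
    then obtain \<rho> where "\<rho> \<subseteq> S f r F" "W0 = enc ` \<rho>" by (auto elim: subset_imageE)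
    then show "W0 \<in> (`) enc ` {\<rho>. \<exists>f r F. (f, r, F) \<in> pairs \<and> \<rho> \<subseteq> S f r F}" using p(1) by blast
  qed blast
  finally show ?thesis unfolding S_def .
qed

lemma realization_pure_morse_complex:
  assumes "insert {} (pure_morse_complex K) = (`) enc ` L"
  shows "realization (pure_morse_complex K) homotopy_equivalent_space top_of_set (geom L)"
proof -
  have "realization (pure_morse_complex K) = top_of_set (geom ((`) enc ` L))"
    using assms by (metis geom_insert_empty realization_eq_geom)
  then show ?thesis
    using geom_image_homeomorphic[OF inj_enc, of L]
    by (metis homeomorphic_imp_homotopy_equivalent_space homotopy_equivalent_space_sym)
qed

theorem mainTheorem12:
  shows "realization (pure_morse_complex full_simplex3)
           homotopy_equivalent_space realization (pure_morse_complex boundary_simplex3)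
       \<and> realization (pure_morse_complex boundary_simplex3)
           homotopy_equivalent_space wedge_spheres 81 3"
proof -
  have "insert {} (pure_morse_complex full_simplex3) = (`) enc ` Kf"
    using pure_morse_complex_eq[OF hasse_edges_full] by (simp add: Kf_def)
  then have full: "realization (pure_morse_complex full_simplex3) homotopy_equivalent_space top_of_set (geom K1)"
    using realization_pure_morse_complex Kf_homotopy_equivalent_K1 homotopy_eqv_trans by metis
  have "insert {} (pure_morse_complex boundary_simplex3) = (`) enc ` Kb"
    using pure_morse_complex_eq[of boundary_simplex3 "{}"] hasse_edges_boundary by (simp add: Kb_def)
  then have boundary: "realization (pure_morse_complex boundary_simplex3) homotopy_equivalent_space top_of_set (geom K1)"
    using realization_pure_morse_complex Kb_homotopy_equivalent_K1 homotopy_eqv_trans by metis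
  show ?thesis
    using full boundary K1_homotopy_equivalent_wedge homotopy_equivalent_space_sym homotopy_eqv_trans by metis
qed

end
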